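(* Let $T=(\pi,\lambda)$ be a hyperbolically self-similar IET on $[0,1)$ with self-similarity matrix $M$, and let $\omega\in\mathbb R^{\mathcal A}\setminus\{0\}$ satisfy $M\omega=\omega$. For $t\in\mathbb R$ let $\mu_t$ be the invariant probability measure of $f_t\in\operatorname{Aff}(T,t\omega)$, let $\nu_t$ be the $\phi_{t\omega}$-conformal measure for $T$, and let $\rho(t)$ be the logarithm of the Perron–Frobenius eigenvalue of $M(t\omega)$. Then for every $t\in\mathbb R$, $$\mathcal G(T,t\omega)=\rho(t)-t\rho'(0)\quad\text{and}\quad \mathcal H(T,t\omega)=\rho(t)-t\rho'(t).$$ In particular, $$\dim_H(\mu_t)=\frac{\rho(0)}{\rho(t)-\rho'(0)t}\quad\text{and}\quad \dim_H(\nu_t)=\frac{\rho(t)-\rho'(t)t}{\rho(0)}.$$ Moreover, for $t\ne0$, $$\frac{d}{dt}\Big(\frac{1}{t\dim_H(\mu_t)}\Big)=-\frac{\dim_H(\nu_t)}{t^2}.$$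
   Context: **AIETs.** Let $\mathcal A$ be a finite alphabet with $d\ge 2$ letters. A permutation is a pair $\pi=(\pi_t,\pi_b)$ of bijections $\mathcal A\to\{1,\dots,d\}$, always assumed irreducible: $\pi_t^{-1}\{1,\dots,k\}\ne\pi_b^{-1}\{1,\dots,k\}$ for $1\le k<d$. An affine interval exchange transformation (AIET) $f=(\pi,\lambda,\omega)$, with $\lambda\in\mathbb R_{>0}^{\mathcal A}$ and log-slope vector $\omega\in\mathbb R^{\mathcal A}$, is a bijection of $I=[0,\sum_\alpha\lambda_\alpha)$ which maps each interval of the partition of $I$ into left-closed right-open intervals $I_\alpha=I_\alpha(f)$ of lengths $\lambda_\alpha$ (ordered from left to right according to $\pi_t$) affinely with slope $e^{\omega_\alpha}$, the images $f(I_\alpha)$ being ordered from left to right according to $\pi_b$. An IET $T=(\pi,\lambda)$ is an AIET with $\omega=0$. **Rauzy–Veech induction.** Put $\alpha(\varepsilon)=\pi_\varepsilon^{-1}(d)$, $\varepsilon\in\{t,b\}$. If $|I_{\alpha(t)}|>|f(I_{\alpha(b)})|$ (top type, winner $\alpha(t)$), set $I^{(1)}=I\setminus f(I_{\alpha(b)})$, $I^{(1)}_{\alpha(t)}=I_{\alpha(t)}\setminus f(I_{\alpha(b)})$ and $I^{(1)}_\alpha=I_\alpha$ for the other letters. If $|I_{\alpha(t)}|<|f(I_{\alpha(b)})|$ (bottom type, winner $\alpha(b)$), set $I^{(1)}=I\setminus I_{\alpha(t)}$, $I^{(1)}_{\alpha(t)}=f^{-1}(I_{\alpha(t)})$, $I^{(1)}_{\alpha(b)}=I_{\alpha(b)}\setminus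 f^{-1}(I_{\alpha(t)})$ and $I^{(1)}_\alpha=I_\alpha$ for the other letters. The first return map of $f$ to $I^{(1)}$ is an AIET exchanging the $I^{(1)}_\alpha$. If this can be iterated forever (no equality of lengths occurs), $f$ is infinitely renormalizable; one gets intervals $I^{(n)}$, $I^{(n)}_\alpha=I^{(n)}_\alpha(f)$, permutations $\pi^{(n)}$ and return times $q^{(n)}_\alpha$ such that the first return map of $f$ to $I^{(n)}$ equals $f^{q^{(n)}_\alpha}$ on $I^{(n)}_\alpha$. The combinatorial rotation number $\gamma(f)$ is the infinite sequence of pairs ($\pi^{(n)}$, type of step $n$), $n\ge0$; it is $\infty$-complete if every letter is a winner infinitely often. **Hyperbolic self-similarity.** An IET $T=(\pi,\lambda)$ on $[0,1)$ is self-similar if $\gamma(T)$ is $\infty$-complete and periodic. For a period $N$, the self-similarity matrix is $M=M(T)$, $M_{\alpha\beta}=\#\{0\le k<q^{(N)}_\alpha: T^kI^{(N)}_\alpha\subset I_\beta\}$; then $\lambda M=e^{\rho_T}\lambda$, where $\rho_T>0$ is the logarithm of the Perron–Frobenius eigenvalue of $M$. Let $\Omega_\pi$ be the matrix with $(\Omega_\pi)_{\alpha\beta}=1$ if $\pi_b(\alpha)>\pi_b(\beta),\pi_t(\alpha)<\pi_t(\beta)$; $-1$ if $\pi_b(\alpha)<\pi_b(\beta),\pi_t(\alpha)>\pi_t(\beta)$; $0$ otherwise; put $\kappa-1=\dim\ker\Omega_\pi$ and $2g=d-(\kappa-1)$. $T$ is hyperbolically self-similar if it is self-similar and $M$ has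 $g$ simple real eigenvalues of modulus $>1$ and $g$ simple real eigenvalues of modulus $<1$, all with pairwise distinct moduli, and eigenvalue $1$ with $\kappa-1$ independent fixed (right) vectors. Convention: $N$ is replaced by a multiple so that all entries and all eigenvalues of $M$ are positive. **Aff and measures.** $\operatorname{Aff}(T,\omega)$ is the set of AIETs $f$ on $[0,1)$ with log-slope vector $\omega$ and $\gamma(f)=\gamma(T)$; it is non-empty iff $\langle\omega,\lambda\rangle=0$ (which holds when $M\omega=\omega$), and its elements are uniquely ergodic. For $v\in\mathbb R^{\mathcal A}$, $\phi_v:[0,1)\to\mathbb R$ equals $v_\alpha$ on $I_\alpha(T)$; a Borel probability $\nu$ is $\phi_v$-conformal for $T$ if $T_*\nu\sim\nu$ and $\frac{d(T^{-1})_*\nu}{d\nu}=e^{\phi_v}$; for $v=t\omega$ with $M\omega=\omega$ it exists and is unique. **Matrices and the quantities $\mathcal G,\mathcal H$.** Here $I_\alpha,I_\alpha^{(N)},q_\alpha^{(N)}$ refer to $T$, $S_i\phi(x)=\sum_{0\le k<i}\phi(T^kx)$, and $\beta(\alpha,i)$ is the letter with $T^iI^{(N)}_\alpha\subset I_{\beta(\alpha,i)}$. Put $M(v)_{\alpha\beta}=\sum_{0\le k<q^{(N)}_\alpha,\ \beta(\alpha,k)=\beta}e^{S_k\phi_v|_{I^{(N)}_\alpha}}$. For $v$ with $Mv=v$: let $\rho_v$ be the logarithm of the Perron–Frobenius eigenvalue of $M(v)$, and let $\ell^v,\theta^v\in\mathbb R_{>0}^{\mathcal A}$ be its left and right Perron–Frobenius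 eigenvectors with $\sum_\alpha\ell^v_\alpha=1$, $\langle\ell^v,\theta^v\rangle=1$; let $\theta=\theta^0$ (so $M\theta=e^{\rho_T}\theta$, $\langle\lambda,\theta\rangle=1$). Then $$\mathcal G(T,v)=\rho_v-\sum_{\alpha}\sum_{0\le i<q^{(N)}_\alpha}\theta_{\beta(\alpha,i)}e^{-\rho_T}\lambda_\alpha\,S_i\phi_v|_{I^{(N)}_\alpha},$$ $$\mathcal H(T,v)=\rho_v-\sum_{\alpha}\sum_{0\le i<q^{(N)}_\alpha}\theta^v_{\beta(\alpha,i)}e^{-\rho_v}\ell^v_\alpha e^{S_i\phi_v|_{I^{(N)}_\alpha}}S_i\phi_v|_{I^{(N)}_\alpha}.$$ **Dimension.** For a Borel probability $\mu$ on $\mathbb R$, $\dim_H(\mu)=\inf\{\dim_H(E): E\text{ Borel},\ \mu(E)=1\}$. *)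

theory Defs
  imports "HOL-Analysis.Analysis" "HOL-Probability.Probability"
    "HOL-Computational_Algebra.Polynomial"
begin

text \<open>The alphabet is a finite type. A permutation is the pair of its top and bottom
  orderings, with values in \<open>{1..d}\<close>.\<close>

type_synonym 'a perm_pair = "('a \<Rightarrow> nat) \<times> ('a \<Rightarrow> nat)"

definition irreducible_perm :: "'a::finite perm_pair \<Rightarrow> bool" where
  "irreducible_perm p \<longleftrightarrow>
     bij_betw (fst p) UNIV {1..CARD('a)} \<and> bij_betw (snd p) UNIV {1..CARD('a)} \<and>
     (\<forall>k. 1 \<le> k \<and> k < CARD('a) \<longrightarrow> fst p -` {1..k} \<noteq> snd p -` {1..k})"

record ('a::finite) aiet =
  perm :: "'a perm_pair"
  len :: "real ^ 'a"
  logslope :: "real ^ 'a"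

text \<open>The last equation says that the images of the exchanged intervals fill up the domain.\<close>

definition is_aiet :: "'a::finite aiet \<Rightarrow> bool" where
  "is_aiet f \<longleftrightarrow> irreducible_perm (perm f) \<and> (\<forall>\<alpha>. 0 < len f $ \<alpha>) \<and>
     (\<Sum>\<alpha>\<in>UNIV. exp (logslope f $ \<alpha>) * len f $ \<alpha>) = (\<Sum>\<alpha>\<in>UNIV. len f $ \<alpha>)"

definition is_iet :: "'a::finite aiet \<Rightarrow> bool" where
  "is_iet T \<longleftrightarrow> is_aiet T \<and> logslope T = 0"

definition aiet_domain :: "'a::finite aiet \<Rightarrow> real set" where
  "aiet_domain f = {0..<(\<Sum>\<alpha>\<in>UNIV. len f $ \<alpha>)}"

definition top_end :: "'a::finite aiet \<Rightarrow> 'a \<Rightarrow> real" where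
  "top_end f \<alpha> = (\<Sum>\<beta> | fst (perm f) \<beta> < fst (perm f) \<alpha>. len f $ \<beta>)"

definition bot_end :: "'a::finite aiet \<Rightarrow> 'a \<Rightarrow> real" where
  "bot_end f \<alpha> = (\<Sum>\<beta> | snd (perm f) \<beta> < snd (perm f) \<alpha>. exp (logslope f $ \<beta>) * len f $ \<beta>)"

definition aiet_interval :: "'a::finite aiet \<Rightarrow> 'a \<Rightarrow> real set" where
  "aiet_interval f \<alpha> = {top_end f \<alpha>..<top_end f \<alpha> + len f $ \<alpha>}"

text \<open>The map is extended by the identity outside its domain; it is then a bijection of the
  whole real line, so that its inverse can be taken on the type.\<close>

definition aiet_map :: "'a::finite aiet \<Rightarrow> real \<Rightarrow> real" where
  "aiet_map f x =
     (if x \<in> aiet_domain f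
      then let \<alpha> = (THE \<alpha>. x \<in> aiet_interval f \<alpha>)
           in bot_end f \<alpha> + exp (logslope f $ \<alpha>) * (x - top_end f \<alpha>)
      else x)"

definition first_return_time :: "('x \<Rightarrow> 'x) \<Rightarrow> 'x set \<Rightarrow> 'x \<Rightarrow> nat" where
  "first_return_time F A x = (LEAST k. 1 \<le> k \<and> (F ^^ k) x \<in> A)"

definition first_return :: "('x \<Rightarrow> 'x) \<Rightarrow> 'x set \<Rightarrow> 'x \<Rightarrow> 'x" where
  "first_return F A x = (F ^^ first_return_time F A x) x"

definition position :: "('a \<Rightarrow> real set) \<Rightarrow> 'a \<Rightarrow> nat" where
  "position J \<alpha> = card {\<beta>. Inf (J \<beta>) \<le> Inf (J \<alpha>)}"

text \<open>The permutation of a map \<open>g\<close> exchanging the disjoint intervals \<open>J \<alpha>\<close>: the orders from left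
  to right of these intervals and of their images.\<close>

definition exchange_perm :: "(real \<Rightarrow> real) \<Rightarrow> ('a \<Rightarrow> real set) \<Rightarrow> 'a perm_pair" where
  "exchange_perm g J = (position J, position (\<lambda>\<alpha>. g ` J \<alpha>))"

definition last_top :: "'a::finite perm_pair \<Rightarrow> 'a" where
  "last_top p = (THE \<alpha>. fst p \<alpha> = CARD('a))"

definition last_bot :: "'a::finite perm_pair \<Rightarrow> 'a" where
  "last_bot p = (THE \<alpha>. snd p \<alpha> = CARD('a))"

text \<open>One step for a map \<open>g\<close> exchanging the intervals \<open>J \<alpha>\<close>. In the case of equal lengths, where
  the induction is not defined, the intervals are left unchanged; this case is excluded by
  infinite renormalizability below.\<close>

definition rv_step :: "(real \<Rightarrow> real) \<Rightarrow> ('a::finite \<Rightarrow> real set) \<Rightarrow> 'a \<Rightarrow> real set" where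
  "rv_step g J =
     (let a = last_top (exchange_perm g J);
          b = last_bot (exchange_perm g J);
          P = {x \<in> (\<Union>\<alpha>. J \<alpha>). g x \<in> J a}
      in if measure lborel (J a) > measure lborel (g ` J b) then J(a := J a - g ` J b)
         else if measure lborel (J a) < measure lborel (g ` J b) then J(a := P, b := J b - P)
         else J)"

text \<open>The intervals $I^{(n)}_\alpha$, their union $I^{(n)}$, the first return map to it, the
  permutation $\pi^{(n)}$ and the return times $q^{(n)}_\alpha$.\<close>

primrec rv_interval :: "'a::finite aiet \<Rightarrow> nat \<Rightarrow> 'a \<Rightarrow> real set" where
  "rv_interval f 0 = aiet_interval f"
| "rv_interval f (Suc n) =
     rv_step (first_return (aiet_map f) (\<Union>\<alpha>. rv_interval f n \<alpha>)) (rv_interval f n)"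

definition rv_domain :: "'a::finite aiet \<Rightarrow> nat \<Rightarrow> real set" where
  "rv_domain f n = (\<Union>\<alpha>. rv_interval f n \<alpha>)"

definition rv_map :: "'a::finite aiet \<Rightarrow> nat \<Rightarrow> real \<Rightarrow> real" where
  "rv_map f n = first_return (aiet_map f) (rv_domain f n)"

definition rv_perm :: "'a::finite aiet \<Rightarrow> nat \<Rightarrow> 'a perm_pair" where
  "rv_perm f n = exchange_perm (rv_map f n) (rv_interval f n)"

definition rv_time :: "'a::finite aiet \<Rightarrow> nat \<Rightarrow> 'a \<Rightarrow> nat" where
  "rv_time f n \<alpha> =
     (THE q. \<forall>x\<in>rv_interval f n \<alpha>. first_return_time (aiet_map f) (rv_domain f n) x = q)"

definition rv_top_length :: "'a::finite aiet \<Rightarrow> nat \<Rightarrow> real" where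
  "rv_top_length f n = measure lborel (rv_interval f n (last_top (rv_perm f n)))"

definition rv_bot_length :: "'a::finite aiet \<Rightarrow> nat \<Rightarrow> real" where
  "rv_bot_length f n = measure lborel (rv_map f n ` rv_interval f n (last_bot (rv_perm f n)))"

definition infinitely_renormalizable :: "'a::finite aiet \<Rightarrow> bool" where
  "infinitely_renormalizable f \<longleftrightarrow> (\<forall>n. rv_top_length f n \<noteq> rv_bot_length f n)"

datatype rv_type = Top | Bottom

definition rv_step_type :: "'a::finite aiet \<Rightarrow> nat \<Rightarrow> rv_type" where
  "rv_step_type f n = (if rv_top_length f n > rv_bot_length f n then Top else Bottom)"

definition rv_winner :: "'a::finite aiet \<Rightarrow> nat \<Rightarrow> 'a" where
  "rv_winner f n =
     (case rv_step_type f n of Top \<Rightarrow> last_top (rv_perm f n) | Bottom \<Rightarrow> last_bot (rv_perm f n))"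

definition rotation_number :: "'a::finite aiet \<Rightarrow> nat \<Rightarrow> 'a perm_pair \<times> rv_type" where
  "rotation_number f n = (rv_perm f n, rv_step_type f n)"

definition infinity_complete :: "'a::finite aiet \<Rightarrow> bool" where
  "infinity_complete f \<longleftrightarrow> (\<forall>\<alpha>. \<exists>\<^sub>\<infinity>n. rv_winner f n = \<alpha>)"

definition complex_eigenvalues :: "real ^ 'n ^ 'n \<Rightarrow> complex set" where
  "complex_eigenvalues A =
     {z. \<exists>x::complex ^ 'n. x \<noteq> 0 \<and> (\<chi> i j. complex_of_real (A $ i $ j)) *v x = z *s x}"

definition charpoly :: "real ^ 'n ^ 'n \<Rightarrow> real poly" where
  "charpoly A = det (\<chi> i j. (if i = j then [:0, 1:] else 0) - [:A $ i $ j:])"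

definition simple_eigenvalue :: "real ^ 'n ^ 'n \<Rightarrow> real \<Rightarrow> bool" where
  "simple_eigenvalue A r \<longleftrightarrow> order r (charpoly A) = 1"

text \<open>For a nonnegative matrix the Perron--Frobenius eigenvalue is the spectral radius.\<close>

definition pf_eigenvalue :: "real ^ 'n ^ 'n \<Rightarrow> real" where
  "pf_eigenvalue A = Max (norm ` complex_eigenvalues A)"

definition pf_left :: "real ^ 'n ^ 'n \<Rightarrow> real ^ 'n" where
  "pf_left A = (THE l. (\<forall>i. 0 < l $ i) \<and> l v* A = pf_eigenvalue A *s l \<and> (\<Sum>i\<in>UNIV. l $ i) = 1)"

definition pf_right :: "real ^ 'n ^ 'n \<Rightarrow> real ^ 'n" where
  "pf_right A = (THE r. (\<forall>i. 0 < r $ i) \<and> A *v r = pf_eigenvalue A *s r \<and> pf_left A \<bullet> r = 1)"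

definition is_period :: "'a::finite aiet \<Rightarrow> nat \<Rightarrow> bool" where
  "is_period T N \<longleftrightarrow> 1 \<le> N \<and> (\<forall>n. rotation_number T (n + N) = rotation_number T n)"

definition self_similar :: "'a::finite aiet \<Rightarrow> bool" where
  "self_similar T \<longleftrightarrow> is_iet T \<and> aiet_domain T = {0..<1} \<and>
     infinitely_renormalizable T \<and> infinity_complete T \<and> (\<exists>N. is_period T N)"

definition ss_matrix :: "'a::finite aiet \<Rightarrow> nat \<Rightarrow> real ^ 'a ^ 'a" where
  "ss_matrix T N = (\<chi> \<alpha> \<beta>.
     real (card {k. k < rv_time T N \<alpha> \<and>
                    (aiet_map T ^^ k) ` rv_interval T N \<alpha> \<subseteq> aiet_interval T \<beta>}))"

definition omega_matrix :: "'a::finite perm_pair \<Rightarrow> real ^ 'a ^ 'a" where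
  "omega_matrix p = (\<chi> \<alpha> \<beta>.
     if snd p \<alpha> > snd p \<beta> \<and> fst p \<alpha> < fst p \<beta> then 1
     else if snd p \<alpha> < snd p \<beta> \<and> fst p \<alpha> > fst p \<beta> then - 1
     else 0)"

definition kernel_dim :: "'a::finite perm_pair \<Rightarrow> nat" where
  "kernel_dim p = dim {x. omega_matrix p *v x = 0}"

text \<open>The difference is even, being the rank of an antisymmetric matrix.\<close>

definition genus :: "'a::finite perm_pair \<Rightarrow> nat" where
  "genus p = (CARD('a) - kernel_dim p) div 2"

text \<open>The period \<open>N\<close> is part of the data, since the self-similarity matrix depends on it. The last
  two conditions are the normalization obtained by passing to a multiple of the period.\<close>

definition hyperbolically_self_similar :: "'a::finite aiet \<Rightarrow> nat \<Rightarrow> bool" where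
  "hyperbolically_self_similar T N \<longleftrightarrow>
     self_similar T \<and> is_period T N \<and>
     (\<exists>U S. finite U \<and> card U = genus (perm T) \<and> (\<forall>r\<in>U. \<bar>r\<bar> > 1) \<and>
            finite S \<and> card S = genus (perm T) \<and> (\<forall>r\<in>S. \<bar>r\<bar> < 1) \<and>
            (\<forall>r\<in>U \<union> S. simple_eigenvalue (ss_matrix T N) r) \<and> inj_on abs (U \<union> S)) \<and>
     dim {x. ss_matrix T N *v x = x} = kernel_dim (perm T) \<and>
     (\<forall>\<alpha> \<beta>. 0 < ss_matrix T N $ \<alpha> $ \<beta>) \<and>
     (\<forall>z\<in>complex_eigenvalues (ss_matrix T N). \<exists>r>0. z = complex_of_real r)"

definition Aff :: "'a::finite aiet \<Rightarrow> real ^ 'a \<Rightarrow> 'a aiet set" where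
  "Aff T \<omega> = {f. is_aiet f \<and> aiet_domain f = {0..<1} \<and> logslope f = \<omega> \<and>
                 infinitely_renormalizable f \<and> rotation_number f = rotation_number T}"

definition phi :: "'a::finite aiet \<Rightarrow> real ^ 'a \<Rightarrow> real \<Rightarrow> real" where
  "phi T v x = (\<Sum>\<alpha>\<in>UNIV. v $ \<alpha> * indicator (aiet_interval T \<alpha>) x)"

text \<open>Measures on the unit interval are Borel measures on the line that give it full mass.\<close>

definition borel_prob_on :: "real set \<Rightarrow> real measure \<Rightarrow> bool" where
  "borel_prob_on A \<mu> \<longleftrightarrow> prob_space \<mu> \<and> sets \<mu> = sets borel \<and> emeasure \<mu> A = 1"

definition invariant_prob :: "'a::finite aiet \<Rightarrow> real measure \<Rightarrow> bool" where
  "invariant_prob f \<mu> \<longleftrightarrow> borel_prob_on (aiet_domain f) \<mu> \<and> distr \<mu> borel (aiet_map f) = \<mu>"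

definition conformal_prob :: "'a::finite aiet \<Rightarrow> (real \<Rightarrow> real) \<Rightarrow> real measure \<Rightarrow> bool" where
  "conformal_prob T \<phi> \<nu> \<longleftrightarrow> borel_prob_on (aiet_domain T) \<nu> \<and>
     absolutely_continuous \<nu> (distr \<nu> borel (aiet_map T)) \<and>
     absolutely_continuous (distr \<nu> borel (aiet_map T)) \<nu> \<and>
     distr \<nu> borel (inv (aiet_map T)) = density \<nu> (\<lambda>x. ennreal (exp (\<phi> x)))"

definition birkhoff_sum :: "(real \<Rightarrow> real) \<Rightarrow> nat \<Rightarrow> (real \<Rightarrow> real) \<Rightarrow> real \<Rightarrow> real" where
  "birkhoff_sum F i \<phi> x = (\<Sum>k<i. \<phi> ((F ^^ k) x))"

text \<open>The constant value of $S_i\phi_v$ on $I^{(N)}_\alpha$ (for $i \le q^{(N)}_\alpha$).\<close>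

definition S_val :: "'a::finite aiet \<Rightarrow> nat \<Rightarrow> real ^ 'a \<Rightarrow> 'a \<Rightarrow> nat \<Rightarrow> real" where
  "S_val T N v \<alpha> i = (THE c. \<forall>x\<in>rv_interval T N \<alpha>. birkhoff_sum (aiet_map T) i (phi T v) x = c)"

definition visited :: "'a::finite aiet \<Rightarrow> nat \<Rightarrow> 'a \<Rightarrow> nat \<Rightarrow> 'a" where
  "visited T N \<alpha> i = (THE \<beta>. (aiet_map T ^^ i) ` rv_interval T N \<alpha> \<subseteq> aiet_interval T \<beta>)"

definition twisted_matrix :: "'a::finite aiet \<Rightarrow> nat \<Rightarrow> real ^ 'a \<Rightarrow> real ^ 'a ^ 'a" where
  "twisted_matrix T N v = (\<chi> \<alpha> \<beta>.
     \<Sum>k | k < rv_time T N \<alpha> \<and> visited T N \<alpha> k = \<beta>. exp (S_val T N v \<alpha> k))"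

definition rho :: "'a::finite aiet \<Rightarrow> nat \<Rightarrow> real ^ 'a \<Rightarrow> real" where
  "rho T N v = ln (pf_eigenvalue (twisted_matrix T N v))"

definition rho_T :: "'a::finite aiet \<Rightarrow> nat \<Rightarrow> real" where
  "rho_T T N = ln (pf_eigenvalue (ss_matrix T N))"

definition ell :: "'a::finite aiet \<Rightarrow> nat \<Rightarrow> real ^ 'a \<Rightarrow> real ^ 'a" where
  "ell T N v = pf_left (twisted_matrix T N v)"

definition theta :: "'a::finite aiet \<Rightarrow> nat \<Rightarrow> real ^ 'a \<Rightarrow> real ^ 'a" where
  "theta T N v = pf_right (twisted_matrix T N v)"

definition G_quantity :: "'a::finite aiet \<Rightarrow> nat \<Rightarrow> real ^ 'a \<Rightarrow> real" where
  "G_quantity T N v = rho T N v -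
     (\<Sum>\<alpha>\<in>UNIV. \<Sum>i<rv_time T N \<alpha>.
        theta T N 0 $ visited T N \<alpha> i * exp (- rho_T T N) * len T $ \<alpha> * S_val T N v \<alpha> i)"

definition H_quantity :: "'a::finite aiet \<Rightarrow> nat \<Rightarrow> real ^ 'a \<Rightarrow> real" where
  "H_quantity T N v = rho T N v -
     (\<Sum>\<alpha>\<in>UNIV. \<Sum>i<rv_time T N \<alpha>.
        theta T N v $ visited T N \<alpha> i * exp (- rho T N v) * ell T N v $ \<alpha> *
        exp (S_val T N v \<alpha> i) * S_val T N v \<alpha> i)"

definition hausdorff_content :: "real \<Rightarrow> real \<Rightarrow> real set \<Rightarrow> ennreal" where
  "hausdorff_content s \<delta> E =
     (INF U\<in>{U :: nat \<Rightarrow> real set. E \<subseteq> (\<Union>i. U i) \<and> (\<forall>i. bounded (U i) \<and> diameter (U i) \<le> \<delta>)}.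
        \<Sum>i. ennreal (diameter (U i) powr s))"

definition hausdorff_outer :: "real \<Rightarrow> real set \<Rightarrow> ennreal" where
  "hausdorff_outer s E = (SUP \<delta>\<in>{0<..}. hausdorff_content s \<delta> E)"

text \<open>Restricting to positive exponents avoids the convention for \<open>0 powr 0\<close>. The infimum is
  over a nonempty set, since every exponent above 1 belongs to it.\<close>

definition hausdorff_dim :: "real set \<Rightarrow> real" where
  "hausdorff_dim E = Inf {s. 0 < s \<and> hausdorff_outer s E = 0}"

definition dim_H :: "real measure \<Rightarrow> real" where
  "dim_H \<mu> = Inf (hausdorff_dim ` {E. E \<in> sets borel \<and> emeasure \<mu> E = 1})"

end

theory Submission
  imports Defs
begin

text \<open>A point of \<open>[0, 1)\<close> is coded by the towers over the induction intervals of order \<open>n N\<close>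
  containing it. Since \<open>M \<omega> = \<omega>\<close>, the first return map to such an interval has the same log-slopes as
  the original map, so every measure for which \<open>f\<close> has Jacobian \<open>exp (s \<omega>)\<close> gives the cylinder of
  order \<open>n\<close> with Birkhoff sum \<open>S\<close> the mass \<open>exp (s S - n \<rho> s)\<close> up to constants. The invariant measure of
  \<open>f\<^sub>t\<close> is the case \<open>s = 0\<close>, Lebesgue measure is the case \<open>s = t\<close> for \<open>f\<^sub>t\<close> and \<open>s = 0\<close> for \<open>T\<close>, and \<open>\<nu>\<^sub>s\<close> is
  conformal for \<open>T\<close>. The sum of \<open>exp (u S)\<close> over the cylinders of order \<open>n\<close> grows like \<open>exp (n \<rho> u)\<close>, so,
  \<open>\<rho>\<close> being differentiable, \<open>S\<close> is close to \<open>n \<rho>' s\<close> outside an exponentially small set. Masses and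
  lengths of typical cylinders are therefore \<open>exp (- n (\<rho> s - s \<rho>' s))\<close> and \<open>exp (- n (\<rho> t - t \<rho>' s))\<close>,
  and the dimension is the quotient of these exponents.\<close>

section \<open>Perron--Frobenius theory of positive matrices\<close>

text \<open>The masses of the bases of order \<open>n N\<close> form a row vector \<open>x n\<close>
  with \<open>x n = x (Suc n) v* M s\<close> for every \<open>n\<close>. A nonnegative orbit that
  can be traced back indefinitely must be the Perron one, so the mass of a base is not merely
  comparable but equal to \<open>exp (- n * \<rho> s) * \<l> s $ \<alpha>\<close>. This one argument
  covers invariant, Lebesgue and conformal measures. It also identifies \<open>len T\<close> with
  the left eigenvector at 0, so that the sum in \<open>G_quantity\<close>, like the one in
  \<open>H_quantity\<close>, becomes the perturbation formula for the derivative of the eigenvalue.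
  The obstacle is that \<open>f\<close> in \<open>Aff T (t *\<^sub>R \<omega>)\<close> is tied to
  \<open>T\<close> only by its rotation number, while intervals, return times and matrices are
  defined geometrically; all of them are therefore expressed through words that depend on the
  rotation number alone. The dimension of \<open>\<mu>\<^sub>t\<close> has the denominator
  \<open>\<rho> t - t * \<rho>' 0\<close>. Its positivity comes from counting cylinders: the
  entropy, here \<open>\<rho> 0 > 0\<close>, never exceeds the Lyapunov exponent.\<close>

locale positive_matrix =
  fixes A :: "real ^ 'n ^ 'n"
  assumes pos: "0 < A $ i $ j"

lemma positive_matrix_transpose: "positive_matrix A \<Longrightarrow> positive_matrix (transpose A)"
  by (simp add: positive_matrix_def transpose_def)

context positive_matrix
begin

lemma mult_pos_vec:
  assumes "\<And>i. 0 \<le> x $ i" "x \<noteq> 0"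
  shows "0 < (A *v x) $ i"
proof -
  obtain k where k: "x $ k \<noteq> 0" using assms(2) by (metis vec_eq_iff zero_index)
  have "0 < (\<Sum>j\<in>UNIV. A $ i $ j * x $ j)"
    by (rule sum_pos2[where i = k]) (use k assms(1) pos in \<open>auto simp: less_le mult_nonneg_nonneg\<close>)
  then show ?thesis by (simp add: matrix_vector_mult_def)
qed

text \<open>Brouwer's fixed point theorem on the probability simplex, for the map that applies
  \<open>A\<close> and rescales the coordinate sum to 1; the scaling factor is the
  eigenvalue.\<close>

lemma ex_right_eigenvector: "\<exists>r x. 0 < r \<and> (\<forall>i. 0 < x $ i) \<and> A *v x = r *s x"
proof -
  define S where "S = {x :: real ^ 'n. (\<forall>i. 0 \<le> x $ i) \<and> (\<Sum>i\<in>UNIV. x $ i) = 1}"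
  define f where "f x = (1 / (\<Sum>i\<in>UNIV. (A *v x) $ i)) *\<^sub>R (A *v x)" for x
  have nz: "x \<noteq> 0" if "x \<in> S" for x using that by (auto simp: S_def)
  have Apos: "0 < (A *v x) $ i" if "x \<in> S" for x i
    using mult_pos_vec[of x i] nz[OF that] that by (auto simp: S_def)
  have sumpos: "0 < (\<Sum>i\<in>UNIV. (A *v x) $ i)" if "x \<in> S" for x
    by (rule sum_pos) (use Apos[OF that] in auto)
  have "closed S"
  proof -
    have "S = (\<Inter>i. {x. 0 \<le> x $ i}) \<inter> {x. (\<Sum>i\<in>UNIV. x $ i) = 1}" by (auto simp: S_def)
    moreover have "closed {x :: real ^ 'n. 0 \<le> x $ i}" for i
      by (intro closed_Collect_le continuous_intros)
    moreover have "closed {x :: real ^ 'n. (\<Sum>i\<in>UNIV. x $ i) = 1}"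
      by (intro closed_Collect_eq continuous_intros)
    ultimately show ?thesis by auto
  qed
  moreover have "bounded S"
  proof (rule boundedI)
    fix x assume x: "x \<in> S"
    have "norm x \<le> (\<Sum>i\<in>UNIV. \<bar>x $ i\<bar>)" by (rule norm_le_l1_cart)
    also have "\<dots> = 1" using x by (auto simp: S_def)
    finally show "norm x \<le> 1" .
  qed
  ultimately have "compact S" by (simp add: compact_eq_bounded_closed)
  moreover have "convex S"
    by (auto simp: S_def convex_def sum.distrib simp flip: sum_distrib_left)
  moreover have "S \<noteq> {}"
    by (auto simp: S_def intro!: exI[of _ "\<chi> i. 1 / real CARD('n)"])
  moreover have "continuous_on S f"
    unfolding f_def
    by (intro continuous_intros matrix_vector_mult_linear_continuous_on)
      (use sumpos in \<open>auto simp: less_le\<close>)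
  moreover have "f \<in> S \<rightarrow> S"
  proof
    fix x assume x: "x \<in> S"
    show "f x \<in> S"
      using sumpos[OF x] Apos[OF x]
      by (auto simp: S_def f_def less_imp_le simp flip: sum_divide_distrib)
  qed
  ultimately obtain x where x: "x \<in> S" "f x = x" by (rule brouwer)
  let ?r = "\<Sum>i\<in>UNIV. (A *v x) $ i"
  have "A *v x = ?r *s x"
  proof -
    have "?r *\<^sub>R f x = A *v x" using sumpos[OF x(1)] by (simp add: f_def)
    then show ?thesis using x(2) by (simp add: scalar_mult_eq_scaleR)
  qed
  moreover have "0 < x $ i" for i
  proof -
    have "?r * x $ i > 0"
      using Apos[OF x(1), of i] arg_cong[OF calculation, of "\<lambda>v. v $ i"] by (metis vector_smult_component)
    then show ?thesis using sumpos[OF x(1)] by (simp add: zero_less_mult_iff)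
  qed
  ultimately show ?thesis using sumpos[OF x(1)] by blast
qed

text \<open>The eigenvalues found for \<open>A\<close> and for its transpose agree because the
  pairing of the two positive eigenvectors is nonzero.\<close>

lemma ex_eigenvectors:
  "\<exists>r l x. 0 < r \<and> (\<forall>i. 0 < l $ i) \<and> (\<forall>i. 0 < x $ i) \<and> A *v x = r *s x \<and> l v* A = r *s l"
proof -
  interpret tr: positive_matrix "transpose A"
    using positive_matrix_transpose positive_matrix_axioms .
  obtain r x where x: "0 < r" "\<forall>i. 0 < x $ i" "A *v x = r *s x"
    using ex_right_eigenvector by blast
  obtain r' l where l: "0 < r'" "\<forall>i. 0 < l $ i" "transpose A *v l = r' *s l"
    using tr.ex_right_eigenvector by blast
  have l': "l v* A = r' *s l" using l(3) by simp
  have "0 < l \<bullet> x" unfolding inner_vec_def by (rule sum_pos) (use l x in auto)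
  moreover have "r' * (l \<bullet> x) = r * (l \<bullet> x)"
    using dot_lmul_matrix[of l A x] l' x(3) by (simp add: scalar_mult_eq_scaleR)
  ultimately have "r' = r" by simp
  then show ?thesis using l' l(2) x by blast
qed

text \<open>By the triangle inequality the moduli \<open>u\<close> of a complex eigenvector satisfy
  \<open>norm z * u \<le> A *v u\<close> coordinatewise; pairing with the positive left eigenvector
  compares \<open>norm z\<close> with \<open>r\<close>.\<close>

lemma complex_eigenvalue_norm_le:
  assumes "\<forall>i. 0 < l $ i" "l v* A = r *s l" and z: "z \<in> complex_eigenvalues A"
  shows "norm z \<le> r"
proof -
  let ?A = "\<chi> i j. complex_of_real (A $ i $ j)"
  obtain y where y: "y \<noteq> 0" "?A *v y = z *s y"
    using z unfolding complex_eigenvalues_def by blast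
  define u :: "real ^ 'n" where "u = (\<chi> i. norm (y $ i))"
  have le: "norm z * u $ i \<le> (A *v u) $ i" for i
  proof -
    have "z * y $ i = (\<Sum>j\<in>UNIV. of_real (A $ i $ j) * y $ j)"
      using arg_cong[OF y(2), of "\<lambda>v. v $ i"] by (simp add: matrix_vector_mult_def)
    then have "norm z * norm (y $ i) = norm (\<Sum>j\<in>UNIV. of_real (A $ i $ j) * y $ j)"
      by (metis norm_mult)
    also have "\<dots> \<le> (\<Sum>j\<in>UNIV. norm (of_real (A $ i $ j) * y $ j))" by (rule norm_sum)
    also have "\<dots> = (\<Sum>j\<in>UNIV. A $ i $ j * norm (y $ j))"
      using pos by (simp add: norm_mult less_imp_le abs_of_pos)
    finally show ?thesis by (simp add: u_def matrix_vector_mult_def)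
  qed
  obtain k where k: "y $ k \<noteq> 0" using y(1) by (metis vec_eq_iff zero_index)
  have "0 < l \<bullet> u" unfolding inner_vec_def
    by (rule sum_pos2[where i = k]) (use assms(1) k in \<open>auto simp: u_def less_imp_le\<close>)
  moreover have "norm z * (l \<bullet> u) \<le> l \<bullet> (A *v u)"
    unfolding inner_vec_def sum_distrib_left
  proof (rule sum_mono)
    fix i
    show "norm z * (l $ i \<bullet> u $ i) \<le> l $ i \<bullet> (A *v u) $ i"
      using mult_left_mono[OF le[of i], of "l $ i"] assms(1) by (simp add: less_imp_le mult_ac)
  qed
  moreover have "l \<bullet> (A *v u) = r * (l \<bullet> u)"
    using dot_lmul_matrix[of l A u] assms(2) by (simp add: scalar_mult_eq_scaleR)
  ultimately show ?thesis by simp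
qed

text \<open>\<open>pf_eigenvalue\<close> is a \<open>Max\<close>, which is meaningful only for a
  finite set.\<close>

lemma finite_complex_eigenvalues: "finite (complex_eigenvalues A)"
proof -
  let ?A = "\<chi> i j. complex_of_real (A $ i $ j)"
  let ?B = "\<lambda>z. (\<chi> i j. (if i = j then z else 0) - complex_of_real (A $ i $ j)) :: complex ^ 'n ^ 'n"
  define p where "p = det (\<chi> i j :: 'n. (if i = j then [:0, 1:] else 0) - [:complex_of_real (A $ i $ j):])"
  have poly_p: "poly p z = det (?B z)" for z
    unfolding p_def det_def
    by (auto simp: poly_sum poly_prod intro!: sum.cong prod.cong)
  have mult: "?B z *v y = z *s y - ?A *v y" for z y
  proof -
    have "(?B z *v y) $ i = (z *s y - ?A *v y) $ i" for i
    proof -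
      have "(?B z *v y) $ i
        = (\<Sum>j\<in>UNIV. (if i = j then z * y $ j else 0) - complex_of_real (A $ i $ j) * y $ j)"
        unfolding matrix_vector_mult_def by (auto simp: left_diff_distrib intro!: sum.cong)
      then show ?thesis by (simp add: sum_subtractf matrix_vector_mult_def)
    qed
    then show ?thesis by (simp add: vec_eq_iff)
  qed
  have root: "z \<in> complex_eigenvalues A \<longleftrightarrow> poly p z = 0" for z
  proof -
    have "det (?B z) \<noteq> 0 \<longleftrightarrow> (\<forall>y. ?B z *v y = 0 \<longrightarrow> y = 0)"
      by (simp add: invertible_left_inverse matrix_left_invertible_ker flip: invertible_det_nz)
    then show ?thesis unfolding poly_p complex_eigenvalues_def mult by auto
  qed
  obtain r l where l: "0 < r" "\<forall>i. 0 < l $ i" "l v* A = r *s l"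
    using ex_eigenvectors by blast
  \<comment> \<open>A single number that is not an eigenvalue shows that \<open>p\<close> is not the
    zero polynomial.\<close>
  have "complex_of_real (r + 1) \<notin> complex_eigenvalues A"
    using complex_eigenvalue_norm_le[OF l(2,3), of "complex_of_real (r + 1)"] l(1)
    by (metis abs_of_pos add_pos_pos less_add_one linorder_not_less norm_of_real zero_less_one)
  then have "p \<noteq> 0" using root by force
  then have "finite {z. poly p z = 0}" by (rule poly_roots_finite)
  moreover have "{z. poly p z = 0} = complex_eigenvalues A" using root by blast
  ultimately show ?thesis by simp
qed

lemma pf_eigenvalue_eq:
  assumes "0 < r" "\<forall>i. 0 < l $ i" "\<forall>i. 0 < x $ i" "A *v x = r *s x" "l v* A = r *s l"
  shows "pf_eigenvalue A = r"
proof -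
  let ?A = "\<chi> i j. complex_of_real (A $ i $ j)"
  have "complex_of_real r \<in> complex_eigenvalues A"
  proof -
    define z :: "complex ^ 'n" where "z = (\<chi> i. complex_of_real (x $ i))"
    have "z \<noteq> 0" using assms(3) by (auto simp: z_def vec_eq_iff less_le)
    moreover have "(?A *v z) $ i = (complex_of_real r *s z) $ i" for i
    proof -
      have "(\<Sum>j\<in>UNIV. A $ i $ j * x $ j) = r * x $ i"
        using arg_cong[OF assms(4), of "\<lambda>v. v $ i"] by (simp add: matrix_vector_mult_def)
      then show ?thesis
        by (simp add: matrix_vector_mult_def z_def flip: of_real_mult of_real_sum)
    qed
    ultimately show ?thesis unfolding complex_eigenvalues_def by (auto simp: vec_eq_iff)
  qed
  then have "r \<in> norm ` complex_eigenvalues A"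
    using assms(1) by (force simp: image_iff)
  then show ?thesis
    unfolding pf_eigenvalue_def
    using finite_complex_eigenvalues complex_eigenvalue_norm_le[OF assms(2,5)]
    by (intro Max_eqI) auto
qed

lemma pf_eigenvectors:
  obtains l x where "\<forall>i. 0 < l $ i" "\<forall>i. 0 < x $ i"
    "A *v x = pf_eigenvalue A *s x" "l v* A = pf_eigenvalue A *s l"
  using ex_eigenvectors pf_eigenvalue_eq by metis

lemma pf_eigenvalue_pos: "0 < pf_eigenvalue A"
  using ex_eigenvectors pf_eigenvalue_eq by metis

lemma nonneg_right_eigenvector:
  assumes "\<forall>i. 0 \<le> y $ i" "y \<noteq> 0" "A *v y = c *s y"
  shows "c = pf_eigenvalue A"
proof -
  obtain l x where l: "\<forall>i. 0 < l $ i" "l v* A = pf_eigenvalue A *s l"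
    using pf_eigenvectors by metis
  obtain k where k: "y $ k \<noteq> 0" using assms(2) by (metis vec_eq_iff zero_index)
  have "0 < l \<bullet> y" unfolding inner_vec_def
    by (rule sum_pos2[where i = k]) (use l(1) k assms(1) in \<open>auto simp: less_le\<close>)
  moreover have "pf_eigenvalue A * (l \<bullet> y) = c * (l \<bullet> y)"
    using dot_lmul_matrix[of l A y] l(2) assms(3) by (simp add: scalar_mult_eq_scaleR)
  ultimately show ?thesis by simp
qed

text \<open>\<open>c\<close> is the largest number with \<open>c *s x \<le> y\<close>. The
  difference \<open>w\<close> is nonnegative, has a vanishing coordinate and satisfies the
  eigenvalue equation, whereas \<open>A\<close> maps every nonzero nonnegative vector to a positive
  one; so \<open>w\<close> is zero.\<close>

lemma right_eigenvectors_parallel: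
  assumes "\<forall>i. 0 < x $ i" "A *v x = pf_eigenvalue A *s x"
    and "A *v y = pf_eigenvalue A *s y"
  shows "\<exists>c. y = c *s x"
proof -
  define c where "c = Min (range (\<lambda>i. y $ i / x $ i))"
  define w where "w = y - c *s x"
  have "c \<in> range (\<lambda>i. y $ i / x $ i)" unfolding c_def by (rule Min_in) auto
  then obtain k where k: "c = y $ k / x $ k" by auto
  have "c \<le> y $ i / x $ i" for i unfolding c_def by (rule Min_le) auto
  then have "0 \<le> w $ i" for i
    using assms(1) by (simp add: w_def pos_le_divide_eq)
  moreover have "A *v w = pf_eigenvalue A *s w"
    using assms by (simp add: w_def matrix_vector_mult_diff_distrib matrix_vector_mult_scaleR
        scalar_mult_eq_scaleR scaleR_diff_right mult.commute)
  moreover have "w $ k = 0"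
    using assms(1)[rule_format, of k] by (simp add: w_def k)
  ultimately have "w = 0"
    using mult_pos_vec[of w k] by (metis less_irrefl mult_zero_right vector_smult_component)
  then show ?thesis by (auto simp: w_def)
qed


lemma left_eigenvectors_parallel:
  assumes "\<forall>i. 0 < x $ i" "x v* A = pf_eigenvalue A *s x"
    and "y v* A = pf_eigenvalue A *s y"
  shows "\<exists>c. y = c *s x"
proof -
  interpret tr: positive_matrix "transpose A"
    using positive_matrix_transpose positive_matrix_axioms .
  have "pf_eigenvalue (transpose A) = pf_eigenvalue A"
    by (rule tr.nonneg_right_eigenvector[symmetric, of x])
      (use assms in \<open>auto simp: less_imp_le vec_eq_iff less_le\<close>)
  then show ?thesis using tr.right_eigenvectors_parallel[of x y] assms by simp
qed

lemma pf_left_props: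
  "0 < pf_left A $ i" "pf_left A v* A = pf_eigenvalue A *s pf_left A" "(\<Sum>i\<in>UNIV. pf_left A $ i) = 1"
proof -
  obtain l where l: "\<forall>i. 0 < l $ i" "l v* A = pf_eigenvalue A *s l"
    using pf_eigenvectors by metis
  have s: "0 < (\<Sum>i\<in>UNIV. l $ i)" by (rule sum_pos) (use l in auto)
  define l' where "l' = (1 / (\<Sum>i\<in>UNIV. l $ i)) *s l"
  have "\<exists>!l. (\<forall>i. 0 < l $ i) \<and> l v* A = pf_eigenvalue A *s l \<and> (\<Sum>i\<in>UNIV. l $ i) = 1"
  proof (rule ex1I[of _ l'])
    show l': "(\<forall>i. 0 < l' $ i) \<and> l' v* A = pf_eigenvalue A *s l' \<and> (\<Sum>i\<in>UNIV. l' $ i) = 1"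
      using l s by (auto simp: l'_def scaleR_vector_matrix_assoc scalar_mult_eq_scaleR mult.commute
          simp flip: sum_divide_distrib)
    fix y assume y: "(\<forall>i. 0 < y $ i) \<and> y v* A = pf_eigenvalue A *s y \<and> (\<Sum>i\<in>UNIV. y $ i) = 1"
    then obtain c where c: "y = c *s l'"
      using left_eigenvectors_parallel l' by blast
    then have "c = 1" using y l' by (simp flip: sum_distrib_left)
    then show "y = l'" using c by simp
  qed
  from theI'[OF this] show "0 < pf_left A $ i" "pf_left A v* A = pf_eigenvalue A *s pf_left A"
    "(\<Sum>i\<in>UNIV. pf_left A $ i) = 1"
    unfolding pf_left_def by auto
qed

lemma pf_right_props:
  "0 < pf_right A $ i" "A *v pf_right A = pf_eigenvalue A *s pf_right A" "pf_left A \<bullet> pf_right A = 1"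
proof -
  obtain x where x: "\<forall>i. 0 < x $ i" "A *v x = pf_eigenvalue A *s x"
    using pf_eigenvectors by metis
  have s: "0 < pf_left A \<bullet> x" unfolding inner_vec_def by (rule sum_pos) (use x pf_left_props in auto)
  define x' where "x' = (1 / (pf_left A \<bullet> x)) *s x"
  have "\<exists>!x. (\<forall>i. 0 < x $ i) \<and> A *v x = pf_eigenvalue A *s x \<and> pf_left A \<bullet> x = 1"
  proof (rule ex1I[of _ x'])
    show x': "(\<forall>i. 0 < x' $ i) \<and> A *v x' = pf_eigenvalue A *s x' \<and> pf_left A \<bullet> x' = 1"
      using x s by (auto simp: x'_def matrix_vector_mult_scaleR scalar_mult_eq_scaleR mult.commute)
    fix y assume y: "(\<forall>i. 0 < y $ i) \<and> A *v y = pf_eigenvalue A *s y \<and> pf_left A \<bullet> y = 1"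
    then obtain c where c: "y = c *s x'"
      using right_eigenvectors_parallel x' by blast
    then have "c = 1" using y x' by (simp add: scalar_mult_eq_scaleR)
    then show "y = x'" using c by simp
  qed
  from theI'[OF this] show "0 < pf_right A $ i" "A *v pf_right A = pf_eigenvalue A *s pf_right A"
    "pf_left A \<bullet> pf_right A = 1"
    unfolding pf_right_def by auto
qed

text \<open>Compare both sides of the eigenvalue equation at the smallest coordinate of the
  eigenvector: at least two columns with entries at least 1 already give the factor 2.\<close>

lemma pf_eigenvalue_gt_1:
  assumes "2 \<le> CARD('n)" "\<And>i j. 1 \<le> A $ i $ j"
  shows "1 < pf_eigenvalue A"
proof -
  let ?x = "pf_right A"
  have "finite (range (($) ?x))" "range (($) ?x) \<noteq> {}" by auto
  then have "Min (range (($) ?x)) \<in> range (($) ?x)" by (rule Min_in)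
  then obtain k where k: "?x $ k = Min (range (($) ?x))" by (metis imageE)
  have min: "?x $ k \<le> ?x $ j" for j unfolding k by (rule Min_le) auto
  have "2 * ?x $ k \<le> real CARD('n) * ?x $ k"
    using assms(1) pf_right_props(1)[of k] by simp
  also have "\<dots> = (\<Sum>j\<in>(UNIV :: 'n set). ?x $ k)" by simp
  also have "\<dots> \<le> (\<Sum>j\<in>UNIV. A $ k $ j * ?x $ j)"
  proof (rule sum_mono)
    fix j
    show "?x $ k \<le> A $ k $ j * ?x $ j"
      using mult_mono[OF assms(2) min[of j], of k j] pf_right_props(1)[of k] pos[of k j] by simp
  qed
  also have "\<dots> = pf_eigenvalue A * ?x $ k"
    using arg_cong[OF pf_right_props(2), of "\<lambda>v. v $ k"] by (simp add: matrix_vector_mult_def)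
  finally show ?thesis using pf_right_props(1)[of k] by simp
qed

end

text \<open>Divided by the Perron eigenvector and normalized, a step of the orbit becomes an averaging by a
  positive stochastic matrix, which contracts the oscillation by a fixed factor. As the orbit extends
  infinitely far back, the oscillation vanishes.\<close>

lemma (in positive_matrix) backward_orbit_eq:
  fixes x :: "nat \<Rightarrow> real ^ 'n"
  assumes nonneg: "\<And>n i. 0 \<le> x n $ i" and step: "\<And>n. x n = x (Suc n) v* A"
    and sum0: "(\<Sum>i\<in>UNIV. x 0 $ i) = 1"
  shows "x n = (1 / pf_eigenvalue A ^ n) *s pf_left A"
proof -
  define r l \<theta> where "r = pf_eigenvalue A" and "l = pf_left A" and "\<theta> = pf_right A"
  have r: "0 < r" and l: "0 < l $ i" and \<theta>: "0 < \<theta> $ i" for i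
    using pf_eigenvalue_pos pf_left_props pf_right_props by (auto simp: r_def l_def \<theta>_def)
  define u where "u n i = r ^ n * x n $ i / l $ i" for n i
  define p where "p i j = l $ i * A $ i $ j / (r * l $ j)" for i j
  have p_pos: "0 < p i j" for i j using l r pos by (simp add: p_def)
  have p_sum: "(\<Sum>i\<in>UNIV. p i j) = 1" for j
  proof -
    have "(\<Sum>i\<in>UNIV. l $ i * A $ i $ j) = r * l $ j"
      using arg_cong[OF pf_left_props(2), of "\<lambda>v. v $ j"]
      by (simp add: vector_matrix_mult_def l_def r_def mult.commute)
    then show ?thesis using r l[of j] by (simp add: p_def flip: sum_divide_distrib)
  qed
  have u_step: "u n j = (\<Sum>i\<in>UNIV. p i j * u (Suc n) i)" for n j
  proof -
    have "p i j * u (Suc n) i = r ^ n * (A $ i $ j * x (Suc n) $ i) / l $ j" for i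
      using l[of i] r by (simp add: p_def u_def field_simps)
    then show ?thesis
      by (simp add: u_def step[of n] vector_matrix_mult_def sum_distrib_left sum_divide_distrib mult.commute[of "A $ _ $ _"])
  qed
  \<comment> \<open>The pairing with the right eigenvector, rescaled by \<open>r ^ n\<close>, is
    conserved; this bounds all coordinates of all \<open>u n\<close> by one constant.\<close>
  define K where "K = x 0 \<bullet> \<theta>"
  have K: "r ^ n * (x n \<bullet> \<theta>) = K" for n
  proof (induction n)
    case (Suc n)
    have "x n \<bullet> \<theta> = r * (x (Suc n) \<bullet> \<theta>)"
      using dot_lmul_matrix[of "x (Suc n)" A \<theta>] step[of n] pf_right_props(2)
      by (simp add: \<theta>_def r_def scalar_mult_eq_scaleR)
    then show ?case using Suc by (simp add: mult_ac)
  qed (simp add: K_def)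
  define B where "B = Max (range (\<lambda>i. K / (\<theta> $ i * l $ i)))"
  have u_nonneg: "0 \<le> u n i" for n i using r l nonneg by (simp add: u_def less_imp_le)
  have u_le: "u n i \<le> B" for n i
  proof -
    have "x n $ i * \<theta> $ i \<le> x n \<bullet> \<theta>"
      unfolding inner_vec_def
      by (rule order_trans[OF _ member_le_sum[of i]]) (use nonneg \<theta> in \<open>auto simp: less_imp_le\<close>)
    then have "r ^ n * (x n $ i * \<theta> $ i) \<le> K"
      using mult_left_mono[of _ _ "r ^ n"] r K[of n] by (metis less_imp_le zero_less_power)
    then have "u n i \<le> K / (\<theta> $ i * l $ i)"
      using \<theta>[of i] l[of i] by (simp add: u_def field_simps)
    also have "\<dots> \<le> B" unfolding B_def by (rule Max_ge) auto
    finally show ?thesis .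
  qed
  define \<delta> where "\<delta> = Min (range (\<lambda>(i, j). p i j))"
  have "\<delta> \<in> range (\<lambda>(i, j). p i j)" unfolding \<delta>_def by (rule Min_in) auto
  then have \<delta>: "0 < \<delta>" using p_pos by auto
  have \<delta>_le: "\<delta> \<le> p i j" for i j
  proof -
    have "p i j \<in> range (\<lambda>(i, j). p i j)" by (auto intro!: image_eqI[of _ _ "(i, j)"])
    then show ?thesis unfolding \<delta>_def by (intro Min_le) auto
  qed
  have "p undefined undefined \<le> (\<Sum>i\<in>UNIV. p i undefined)"
    by (rule member_le_sum) (use p_pos in \<open>auto simp: less_imp_le\<close>)
  then have \<delta>_le1: "\<delta> \<le> 1" using p_sum \<delta>_le[of undefined undefined] by simp
  have osc: "u n i - u n j \<le> (1 - \<delta>) ^ k * B" for k n i j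
  proof (induction k arbitrary: n i j)
    case 0
    then show ?case using u_nonneg[of n j] u_le[of n i] by simp
  next
    case (Suc k)
    define m where "m = Min (range (u (Suc n)))"
    let ?D = "(1 - \<delta>) ^ k * B"
    have "m \<in> range (u (Suc n))" unfolding m_def by (rule Min_in) auto
    then obtain c where c: "m = u (Suc n) c" by auto
    have m_le: "m \<le> u (Suc n) a" for a unfolding m_def by (rule Min_le) auto
    have D0: "0 \<le> ?D" using Suc[of n undefined undefined] by simp
    have shift: "u n a = m + (\<Sum>b\<in>UNIV. p b a * (u (Suc n) b - m))" for a
      by (simp add: u_step[of n] right_diff_distrib sum_subtractf p_sum flip: sum_distrib_right)
    have "m \<le> u n j"
      using sum_nonneg[of UNIV "\<lambda>b. p b j * (u (Suc n) b - m)"] p_pos m_le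
      by (simp add: shift[of j] less_imp_le)
    moreover have "u n i \<le> m + (1 - \<delta>) * ?D"
    proof -
      \<comment> \<open>The coordinate \<open>c\<close> where the minimum \<open>m\<close> is
        attained drops out and takes weight at least \<open>\<delta>\<close> with it; this is the
        source of the factor \<open>1 - \<delta>\<close>.\<close>
      have "(\<Sum>b\<in>UNIV. p b i * (u (Suc n) b - m)) = (\<Sum>b\<in>UNIV - {c}. p b i * (u (Suc n) b - m))"
        by (rule sum.mono_neutral_right) (auto simp: c)
      also have "\<dots> \<le> (\<Sum>b\<in>UNIV - {c}. p b i * ?D)"
        by (rule sum_mono, rule mult_left_mono) (use Suc p_pos c in \<open>auto simp: less_imp_le\<close>)
      also have "\<dots> = (1 - p c i) * ?D"
        using p_sum[of i] sum.remove[of UNIV c "\<lambda>b. p b i"] by (simp flip: sum_distrib_right)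
      also have "\<dots> \<le> (1 - \<delta>) * ?D" using \<delta>_le[of c i] D0 by (intro mult_right_mono) auto
      finally show ?thesis using shift[of i] by simp
    qed
    ultimately show ?case by (simp add: mult.assoc)
  qed
  have u_le': "u n i \<le> u n j" for n i j
  proof -
    have "(\<lambda>k. (1 - \<delta>) ^ k * B) \<longlonglongrightarrow> 0 * B"
      using \<delta> \<delta>_le1 by (intro tendsto_intros LIMSEQ_power_zero) auto
    then have "u n i - u n j \<le> 0"
      by (intro tendsto_lowerbound[of _ _ sequentially]) (use osc in \<open>auto intro!: always_eventually\<close>)
    then show ?thesis by simp
  qed
  then have u_eq: "u n i = u n j" for n i j by (intro antisym)
  have x_eq: "x n = (u n undefined / r ^ n) *s l" for n
  proof -
    have "x n $ i = u n undefined / r ^ n * l $ i" for i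
      using u_eq[of n undefined i] l[of i] r by (simp add: u_def)
    then show ?thesis by (simp add: vec_eq_iff)
  qed
  have u_Suc: "u n j = u (Suc n) j" for n j
  proof -
    have "u n j = (\<Sum>i\<in>UNIV. p i j * u (Suc n) j)"
      unfolding u_step[of n] by (intro sum.cong refl arg_cong2[of _ _ _ _ "(*)"] u_eq)
    then show ?thesis by (simp add: p_sum flip: sum_distrib_right)
  qed
  have "u n undefined = u 0 undefined" by (induction n) (use u_Suc in auto)
  moreover have "u 0 undefined = 1"
    using sum0 x_eq[of 0] pf_left_props(3) by (simp add: l_def flip: sum_distrib_left)
  ultimately show ?thesis using x_eq[of n] by (simp add: r_def l_def)
qed

text \<open>With \<open>l\<close> the left eigenvector at \<open>t\<close> and \<open>y s\<close> the right eigenvector at \<open>s\<close> normalized by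
  \<open>l \<bullet> y s = 1\<close>, the increment of the eigenvalue equals \<open>l \<bullet> (A s - A t) y s\<close>. Continuity of \<open>y\<close>
  follows from its uniqueness, by the closed graph theorem.\<close>

lemma has_derivative_pf_eigenvalue:
  fixes A :: "real \<Rightarrow> real ^ 'n ^ 'n"
  assumes pos: "\<And>s. positive_matrix (A s)"
    and deriv: "\<And>s i j. ((\<lambda>s. A s $ i $ j) has_real_derivative D s i j) (at s)"
  shows "((\<lambda>s. pf_eigenvalue (A s)) has_real_derivative
    (\<Sum>i\<in>UNIV. \<Sum>j\<in>UNIV. pf_left (A t) $ i * D t i j * pf_right (A t) $ j)) (at t)"
proof -
  interpret positive_matrix "A s" for s by (rule pos)
  have contA: "continuous_on UNIV (\<lambda>s. A s $ i $ j)" for i j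
    by (rule DERIV_continuous_on) (use deriv in \<open>auto intro: has_field_derivative_at_within\<close>)
  define l where "l = pf_left (A t)"
  have l: "0 < l $ i" for i by (simp add: l_def pf_left_props)
  \<comment> \<open>Normalizing against the fixed vector \<open>l\<close>, not against the left
    eigenvector at \<open>s\<close>, keeps all \<open>y s\<close> in one compact set
    \<open>K\<close>.\<close>
  define y where "y s = (1 / (l \<bullet> pf_right (A s))) *s pf_right (A s)" for s
  have lp: "0 < l \<bullet> pf_right (A s)" for s
    unfolding inner_vec_def by (rule sum_pos) (use l pf_right_props in auto)
  have y_pos: "0 < y s $ i" for s i using lp[of s] by (simp add: y_def pf_right_props)
  have ly: "l \<bullet> y s = 1" for s using lp[of s] by (simp add: y_def scalar_mult_eq_scaleR)
  have Ay: "A s *v y s = pf_eigenvalue (A s) *s y s" for s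
    by (simp add: y_def matrix_vector_mult_scaleR scalar_mult_eq_scaleR pf_right_props(2) mult.commute)
  define K where "K = {v :: real ^ 'n. (\<forall>i. 0 \<le> v $ i) \<and> l \<bullet> v = 1}"
  have "closed K"
  proof -
    have "K = (\<Inter>i. {v. 0 \<le> v $ i}) \<inter> {v. l \<bullet> v = 1}" by (auto simp: K_def)
    moreover have "closed {v :: real ^ 'n. 0 \<le> v $ i}" for i
      by (intro closed_Collect_le continuous_intros)
    moreover have "closed {v. l \<bullet> v = 1}" by (intro closed_Collect_eq continuous_intros)
    ultimately show ?thesis by auto
  qed
  moreover have "bounded K"
  proof (rule boundedI)
    fix v assume v: "v \<in> K"
    have "v $ i \<le> 1 / l $ i" for i
    proof -
      have "l $ i * v $ i \<le> l \<bullet> v" unfolding inner_vec_def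
        by (rule order_trans[OF _ member_le_sum[of i]]) (use v l in \<open>auto simp: K_def less_imp_le\<close>)
      then show ?thesis using v l[of i] by (simp add: K_def field_simps)
    qed
    then have "(\<Sum>i\<in>UNIV. \<bar>v $ i\<bar>) \<le> (\<Sum>i\<in>UNIV. 1 / l $ i)"
      using v by (intro sum_mono) (simp add: K_def)
    then show "norm v \<le> (\<Sum>i\<in>UNIV. 1 / l $ i)" using norm_le_l1_cart[of v] by linarith
  qed
  ultimately have "compact K" by (simp add: compact_eq_bounded_closed)
  have contF: "continuous_on UNIV (\<lambda>p :: real \<times> (real ^ 'n). A (fst p) $ i $ j)" for i j
    by (rule continuous_on_compose2[OF contA[of i j]]) (auto intro!: continuous_intros)
  \<comment> \<open>Testing against \<open>l\<close> replaces the eigenvalue by an expression in the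
    matrix and the vector, so the graph is cut out by equations whose continuity is already
    known.\<close>
  have graph: "range (\<lambda>s. (s, y s)) = {p. snd p \<in> K \<and> (\<forall>i. (\<Sum>j\<in>UNIV. A (fst p) $ i $ j * snd p $ j)
      = (\<Sum>i\<in>UNIV. \<Sum>j\<in>UNIV. l $ i * (A (fst p) $ i $ j * snd p $ j)) * snd p $ i)}" (is "_ = ?R")
  proof (intro equalityI subsetI)
    fix p assume "p \<in> range (\<lambda>s. (s, y s))"
    then obtain s where p: "p = (s, y s)" by auto
    have "(\<Sum>i\<in>UNIV. \<Sum>j\<in>UNIV. l $ i * (A s $ i $ j * y s $ j)) = l \<bullet> (A s *v y s)"
      by (simp add: inner_vec_def matrix_vector_mult_def sum_distrib_left)
    also have "\<dots> = pf_eigenvalue (A s)" by (simp add: Ay scalar_mult_eq_scaleR ly)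
    finally show "p \<in> ?R"
      using p y_pos ly Ay[of s]
      by (auto simp: K_def less_imp_le matrix_vector_mult_def vec_eq_iff)
  next
    fix p assume "p \<in> ?R"
    moreover obtain s v where p: "p = (s, v)" by (cases p)
    ultimately have v: "v \<in> K" and "\<exists>c. A s *v v = c *s v"
      by (auto simp: vec_eq_iff matrix_vector_mult_def)
    then obtain c where c: "A s *v v = c *s v" by blast
    have "v \<noteq> 0" using v by (auto simp: K_def)
    then have "c = pf_eigenvalue (A s)"
      using nonneg_right_eigenvector[of v s c] v c by (auto simp: K_def)
    then obtain k where k: "v = k *s y s"
      using right_eigenvectors_parallel[of "y s" s v] y_pos Ay c by blast
    then have "k = 1" using v ly[of s] by (simp add: K_def scalar_mult_eq_scaleR)
    then show "p \<in> range (\<lambda>s. (s, y s))" using k p by simp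
  qed
  have "closed ?R"
  proof -
    have "?R = (snd -` K) \<inter> (\<Inter>i. {p. (\<Sum>j\<in>UNIV. A (fst p) $ i $ j * snd p $ j)
      = (\<Sum>i\<in>UNIV. \<Sum>j\<in>UNIV. l $ i * (A (fst p) $ i $ j * snd p $ j)) * snd p $ i})" by auto
    moreover have "closed (snd -` K :: (real \<times> (real ^ 'n)) set)"
      using \<open>closed K\<close> by (rule closed_vimage_snd)
    moreover have "closed {p. (\<Sum>j\<in>UNIV. A (fst p) $ i $ j * snd p $ j)
      = (\<Sum>i\<in>UNIV. \<Sum>j\<in>UNIV. l $ i * (A (fst p) $ i $ j * snd p $ j)) * snd p $ i}" for i
      by (intro closed_Collect_eq continuous_intros contF)
    ultimately show ?thesis by (metis (no_types, lifting) closed_INT closed_Int)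
  qed
  then have "continuous_on UNIV y"
    using continuous_from_closed_graph[OF \<open>compact K\<close>, of y UNIV] graph y_pos ly
    by (auto simp: K_def less_imp_le)
  then have "isCont y t" by (simp add: continuous_on_eq_continuous_at)
  then have y_lim: "(y \<longlongrightarrow> y t) (at t)" by (simp add: isCont_def)
  have yt: "y t = pf_right (A t)" by (simp add: y_def l_def pf_right_props(3))
  have diff: "pf_eigenvalue (A s) - pf_eigenvalue (A t)
    = (\<Sum>i\<in>UNIV. \<Sum>j\<in>UNIV. l $ i * (A s $ i $ j - A t $ i $ j) * y s $ j)" for s
  proof -
    have "pf_eigenvalue (A s) = l \<bullet> (A s *v y s)" by (simp add: Ay scalar_mult_eq_scaleR ly)
    moreover have "pf_eigenvalue (A t) = l \<bullet> (A t *v y s)"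
      using dot_lmul_matrix[of l "A t" "y s"] pf_left_props(2)[of t] ly[of s]
      by (simp add: l_def scalar_mult_eq_scaleR)
    ultimately show ?thesis
      by (simp add: inner_vec_def matrix_vector_mult_def sum_distrib_left
          right_diff_distrib left_diff_distrib sum_subtractf mult.assoc)
  qed
  have "((\<lambda>s. \<Sum>i\<in>UNIV. \<Sum>j\<in>UNIV. l $ i * ((A s $ i $ j - A t $ i $ j) / (s - t)) * y s $ j) \<longlongrightarrow>
    (\<Sum>i\<in>UNIV. \<Sum>j\<in>UNIV. l $ i * D t i j * y t $ j)) (at t)"
    by (intro tendsto_intros y_lim) (use deriv in \<open>simp add: has_field_derivative_iff\<close>)
  then show ?thesis
    unfolding has_field_derivative_iff diff yt[symmetric] l_def[symmetric]
    by (simp add: sum_divide_distrib)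
qed

section \<open>Rauzy--Veech towers and itineraries\<close>

definition affine_on :: "real \<Rightarrow> (real \<Rightarrow> real) \<Rightarrow> real set \<Rightarrow> bool" where
  "affine_on s g J \<longleftrightarrow> 0 < s \<and> (\<exists>c. \<forall>y\<in>J. g y = c + s * y)"

lemma affine_on_subset: "affine_on s g J \<Longrightarrow> J' \<subseteq> J \<Longrightarrow> affine_on s g J'"
  unfolding affine_on_def by blast

lemma affine_on_id: "affine_on 1 (\<lambda>x. x) J"
  unfolding affine_on_def by (auto intro!: exI[of _ 0])

lemma affine_on_comp:
  assumes "affine_on s g J" "affine_on s' h (g ` J)"
  shows "affine_on (s' * s) (\<lambda>x. h (g x)) J"
proof -
  obtain c c' where c: "\<forall>y\<in>J. g y = c + s * y" and c': "\<forall>y\<in>g ` J. h y = c' + s' * y"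
    using assms unfolding affine_on_def by blast
  have "\<forall>y\<in>J. h (g y) = (c' + s' * c) + (s' * s) * y"
  proof
    fix y assume y: "y \<in> J"
    then have "h (g y) = c' + s' * g y" using c' by blast
    then show "h (g y) = (c' + s' * c) + (s' * s) * y" using c y by (simp add: algebra_simps)
  qed
  then show ?thesis using assms unfolding affine_on_def by auto
qed

lemma affine_on_cong: "affine_on s g J \<Longrightarrow> (\<And>y. y \<in> J \<Longrightarrow> h y = g y) \<Longrightarrow> affine_on s h J"
  unfolding affine_on_def by force

lemma affine_image_atLeastLessThan:
  assumes "\<forall>y\<in>{l..<r}. g y = c + s * y" "0 < s"
  shows "g ` {l..<r} = {c + s * l..<c + s * (r :: real)}"
proof (intro equalityI subsetI)
  fix z assume "z \<in> {c + s * l..<c + s * r}"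
  then have "(z - c) / s \<in> {l..<r}" "z = c + s * ((z - c) / s)"
    using assms(2) by (auto simp: field_simps)
  then show "z \<in> g ` {l..<r}" using assms(1) by (metis imageI)
qed (use assms in auto)

definition interval_partition :: "('a \<Rightarrow> real set) \<Rightarrow> real \<Rightarrow> bool" where
  "interval_partition J x \<longleftrightarrow> (\<forall>\<alpha>. \<exists>l r. l < r \<and> J \<alpha> = {l..<r}) \<and>
     (\<forall>\<alpha> \<beta> z. z \<in> J \<alpha> \<and> z \<in> J \<beta> \<longrightarrow> \<alpha> = \<beta>) \<and> (\<Union>\<alpha>. J \<alpha>) = {0..<x}"

lemma interval_partition_unique:
  "interval_partition J x \<Longrightarrow> z \<in> J \<alpha> \<Longrightarrow> z \<in> J \<beta> \<Longrightarrow> \<alpha> = \<beta>"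
  unfolding interval_partition_def by blast

lemma interval_partition_Inf:
  assumes "interval_partition J x"
  shows "Inf (J \<alpha>) \<in> J \<alpha>"
proof -
  obtain l r where "l < r" "J \<alpha> = {l..<r}" using assms unfolding interval_partition_def by blast
  then show ?thesis by simp
qed

lemma interval_partition_rightmost:
  assumes J: "interval_partition J x" and max: "\<And>\<beta>. Inf (J \<beta>) \<le> Inf (J a)"
  shows "\<exists>l. l < x \<and> J a = {l..<x}"
proof -
  obtain l r where lr: "l < r" "J a = {l..<r}" using J unfolding interval_partition_def by blast
  have un: "(\<Union>\<alpha>. J \<alpha>) = {0..<x}" using J unfolding interval_partition_def by blast
  have lx: "l < x" "0 \<le> l" using lr un by force+
  have "r \<le> x"
  proof (rule ccontr)
    assume "\<not> r \<le> x"
    then have "x \<in> J a" using lx lr by auto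
    then show False using un by auto
  qed
  moreover have "\<not> r < x"
  proof
    assume "r < x"
    then have "r \<in> {0..<x}" using lr lx by auto
    then obtain \<beta> where \<beta>: "r \<in> J \<beta>" using un by blast
    obtain l' r' where lr': "l' < r'" "J \<beta> = {l'..<r'}"
      using J unfolding interval_partition_def by blast
    have "l' \<le> l" using max[of \<beta>] lr lr' by simp
    then have "l \<in> J \<beta>" "l \<in> J a" using \<beta> lr lr' by auto
    then have "\<beta> = a" using interval_partition_unique[OF J] by blast
    then show False using \<beta> lr by simp
  qed
  ultimately show ?thesis using lx lr by auto
qed

text \<open>Left endpoints are distinct, so \<open>position\<close> reaches \<open>CARD('a)\<close>
  at exactly one letter, the one of the rightmost interval. This makes \<open>last_top\<close> and
  \<open>last_bot\<close> well defined.\<close>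

lemma last_position:
  fixes J :: "'a::finite \<Rightarrow> real set"
  assumes J: "interval_partition J x"
  shows "Inf (J \<beta>) \<le> Inf (J (THE \<alpha>. position J \<alpha> = CARD('a)))"
proof -
  have full: "position J \<alpha> = CARD('a) \<longleftrightarrow> (\<forall>\<beta>. Inf (J \<beta>) \<le> Inf (J \<alpha>))" for \<alpha>
  proof
    assume "position J \<alpha> = CARD('a)"
    then have "{\<beta>. Inf (J \<beta>) \<le> Inf (J \<alpha>)} = UNIV"
      unfolding position_def by (intro card_subset_eq) auto
    then show "\<forall>\<beta>. Inf (J \<beta>) \<le> Inf (J \<alpha>)" by auto
  qed (simp add: position_def)
  have inj: "\<alpha> = \<beta>" if "Inf (J \<alpha>) = Inf (J \<beta>)" for \<alpha> \<beta>
    using interval_partition_unique[OF J] interval_partition_Inf[OF J] that by metis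
  have "Max (range (\<lambda>\<alpha>. Inf (J \<alpha>))) \<in> range (\<lambda>\<alpha>. Inf (J \<alpha>))" by (rule Max_in) auto
  then obtain \<alpha> where "Max (range (\<lambda>\<alpha>. Inf (J \<alpha>))) = Inf (J \<alpha>)" by blast
  then have "\<forall>\<beta>. Inf (J \<beta>) \<le> Inf (J \<alpha>)"
    using Max_ge[of "range (\<lambda>\<alpha>. Inf (J \<alpha>))"] by (metis finite_imageI finite rangeI)
  then have "\<exists>!\<alpha>. position J \<alpha> = CARD('a)"
    unfolding full
    by (metis antisym inj)
  from theI'[OF this] show ?thesis unfolding full by blast
qed

lemma last_top_interval:
  assumes "interval_partition J x"
  shows "\<exists>l. l < x \<and> J (last_top (exchange_perm g J)) = {l..<x}"
  unfolding last_top_def exchange_perm_def fst_conv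
  by (rule interval_partition_rightmost[OF assms last_position[OF assms]])

lemma last_bot_interval:
  assumes "interval_partition (\<lambda>\<alpha>. g ` J \<alpha>) x"
  shows "\<exists>l. l < x \<and> g ` J (last_bot (exchange_perm g J)) = {l..<x}"
  unfolding last_bot_def exchange_perm_def snd_conv
  by (rule interval_partition_rightmost[OF assms last_position[OF assms]])

text \<open>Both types of a Rauzy--Veech step have this form, where \<open>a\<close> and \<open>b\<close> are the last top and
  bottom letters and \<open>c\<close> is the loser.\<close>

definition rauzy_move ::
  "(real \<Rightarrow> real) \<Rightarrow> ('a \<Rightarrow> real set) \<Rightarrow> ('a \<Rightarrow> real set) \<Rightarrow> 'a \<Rightarrow> 'a \<Rightarrow> 'a \<Rightarrow> bool" where
  "rauzy_move g J J' a b c \<longleftrightarrow> a \<noteq> b \<and> (\<forall>\<alpha>. \<alpha> \<noteq> c \<longrightarrow> J' \<alpha> \<subseteq> J \<alpha>) \<and> J' c \<subseteq> J b \<and>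
     g ` J' c \<subseteq> J a \<and> (\<Union>\<alpha>. J' \<alpha>) = (\<Union>\<alpha>. J \<alpha>) - g ` J' c"

text \<open>\<open>J a\<close> and the image of \<open>J b\<close> both end at \<open>x\<close>, so
  the shorter one is contained in the longer one, and removing it leaves an interval starting at 0.
  In the bottom case the loser \<open>a\<close> moves to the right part of \<open>J b\<close>,
  because \<open>g\<close> is increasing there.\<close>

lemma rauzy_move_rv_step:
  fixes J :: "'a::finite \<Rightarrow> real set"
  assumes J: "interval_partition J x" and gJ: "interval_partition (\<lambda>\<alpha>. g ` J \<alpha>) x"
    and aff: "\<And>\<alpha>. \<exists>s. affine_on s g (J \<alpha>)"
    and a: "a = last_top (exchange_perm g J)" and b: "b = last_bot (exchange_perm g J)"
    and ab: "a \<noteq> b" and ne: "measure lborel (J a) \<noteq> measure lborel (g ` J b)"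
    and c: "c = (if measure lborel (J a) > measure lborel (g ` J b) then b else a)"
  shows "rauzy_move g J (rv_step g J) a b c \<and> (\<exists>x'. interval_partition (rv_step g J) x')"
proof -
  obtain l where l: "l < x" "J a = {l..<x}" using last_top_interval[OF J] a by blast
  obtain u where u: "u < x" "g ` J b = {u..<x}" using last_bot_interval[OF gJ] b by blast
  obtain p q where pq: "p < q" "J b = {p..<q}" using J unfolding interval_partition_def by blast
  obtain s k where s: "0 < s" "\<forall>y\<in>{p..<q}. g y = k + s * y"
    using aff[of b] pq unfolding affine_on_def by auto
  have un: "(\<Union>\<alpha>. J \<alpha>) = {0..<x}" using J unfolding interval_partition_def by blast
  have "{k + s * p..<k + s * q} = {u..<x}"
    using affine_image_atLeastLessThan[OF s(2,1)] u pq by simp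
  moreover have "k + s * p < k + s * q" using s pq by simp
  ultimately have ku: "k + s * p = u" "k + s * q = x"
    using atLeastLessThan_eq_iff[of "k + s * p" "k + s * q" u x] u(1) by auto
  have int: "\<exists>l r. l < r \<and> J \<alpha> = {l..<r}" for \<alpha> using J unfolding interval_partition_def by blast
  have uniq: "z \<in> J \<alpha> \<Longrightarrow> z \<in> J \<beta> \<Longrightarrow> \<alpha> = \<beta>" for z \<alpha> \<beta>
    using interval_partition_unique[OF J] .
  have l0: "0 \<le> l" "0 \<le> u"
  proof -
    have "l \<in> J a" using l by simp
    then show "0 \<le> l" using un by auto
    have "(\<Union>\<alpha>. g ` J \<alpha>) = {0..<x}" using gJ unfolding interval_partition_def by blast
    moreover have "u \<in> g ` J b" using u by simp
    ultimately have "u \<in> {0..<x}" by blast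
    then show "0 \<le> u" by simp
  qed
  show ?thesis
  proof (cases "measure lborel (J a) > measure lborel (g ` J b)")
    case True
    then have lu: "l < u" using l u by simp
    let ?J' = "J(a := J a - g ` J b)"
    have J': "rv_step g J = ?J'" using True by (simp add: rv_step_def Let_def a b)
    have J'a: "J a - g ` J b = {l..<u}" using l u lu by auto
    have sub: "g ` J b \<subseteq> J a" using l u lu by auto
    have union: "(\<Union>\<alpha>. ?J' \<alpha>) = (\<Union>\<alpha>. J \<alpha>) - g ` J b"
    proof (intro equalityI subsetI)
      fix z assume "z \<in> (\<Union>\<alpha>. ?J' \<alpha>)"
      then obtain \<alpha> where "z \<in> ?J' \<alpha>" by blast
      then show "z \<in> (\<Union>\<alpha>. J \<alpha>) - g ` J b"
        using sub uniq by (cases "\<alpha> = a") auto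
    next
      fix z assume z: "z \<in> (\<Union>\<alpha>. J \<alpha>) - g ` J b"
      then obtain \<alpha> where "z \<in> J \<alpha>" by blast
      then have "z \<in> ?J' \<alpha>" using z by auto
      then show "z \<in> (\<Union>\<alpha>. ?J' \<alpha>)" by blast
    qed
    have "rauzy_move g J ?J' a b b"
      unfolding rauzy_move_def using ab sub union by auto
    moreover have "interval_partition ?J' u"
      unfolding interval_partition_def
    proof (intro conjI allI impI)
      show "\<exists>l r. l < r \<and> ?J' \<alpha> = {l..<r}" for \<alpha>
        using int[of \<alpha>] lu J'a by (cases "\<alpha> = a") auto
      show "\<alpha> = \<beta>" if "z \<in> ?J' \<alpha> \<and> z \<in> ?J' \<beta>" for \<alpha> \<beta> z
        using that uniq by (auto split: if_splits)
      show "(\<Union>\<alpha>. ?J' \<alpha>) = {0..<u}" using union un u l0 by auto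
    qed
    ultimately show ?thesis using J' c True by auto
  next
    case False
    then have lt: "measure lborel (J a) < measure lborel (g ` J b)" using ne by simp
    then have ul: "u < l" using l u by simp
    define P where "P = {y \<in> (\<Union>\<alpha>. J \<alpha>). g y \<in> J a}"
    let ?J' = "J(a := P, b := J b - P)"
    have J': "rv_step g J = ?J'" using False lt by (simp add: rv_step_def Let_def a b P_def)
    \<comment> \<open>The preimage of the left end of \<open>J a\<close> under the branch
      \<open>k + s * y\<close>; it cuts \<open>J b\<close> into what the winner keeps and the
      loser's new interval.\<close>
    define m where "m = (l - k) / s"
    have m: "p < m" "m < q" using ku ul l s(1) by (auto simp: m_def field_simps)
    have PJb: "P \<subseteq> J b"
    proof
      fix y assume y: "y \<in> P"
      then obtain \<alpha> where \<alpha>: "y \<in> J \<alpha>" "g y \<in> J a" by (auto simp: P_def)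
      then have "g y \<in> g ` J b" using u l ul by auto
      then have "\<alpha> = b" using \<alpha>(1) interval_partition_unique[OF gJ, of "g y" \<alpha> b] by blast
      then show "y \<in> J b" using \<alpha> by simp
    qed
    have P: "P = {m..<q}"
    proof (intro equalityI subsetI)
      fix y assume y: "y \<in> P"
      then have "y \<in> {p..<q}" "g y \<in> {l..<x}" using PJb pq l by (auto simp: P_def)
      then show "y \<in> {m..<q}" using s by (auto simp: m_def field_simps)
    next
      fix y assume y: "y \<in> {m..<q}"
      then have yb: "y \<in> {p..<q}" using m by auto
      then have "g y = k + s * y" using s by auto
      moreover have "l \<le> k + s * y" using y s(1) by (auto simp: m_def field_simps)
      moreover have "k + s * y < x" using y s(1) ku(2) by (auto simp flip: ku(2))
      ultimately show "y \<in> P" using yb pq l by (auto simp: P_def)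
    qed
    have gP: "g ` P = J a"
    proof -
      have "\<forall>y\<in>{m..<q}. g y = k + s * y" using s m by auto
      then have "g ` {m..<q} = {k + s * m..<k + s * q}"
        by (rule affine_image_atLeastLessThan) (rule s)
      then show ?thesis using P l ku s by (simp add: m_def)
    qed
    have union: "(\<Union>\<alpha>. ?J' \<alpha>) = (\<Union>\<alpha>. J \<alpha>) - J a"
    proof (intro equalityI subsetI)
      fix z assume "z \<in> (\<Union>\<alpha>. ?J' \<alpha>)"
      then obtain \<alpha> where "z \<in> ?J' \<alpha>" by blast
      then show "z \<in> (\<Union>\<alpha>. J \<alpha>) - J a"
        using PJb uniq ab by (cases "\<alpha> = a"; cases "\<alpha> = b") auto
    next
      fix z assume z: "z \<in> (\<Union>\<alpha>. J \<alpha>) - J a"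
      then obtain \<alpha> where \<alpha>: "z \<in> J \<alpha>" by blast
      then have "\<alpha> \<noteq> a" using z by auto
      then have "z \<in> ?J' \<alpha> \<or> z \<in> ?J' a" using \<alpha> ab by auto
      then show "z \<in> (\<Union>\<alpha>. ?J' \<alpha>)" by blast
    qed
    have "rauzy_move g J ?J' a b a"
      unfolding rauzy_move_def using ab PJb gP union by auto
    moreover have "interval_partition ?J' l"
      unfolding interval_partition_def
    proof (intro conjI allI impI)
      have "J b - P = {p..<m}"
        unfolding P pq(2) using m by (simp add: set_eq_iff) (metis le_less_trans less_imp_le less_trans not_le)
      then have J'b: "?J' b = {p..<m}" by simp
      have J'a: "?J' a = {m..<q}" using P ab by simp
      show "\<exists>l r. l < r \<and> ?J' \<alpha> = {l..<r}" for \<alpha>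
      proof -
        consider "\<alpha> = a" | "\<alpha> = b" | "\<alpha> \<noteq> a" "\<alpha> \<noteq> b" by blast
        then show ?thesis
        proof cases
          case 1
          then show ?thesis using J'a m by blast
        next
          case 2
          then show ?thesis using J'b m by blast
        next
          case 3
          then show ?thesis using int[of \<alpha>] by simp
        qed
      qed
      have "z \<in> P \<and> \<alpha> = a \<or> z \<notin> P \<and> z \<in> J \<alpha>" if "z \<in> ?J' \<alpha>" for \<alpha> z
        using that PJb ab uniq[of z \<alpha> b] by (cases "\<alpha> = a"; cases "\<alpha> = b") auto
      then show "\<alpha> = \<beta>" if "z \<in> ?J' \<alpha> \<and> z \<in> ?J' \<beta>" for \<alpha> \<beta> z
        using that uniq by metis
      show "(\<Union>\<alpha>. ?J' \<alpha>) = {0..<l}" using union un l l0 by auto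
    qed
    ultimately show ?thesis using J' c False by auto
  qed
qed

text \<open>\<open>W \<alpha>\<close> is the itinerary, with respect to the partition \<open>I\<close>, of the points of \<open>J \<alpha>\<close> until their
  first return to the union of the intervals \<open>J \<alpha>\<close>.\<close>

definition tower ::
  "(real \<Rightarrow> real) \<Rightarrow> ('a \<Rightarrow> real set) \<Rightarrow> real set \<Rightarrow> ('a \<Rightarrow> real set) \<Rightarrow> ('a \<Rightarrow> 'a list) \<Rightarrow> bool" where
  "tower F I D J W \<longleftrightarrow>
     (\<exists>x. interval_partition J x \<and> interval_partition (\<lambda>\<alpha>. first_return F (\<Union>\<alpha>. J \<alpha>) ` J \<alpha>) x) \<and>
     (\<forall>\<alpha>. W \<alpha> \<noteq> []) \<and>
     (\<forall>\<alpha>. \<forall>y\<in>J \<alpha>. (\<forall>k<length (W \<alpha>). (F ^^ k) y \<in> I (W \<alpha> ! k)) \<and>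
        (\<forall>k. 0 < k \<and> k < length (W \<alpha>) \<longrightarrow> (F ^^ k) y \<notin> (\<Union>\<alpha>. J \<alpha>)) \<and>
        (F ^^ length (W \<alpha>)) y \<in> (\<Union>\<alpha>. J \<alpha>)) \<and>
     (\<forall>z\<in>D. \<exists>\<alpha>. \<exists>k<length (W \<alpha>). \<exists>y\<in>J \<alpha>. z = (F ^^ k) y)"

lemma tower_cover:
  assumes "tower F I D J W" "z \<in> D"
  shows "\<exists>\<alpha>. \<exists>k<length (W \<alpha>). \<exists>y\<in>J \<alpha>. z = (F ^^ k) y"
proof -
  have "\<forall>z\<in>D. \<exists>\<alpha>. \<exists>k<length (W \<alpha>). \<exists>y\<in>J \<alpha>. z = (F ^^ k) y"
    using assms(1) unfolding tower_def by (elim conjE)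
  then show ?thesis using assms(2) by (rule bspec)
qed

lemma first_return_timeI:
  assumes "0 < n" "(F ^^ n) y \<in> A" "\<And>k. 0 < k \<Longrightarrow> k < n \<Longrightarrow> (F ^^ k) y \<notin> A"
  shows "first_return_time F A y = n"
  unfolding first_return_time_def
  by (rule Least_equality) (use assms in \<open>auto simp: Suc_le_eq not_less[symmetric]\<close>)

text \<open>Injectivity of \<open>F\<close> cancels the shorter return time; if the two times
  differed, one of the points would visit \<open>A\<close> before its return.\<close>

lemma first_return_inj:
  assumes F: "inj F" and y: "y \<in> A" "y' \<in> A" and eq: "(F ^^ n) y = (F ^^ n') y'"
    and n: "\<And>k. 0 < k \<Longrightarrow> k < n \<Longrightarrow> (F ^^ k) y \<notin> A" "\<And>k. 0 < k \<Longrightarrow> k < n' \<Longrightarrow> (F ^^ k) y' \<notin> A"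
    and pos: "0 < n" "0 < n'"
  shows "y = y'"
proof -
  have *: "y = y'"
    if le: "n \<le> n'" and y: "y \<in> A" and eq: "(F ^^ n) y = (F ^^ n') y'"
      and n': "\<And>k. 0 < k \<Longrightarrow> k < n' \<Longrightarrow> (F ^^ k) y' \<notin> A" and "0 < n"
    for n n' y y'
  proof -
    have "inj (F ^^ n)" using F by (rule inj_fn)
    moreover have "(F ^^ n') y' = (F ^^ n) ((F ^^ (n' - n)) y')"
      using le by (metis add_diff_inverse_nat comp_apply funpow_add not_less)
    ultimately have "y = (F ^^ (n' - n)) y'" using eq by (simp add: inj_eq)
    then show ?thesis using n'[of "n' - n"] y \<open>0 < n\<close> le by (cases "n' = n") auto
  qed
  show ?thesis
    using *[of n n' y y'] *[of n' n y' y] y eq n pos by (cases "n \<le> n'") auto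
qed

lemma tower_first_return:
  assumes "tower F I D J W" "y \<in> J \<alpha>"
  shows "first_return_time F (\<Union>\<alpha>. J \<alpha>) y = length (W \<alpha>)"
    and "first_return F (\<Union>\<alpha>. J \<alpha>) y = (F ^^ length (W \<alpha>)) y"
proof -
  show *: "first_return_time F (\<Union>\<alpha>. J \<alpha>) y = length (W \<alpha>)"
    by (rule first_return_timeI) (use assms in \<open>auto simp: tower_def\<close>)
  show "first_return F (\<Union>\<alpha>. J \<alpha>) y = (F ^^ length (W \<alpha>)) y"
    by (simp add: first_return_def *)
qed

text \<open>The Birkhoff sum of \<open>phi\<close> with values \<open>v\<close> along a stretch of
  orbit with itinerary \<open>w\<close>.\<close>

definition wsum :: "real ^ 'a \<Rightarrow> 'a list \<Rightarrow> real" where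
  "wsum v w = (\<Sum>\<beta>\<leftarrow>w. v $ \<beta>)"

lemma wsum_simps [simp]:
  "wsum v [] = 0" "wsum v (\<beta> # w) = v $ \<beta> + wsum v w" "wsum v (w @ w') = wsum v w + wsum v w'"
  by (auto simp: wsum_def)

lemma wsum_take_Suc: "k < length w \<Longrightarrow> wsum v (take (Suc k) w) = wsum v (take k w) + v $ (w ! k)"
  by (simp add: take_Suc_conv_app_nth)

lemma wsum_0 [simp]: "wsum 0 w = 0" by (induction w) auto

lemma wsum_scaleR: "wsum (c *\<^sub>R v) w = c * wsum v w"
  by (induction w) (auto simp: algebra_simps)

lemma tower_affine:
  assumes "tower F I D J W" "\<And>\<beta>. affine_on (exp (v $ \<beta>)) F (I \<beta>)" "k \<le> length (W \<alpha>)"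
  shows "affine_on (exp (wsum v (take k (W \<alpha>)))) (F ^^ k) (J \<alpha>)"
  using assms(3)
proof (induction k)
  case 0
  then show ?case by (simp add: affine_on_id id_def)
next
  case (Suc k)
  have "(F ^^ k) ` J \<alpha> \<subseteq> I (W \<alpha> ! k)" using assms(1) Suc.prems by (force simp: tower_def)
  then have "affine_on (exp (v $ (W \<alpha> ! k)) * exp (wsum v (take k (W \<alpha>)))) (\<lambda>y. F ((F ^^ k) y)) (J \<alpha>)"
    by (intro affine_on_comp[OF _ affine_on_subset[OF assms(2)]]) (use Suc in auto)
  then show ?case using Suc.prems
    by (simp add: wsum_take_Suc exp_add mult.commute o_def)
qed

lemma tower_return_affine:
  assumes "tower F I D J W" "\<And>\<beta>. affine_on (exp (v $ \<beta>)) F (I \<beta>)"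
  shows "affine_on (exp (wsum v (W \<alpha>))) (first_return F (\<Union>\<alpha>. J \<alpha>)) (J \<alpha>)"
  by (rule affine_on_cong[of _ "F ^^ length (W \<alpha>)"])
    (use tower_affine[OF assms, of "length (W \<alpha>)" \<alpha>] tower_first_return(2)[OF assms(1)] in auto)

text \<open>A point of \<open>J' c\<close> first lands in the removed piece inside
  \<open>J a\<close> and then follows the word of \<open>a\<close>; it cannot land in the removed
  piece again, since that piece is the image of a part of \<open>J b\<close> and
  \<open>a \<noteq> b\<close>. Points under any other letter never meet the removed piece, by
  injectivity of the return map, and keep their words.\<close>

lemma tower_rauzy_move:
  assumes T: "tower F I D J W" and F: "inj F" and aff: "\<And>\<beta>. affine_on (exp (v $ \<beta>)) F (I \<beta>)"
    and move: "rauzy_move (first_return F (\<Union>\<alpha>. J \<alpha>)) J J' a b c" and J': "interval_partition J' x'"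
  shows "tower F I D J' (W(c := W b @ W a))"
proof -
  let ?X = "\<Union>\<alpha>. J \<alpha>" and ?X' = "\<Union>\<alpha>. J' \<alpha>" and ?W = "W(c := W b @ W a)"
  let ?g = "first_return F (\<Union>\<alpha>. J \<alpha>)" and ?g' = "first_return F (\<Union>\<alpha>. J' \<alpha>)"
  obtain x where J: "interval_partition J x" and gJ: "interval_partition (\<lambda>\<alpha>. ?g ` J \<alpha>) x"
    using T unfolding tower_def by blast
  have W: "W \<alpha> \<noteq> []" for \<alpha> using T unfolding tower_def by blast
  have sub: "J' \<alpha> \<subseteq> J \<alpha>" if "\<alpha> \<noteq> c" for \<alpha> using move that unfolding rauzy_move_def by blast
  have ab: "a \<noteq> b" and subc: "J' c \<subseteq> J b" and gsub: "?g ` J' c \<subseteq> J a"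
    and X': "?X' = ?X - ?g ` J' c" using move unfolding rauzy_move_def by blast+
  have X'X: "?X' \<subseteq> ?X" using X' by blast
  have it: "(F ^^ k) y \<in> I (W \<alpha> ! k)" if "y \<in> J \<alpha>" "k < length (W \<alpha>)" for y \<alpha> k
    using T that unfolding tower_def by blast
  have avoid: "(F ^^ k) y \<notin> ?X" if "y \<in> J \<alpha>" "0 < k" "k < length (W \<alpha>)" for y \<alpha> k
    using T that unfolding tower_def by blast
  have g: "?g y = (F ^^ length (W \<alpha>)) y" if "y \<in> J \<alpha>" for y \<alpha>
    using tower_first_return(2)[OF T that] .
  have gX: "?g y \<in> ?X" if "y \<in> J \<alpha>" for y \<alpha>
    using T that g[OF that] unfolding tower_def by auto
  have g_inj: "y = y'" if "?g y = ?g y'" "y \<in> J \<alpha>" "y' \<in> J \<beta>" for y y' \<alpha> \<beta>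
  proof (rule first_return_inj[OF F, of _ ?X _ "length (W \<alpha>)" "length (W \<beta>)"])
    show "(F ^^ length (W \<alpha>)) y = (F ^^ length (W \<beta>)) y'" using that g by metis
  qed (use that avoid W in auto)
  have iter: "(F ^^ (length (W b) + k)) y = (F ^^ k) (?g y)" if "y \<in> J' c" for y k
    using g[of y b] that subc by (subst add.commute) (auto simp: funpow_add)
  have ret: "(\<forall>k<length (?W \<alpha>). (F ^^ k) y \<in> I (?W \<alpha> ! k)) \<and>
        (\<forall>k. 0 < k \<and> k < length (?W \<alpha>) \<longrightarrow> (F ^^ k) y \<notin> ?X') \<and>
        (F ^^ length (?W \<alpha>)) y \<in> ?X'" if y: "y \<in> J' \<alpha>" for y \<alpha>
  proof (cases "\<alpha> = c")
    case True
    have yb: "y \<in> J b" and ga: "?g y \<in> J a" using y True subc gsub by auto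
    have lt: "(F ^^ k) y \<in> I (?W \<alpha> ! k)" if k: "k < length (?W \<alpha>)" for k
    proof (cases "k < length (W b)")
      case True
      then show ?thesis using it[OF yb, of k] \<open>\<alpha> = c\<close> by (simp add: nth_append)
    next
      case False
      then obtain j where j: "k = length (W b) + j" by (metis le_Suc_ex not_less)
      then show ?thesis using it[OF ga, of j] iter[of y j] y k \<open>\<alpha> = c\<close> by (simp add: nth_append)
    qed
    moreover have "(F ^^ k) y \<notin> ?X'" if k: "0 < k" "k < length (?W \<alpha>)" for k
    proof -
      consider "k < length (W b)" | "k = length (W b)" | j where "k = length (W b) + j" "0 < j"
        by (metis less_imp_add_positive linorder_neqE_nat)
      then show ?thesis
      proof cases
        case 1
        then show ?thesis using avoid[OF yb k(1)] X'X by blast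
      next
        case 2
        then have "(F ^^ k) y = ?g y" using g[OF yb] by simp
        then show ?thesis using y True X' by blast
      next
        case 3
        then have "(F ^^ j) (?g y) \<notin> ?X" using avoid[OF ga, of j] k True by simp
        then show ?thesis using iter[of y j] y True 3 X'X by auto
      qed
    qed
    moreover have "(F ^^ length (?W \<alpha>)) y \<in> ?X'"
    proof -
      have "(F ^^ length (?W \<alpha>)) y = ?g (?g y)"
        using iter[of y "length (W a)"] y True g[OF ga] by simp
      moreover have "?g (?g y) \<in> ?X" using gX[OF ga] .
      moreover have "?g (?g y) \<notin> ?g ` J' c"
      proof
        assume "?g (?g y) \<in> ?g ` J' c"
        then obtain y' where y': "y' \<in> J' c" "?g (?g y) = ?g y'" by blast
        then have "?g y \<in> J b" using g_inj[OF y'(2) ga, of b] subc by auto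
        then show False using interval_partition_unique[OF J ga] ab by blast
      qed
      ultimately show ?thesis unfolding X' by simp
    qed
    ultimately show ?thesis by blast
  next
    case False
    then have ya: "y \<in> J \<alpha>" using y sub by blast
    have "?g y \<notin> ?g ` J' c"
    proof
      assume "?g y \<in> ?g ` J' c"
      then obtain y' where y': "y' \<in> J' c" "?g y = ?g y'" by blast
      then have "y = y'" using g_inj[OF y'(2) ya, of b] subc by auto
      then show False using interval_partition_unique[OF J' y] y' False by blast
    qed
    then have "(F ^^ length (W \<alpha>)) y \<in> ?X'" using gX[OF ya] g[OF ya] X' by auto
    moreover have "(F ^^ k) y \<notin> ?X'" if "0 < k" "k < length (W \<alpha>)" for k
      using avoid[OF ya that] X'X by blast
    ultimately show ?thesis using False it[OF ya] by simp
  qed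
  have W': "?W \<alpha> \<noteq> []" for \<alpha> using W by simp
  have g': "?g' y = (F ^^ length (?W \<alpha>)) y" if "y \<in> J' \<alpha>" for y \<alpha>
  proof -
    have "first_return_time F ?X' y = length (?W \<alpha>)"
      by (rule first_return_timeI) (use ret[OF that] W' in auto)
    then show ?thesis by (simp add: first_return_def)
  qed
  have g'_inj: "y = y'" if "?g' y = ?g' y'" "y \<in> J' \<alpha>" "y' \<in> J' \<beta>" for y y' \<alpha> \<beta>
  proof (rule first_return_inj[OF F, of _ ?X' _ "length (?W \<alpha>)" "length (?W \<beta>)"])
    show "(F ^^ length (?W \<alpha>)) y = (F ^^ length (?W \<beta>)) y'" using that g' by metis
    show "0 < length (?W \<alpha>)" "0 < length (?W \<beta>)" using W' by auto
  qed (use that(2,3) ret[OF that(2)] ret[OF that(3)] in auto)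
  \<comment> \<open>A point of the old domain either stays in the new one, where its letter can
    change only from \<open>b\<close> to the loser, or (\<open>cases2\<close>) it is the image of a
    point of the loser's new base and lies higher up in that tower.\<close>
  have cases: "\<exists>\<beta>. y \<in> J' \<beta> \<and> (\<beta> \<noteq> c \<and> \<beta> = \<alpha> \<or> \<beta> = c \<and> \<alpha> = b)"
    if "y \<in> J \<alpha>" "y \<in> ?X'" for y \<alpha>
  proof -
    obtain \<beta> where \<beta>: "y \<in> J' \<beta>" using \<open>y \<in> ?X'\<close> by blast
    then show ?thesis
      using interval_partition_unique[OF J \<open>y \<in> J \<alpha>\<close>] sub[of \<beta>] subc by (cases "\<beta> = c") blast+
  qed
  have cases2: "\<exists>y'\<in>J' c. y = ?g y' \<and> \<alpha> = a" if "y \<in> J \<alpha>" "y \<notin> ?X'" for y \<alpha>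
  proof -
    have "y \<in> ?g ` J' c" using that X' by blast
    then obtain y' where y': "y' \<in> J' c" "y = ?g y'" by blast
    then have "y \<in> J a" using gsub by blast
    then show ?thesis using y' interval_partition_unique[OF J \<open>y \<in> J \<alpha>\<close>] by blast
  qed
  have surj: "\<exists>\<beta>. z \<in> ?g' ` J' \<beta>" if z: "z \<in> ?X'" for z
  proof -
    have "z \<in> ?X" using z X'X by (rule subsetD[rotated])
    also have "?X = (\<Union>\<alpha>. ?g ` J \<alpha>)" using J gJ unfolding interval_partition_def by simp
    finally obtain \<alpha> y where y: "y \<in> J \<alpha>" "z = ?g y" by blast
    show ?thesis
    proof (cases "y \<in> ?X'")
      case True
      then obtain \<beta> where \<beta>: "y \<in> J' \<beta>" "\<beta> \<noteq> c \<and> \<beta> = \<alpha> \<or> \<beta> = c \<and> \<alpha> = b" using cases[OF y(1)] by blast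
      moreover have "\<beta> \<noteq> c" using z X' y(2) \<beta>(1) by blast
      ultimately have "?g' y = z" using g'[OF \<beta>(1)] g[OF y(1)] y(2) by auto
      then show ?thesis using \<beta>(1) by blast
    next
      case False
      then obtain y' where y': "y' \<in> J' c" "y = ?g y'" "\<alpha> = a" using cases2[OF y(1)] by blast
      have "?g' y' = (F ^^ length (W a)) (?g y')"
        using g'[OF y'(1)] iter[OF y'(1)] by simp
      then have "?g' y' = z" using y y' g[OF y(1)] by simp
      then show ?thesis using y'(1) by blast
    qed
  qed
  have aff': "\<exists>s. affine_on s ?g' (J' \<alpha>)" for \<alpha>
  proof -
    have len: "affine_on (exp (wsum v (W \<beta>))) (F ^^ length (W \<beta>)) (J \<beta>)" for \<beta>
      using tower_affine[OF T aff, of "length (W \<beta>)" \<beta>] by simp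
    show ?thesis
    proof (cases "\<alpha> = c")
      case False
      then have "affine_on (exp (wsum v (W \<alpha>))) ?g' (J' \<alpha>)"
        by (intro affine_on_cong[OF affine_on_subset[OF len[of \<alpha>] sub]]) (use False g'[of _ \<alpha>] in auto)
      then show ?thesis by blast
    next
      case True
      have "affine_on (exp (wsum v (W b))) ?g (J' c)"
        by (rule affine_on_cong[OF affine_on_subset[OF len[of b] subc]]) (use g[of _ b] subc in auto)
      moreover have "affine_on (exp (wsum v (W a))) (F ^^ length (W a)) (?g ` J' c)"
        by (rule affine_on_subset[OF len gsub])
      ultimately have "affine_on (exp (wsum v (W a)) * exp (wsum v (W b)))
          (\<lambda>y. (F ^^ length (W a)) (?g y)) (J' c)" by (rule affine_on_comp)
      then have "affine_on (exp (wsum v (W a)) * exp (wsum v (W b))) ?g' (J' c)"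
        by (rule affine_on_cong) (use g'[of _ c] iter in simp)
      then show ?thesis using True by blast
    qed
  qed
  have un': "?X' = {0..<x'}" using J' unfolding interval_partition_def by blast
  have gJ': "interval_partition (\<lambda>\<alpha>. ?g' ` J' \<alpha>) x'"
    unfolding interval_partition_def
  proof (intro conjI allI impI)
    fix \<alpha>
    obtain l r where lr: "l < r" "J' \<alpha> = {l..<r}" using J' unfolding interval_partition_def by blast
    obtain s k where s: "0 < s" "\<forall>y\<in>{l..<r}. ?g' y = k + s * y"
      using aff'[of \<alpha>] lr unfolding affine_on_def by auto
    have "?g' ` J' \<alpha> = {k + s * l..<k + s * r}"
      using affine_image_atLeastLessThan[OF s(2,1)] lr by simp
    moreover have "k + s * l < k + s * r" using s lr by simp
    ultimately show "\<exists>l r. l < r \<and> ?g' ` J' \<alpha> = {l..<r}" by blast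
  next
    show "\<alpha> = \<beta>" if z: "z \<in> ?g' ` J' \<alpha> \<and> z \<in> ?g' ` J' \<beta>" for \<alpha> \<beta> z
    proof -
      obtain y y' where yy: "y \<in> J' \<alpha>" "y' \<in> J' \<beta>" "?g' y = ?g' y'" using z by auto
      then have "y = y'" using g'_inj by blast
      then show ?thesis using interval_partition_unique[OF J'] yy by blast
    qed
    show "(\<Union>\<alpha>. ?g' ` J' \<alpha>) = {0..<x'}"
      unfolding un'[symmetric]
    proof (intro equalityI subsetI)
      fix z assume "z \<in> (\<Union>\<alpha>. ?g' ` J' \<alpha>)"
      then obtain \<alpha> y where y: "y \<in> J' \<alpha>" "z = ?g' y" by blast
      then show "z \<in> ?X'" using ret[OF y(1)] g'[OF y(1)] by simp
    qed (use surj in blast)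
  qed
  have cover: "\<exists>\<alpha>. \<exists>k<length (?W \<alpha>). \<exists>y\<in>J' \<alpha>. z = (F ^^ k) y" if z: "z \<in> D" for z
  proof -
    obtain \<alpha> k y where y: "k < length (W \<alpha>)" "y \<in> J \<alpha>" "z = (F ^^ k) y"
      using tower_cover[OF T z] by blast
    show ?thesis
    proof (cases "y \<in> ?X'")
      case True
      then obtain \<beta> where \<beta>: "y \<in> J' \<beta>" "\<beta> \<noteq> c \<and> \<beta> = \<alpha> \<or> \<beta> = c \<and> \<alpha> = b" using cases[OF y(2)] by blast
      then have "k < length (?W \<beta>)" using y(1) by auto
      then show ?thesis using \<beta>(1) y(3) by blast
    next
      case False
      then obtain y' where y': "y' \<in> J' c" "y = ?g y'" "\<alpha> = a" using cases2[OF y(2)] by blast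
      have "length (W b) + k < length (?W c)" using y(1) y'(3) by simp
      moreover have "z = (F ^^ (length (W b) + k)) y'" using iter[OF y'(1)] y y' by simp
      ultimately show ?thesis using y'(1) by blast
    qed
  qed
  show ?thesis
    unfolding tower_def
  proof (intro conjI)
    show "\<exists>x. interval_partition J' x \<and> interval_partition (\<lambda>\<alpha>. ?g' ` J' \<alpha>) x"
      using J' gJ' by (intro exI conjI)
    show "\<forall>\<alpha>. ?W \<alpha> \<noteq> []" using W' by (rule allI)
    show "\<forall>z\<in>D. \<exists>\<alpha>. \<exists>k<length (?W \<alpha>). \<exists>y\<in>J' \<alpha>. z = (F ^^ k) y" using cover by (rule ballI)
  qed (intro allI ballI, rule ret)
qed

section \<open>Affine interval exchanges and the words of their towers\<close>

lemma cumulative_interval_partition: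
  fixes p :: "'a::finite \<Rightarrow> nat" and L :: "'a \<Rightarrow> real"
  assumes p: "inj p" and L: "\<And>\<alpha>. 0 < L \<alpha>"
  shows "interval_partition
    (\<lambda>\<alpha>. {(\<Sum>\<beta> | p \<beta> < p \<alpha>. L \<beta>)..<(\<Sum>\<beta> | p \<beta> < p \<alpha>. L \<beta>) + L \<alpha>}) (\<Sum>\<alpha>\<in>UNIV. L \<alpha>)"
proof -
  define s where "s \<alpha> = (\<Sum>\<beta> | p \<beta> < p \<alpha>. L \<beta>)" for \<alpha>
  define e where "e \<alpha> = (\<Sum>\<beta> | p \<beta> \<le> p \<alpha>. L \<beta>)" for \<alpha>
  have L0: "0 \<le> L \<alpha>" for \<alpha> using L less_imp_le by blast
  have e: "s \<alpha> + L \<alpha> = e \<alpha>" for \<alpha>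
  proof -
    have "{\<beta>. p \<beta> \<le> p \<alpha>} = insert \<alpha> {\<beta>. p \<beta> < p \<alpha>}" using p by (auto simp: inj_eq less_le)
    then show ?thesis by (simp add: e_def s_def)
  qed
  have s0: "0 \<le> s \<alpha>" for \<alpha> unfolding s_def by (rule sum_nonneg) (rule L0)
  have e_le: "e \<alpha> \<le> (\<Sum>\<alpha>\<in>UNIV. L \<alpha>)" for \<alpha>
    unfolding e_def by (rule sum_mono2) (auto simp: L0)
  have es: "e \<alpha> \<le> s \<beta>" if "p \<alpha> < p \<beta>" for \<alpha> \<beta>
    unfolding e_def s_def by (rule sum_mono2) (use that in \<open>auto simp: L0\<close>)
  have "interval_partition (\<lambda>\<alpha>. {s \<alpha>..<s \<alpha> + L \<alpha>}) (\<Sum>\<alpha>\<in>UNIV. L \<alpha>)"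
    unfolding interval_partition_def
  proof (intro conjI allI impI)
    show "\<exists>l r. l < r \<and> {s \<alpha>..<s \<alpha> + L \<alpha>} = {l..<r}" for \<alpha>
      using L[of \<alpha>] by (intro exI[of _ "s \<alpha>"] exI[of _ "s \<alpha> + L \<alpha>"]) simp
    show "\<alpha> = \<beta>" if z: "z \<in> {s \<alpha>..<s \<alpha> + L \<alpha>} \<and> z \<in> {s \<beta>..<s \<beta> + L \<beta>}" for \<alpha> \<beta> z
    proof (rule ccontr)
      assume "\<alpha> \<noteq> \<beta>"
      then have "p \<alpha> < p \<beta> \<or> p \<beta> < p \<alpha>" using p by (metis injD linorder_neqE_nat)
      then show False using es[of \<alpha> \<beta>] es[of \<beta> \<alpha>] z by (auto simp: e)
    qed
    show "(\<Union>\<alpha>. {s \<alpha>..<s \<alpha> + L \<alpha>}) = {0..<\<Sum>\<alpha>\<in>UNIV. L \<alpha>}"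
    proof (intro equalityI subsetI)
      fix z assume "z \<in> (\<Union>\<alpha>. {s \<alpha>..<s \<alpha> + L \<alpha>})"
      then obtain \<alpha> where "s \<alpha> \<le> z" "z < e \<alpha>" using e by auto
      then show "z \<in> {0..<\<Sum>\<alpha>\<in>UNIV. L \<alpha>}" using s0[of \<alpha>] e_le[of \<alpha>] by simp
    next
      fix z assume z: "z \<in> {0..<\<Sum>\<alpha>\<in>UNIV. L \<alpha>}"
      define m where "m = Max (range p)"
      have "m \<in> range p" unfolding m_def by (rule Max_in) auto
      then obtain \<mu> where \<mu>: "m = p \<mu>" by blast
      have "p \<beta> \<le> p \<mu>" for \<beta> unfolding \<mu>[symmetric] m_def by (rule Max_ge) auto
      then have "e \<mu> = (\<Sum>\<alpha>\<in>UNIV. L \<alpha>)" unfolding e_def by (intro sum.cong) auto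
      then have "z < e \<mu>" using z by simp
      then have "\<exists>k \<alpha>. k = p \<alpha> \<and> z < e \<alpha>" by blast
      \<comment> \<open>The interval containing \<open>z\<close> belongs to the first letter, in the
        order given by \<open>p\<close>, whose right end exceeds \<open>z\<close>.\<close>
      then obtain k where "\<exists>\<alpha>. k = p \<alpha> \<and> z < e \<alpha>" and least: "\<And>k'. k' < k \<Longrightarrow> \<not> (\<exists>\<alpha>. k' = p \<alpha> \<and> z < e \<alpha>)"
        using exists_least_iff[of "\<lambda>k. \<exists>\<alpha>. k = p \<alpha> \<and> z < e \<alpha>"] by blast
      then obtain \<alpha> where \<alpha>: "k = p \<alpha>" "z < e \<alpha>" by blast
      have "s \<alpha> \<le> z"
      proof (cases "{\<beta>. p \<beta> < p \<alpha>} = {}")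
        case True
        then show ?thesis using z by (simp add: s_def)
      next
        case False
        then have "Max (p ` {\<beta>. p \<beta> < p \<alpha>}) \<in> p ` {\<beta>. p \<beta> < p \<alpha>}" by (intro Max_in) auto
        then obtain \<gamma> where \<gamma>: "p \<gamma> < p \<alpha>" "Max (p ` {\<beta>. p \<beta> < p \<alpha>}) = p \<gamma>" by auto
        have "p \<beta> \<le> p \<gamma>" if "p \<beta> < p \<alpha>" for \<beta> unfolding \<gamma>(2)[symmetric] using that by (intro Max_ge) auto
        then have "s \<alpha> = e \<gamma>" unfolding s_def e_def using \<gamma>(1) by (intro sum.cong) auto
        then show ?thesis using least[of "p \<gamma>"] \<gamma> \<alpha> by force
      qed
      then show "z \<in> (\<Union>\<alpha>. {s \<alpha>..<s \<alpha> + L \<alpha>})" using \<alpha> e by auto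
    qed
  qed
  then show ?thesis by (simp add: s_def)
qed

lemma aiet_interval_partition:
  assumes "is_aiet f"
  shows "interval_partition (aiet_interval f) (\<Sum>\<alpha>\<in>UNIV. len f $ \<alpha>)"
proof -
  have "inj (fst (perm f))" using assms by (simp add: is_aiet_def irreducible_perm_def bij_betw_def)
  then show ?thesis
    using cumulative_interval_partition[of "fst (perm f)" "\<lambda>\<alpha>. len f $ \<alpha>"] assms
    by (simp add: is_aiet_def aiet_interval_def[abs_def] top_end_def)
qed

lemma UN_aiet_interval: "is_aiet f \<Longrightarrow> (\<Union>\<alpha>. aiet_interval f \<alpha>) = aiet_domain f"
  using aiet_interval_partition unfolding interval_partition_def aiet_domain_def by blast

lemma aiet_map_on_interval:
  assumes "is_aiet f" "x \<in> aiet_interval f \<beta>"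
  shows "aiet_map f x = bot_end f \<beta> + exp (logslope f $ \<beta>) * (x - top_end f \<beta>)"
proof -
  have "x \<in> aiet_domain f" using assms UN_aiet_interval by blast
  moreover have "(THE \<alpha>. x \<in> aiet_interval f \<alpha>) = \<beta>"
    using assms(2) interval_partition_unique[OF aiet_interval_partition[OF assms(1)]]
    by (intro the_equality) blast+
  ultimately show ?thesis by (simp add: aiet_map_def Let_def)
qed

lemma aiet_map_affine_on:
  assumes "is_aiet f"
  shows "affine_on (exp (logslope f $ \<beta>)) (aiet_map f) (aiet_interval f \<beta>)"
  unfolding affine_on_def
proof (intro conjI exI ballI)
  fix y assume "y \<in> aiet_interval f \<beta>"
  then show "aiet_map f y = (bot_end f \<beta> - exp (logslope f $ \<beta>) * top_end f \<beta>) + exp (logslope f $ \<beta>) * y"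
    using aiet_map_on_interval[OF assms] by (simp add: algebra_simps)
qed simp

lemma aiet_image_interval:
  assumes "is_aiet f"
  shows "aiet_map f ` aiet_interval f \<beta> =
    {bot_end f \<beta>..<bot_end f \<beta> + exp (logslope f $ \<beta>) * len f $ \<beta>}"
proof -
  let ?s = "exp (logslope f $ \<beta>)"
  have "aiet_map f ` {top_end f \<beta>..<top_end f \<beta> + len f $ \<beta>} =
    {(bot_end f \<beta> - ?s * top_end f \<beta>) + ?s * top_end f \<beta>..<
     (bot_end f \<beta> - ?s * top_end f \<beta>) + ?s * (top_end f \<beta> + len f $ \<beta>)}"
    by (rule affine_image_atLeastLessThan)
      (use aiet_map_on_interval[OF assms] in \<open>auto simp: aiet_interval_def algebra_simps\<close>)
  then show ?thesis by (simp add: aiet_interval_def algebra_simps)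
qed

lemma aiet_image_partition:
  assumes "is_aiet f"
  shows "interval_partition (\<lambda>\<alpha>. aiet_map f ` aiet_interval f \<alpha>) (\<Sum>\<alpha>\<in>UNIV. len f $ \<alpha>)"
proof -
  have "inj (snd (perm f))" using assms by (simp add: is_aiet_def irreducible_perm_def bij_betw_def)
  then show ?thesis
    using cumulative_interval_partition[of "snd (perm f)" "\<lambda>\<alpha>. exp (logslope f $ \<alpha>) * len f $ \<alpha>"] assms
    by (simp add: is_aiet_def aiet_image_interval[OF assms] bot_end_def)
qed

lemma aiet_map_domain:
  assumes "is_aiet f"
  shows "aiet_map f ` aiet_domain f = aiet_domain f"
proof -
  have "aiet_map f ` aiet_domain f = (\<Union>\<alpha>. aiet_map f ` aiet_interval f \<alpha>)"
    using UN_aiet_interval[OF assms] by blast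
  also have "\<dots> = aiet_domain f"
    using aiet_image_partition[OF assms] unfolding interval_partition_def aiet_domain_def by blast
  finally show ?thesis .
qed

lemma bij_aiet_map:
  assumes "is_aiet f"
  shows "bij (aiet_map f)"
proof (rule bijI)
  have out: "aiet_map f x = x" if "x \<notin> aiet_domain f" for x using that by (simp add: aiet_map_def)
  have D: "aiet_map f x \<in> aiet_domain f \<longleftrightarrow> x \<in> aiet_domain f" for x
    using out[of x] aiet_map_domain[OF assms] by (metis imageI)
  show "inj (aiet_map f)"
  proof (rule injI)
    fix x y assume eq: "aiet_map f x = aiet_map f y"
    show "x = y"
    proof (cases "x \<in> aiet_domain f")
      case True
      then have "y \<in> aiet_domain f" using D eq by metis
      then obtain \<alpha> \<beta> where xy: "x \<in> aiet_interval f \<alpha>" "y \<in> aiet_interval f \<beta>"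
        using True UN_aiet_interval[OF assms] by blast
      then have "\<alpha> = \<beta>"
        using interval_partition_unique[OF aiet_image_partition[OF assms], of "aiet_map f x" \<alpha> \<beta>] eq
        by (metis imageI)
      then show ?thesis
        using eq aiet_map_on_interval[OF assms xy(1)] aiet_map_on_interval[OF assms xy(2)] by simp
    next
      case False
      then show ?thesis using eq D out by metis
    qed
  qed
  show "surj (aiet_map f)"
    using out aiet_map_domain[OF assms] by (metis imageE surjI surj_def)
qed

lemma tower_0:
  assumes "is_aiet f"
  shows "tower (aiet_map f) (aiet_interval f) (aiet_domain f) (aiet_interval f) (\<lambda>\<alpha>. [\<alpha>])"
proof -
  let ?F = "aiet_map f" and ?I = "aiet_interval f"
  have X: "(\<Union>\<alpha>. ?I \<alpha>) = aiet_domain f" using UN_aiet_interval[OF assms] .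
  have ret: "?F y \<in> aiet_domain f" if "y \<in> ?I \<alpha>" for y \<alpha>
    using that X aiet_map_domain[OF assms] by blast
  have "first_return_time ?F (aiet_domain f) y = 1" if "y \<in> ?I \<alpha>" for y \<alpha>
    by (rule first_return_timeI) (use ret[OF that] in auto)
  then have "first_return ?F (\<Union>\<alpha>. ?I \<alpha>) y = ?F y" if "y \<in> ?I \<alpha>" for y \<alpha>
    using that unfolding X by (simp add: first_return_def)
  then have "(\<lambda>\<alpha>. first_return ?F (\<Union>\<alpha>. ?I \<alpha>) ` ?I \<alpha>) = (\<lambda>\<alpha>. ?F ` ?I \<alpha>)"
    by (intro ext image_cong) auto
  then have "\<exists>x. interval_partition ?I x \<and>
      interval_partition (\<lambda>\<alpha>. first_return ?F (\<Union>\<alpha>. ?I \<alpha>) ` ?I \<alpha>) x"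
    using aiet_interval_partition[OF assms] aiet_image_partition[OF assms] by auto
  moreover have "\<forall>z\<in>aiet_domain f. \<exists>\<alpha>. \<exists>k<length [\<alpha>]. \<exists>y\<in>?I \<alpha>. z = (?F ^^ k) y"
    using X by auto
  ultimately show ?thesis
    unfolding tower_def using ret X by simp
qed

definition loser :: "'a::finite perm_pair \<times> rv_type \<Rightarrow> 'a" where
  "loser p = (if snd p = Top then last_bot (fst p) else last_top (fst p))"

text \<open>In both types of a step the loser first follows the last bottom letter and then the last top
  letter, so the itineraries are determined by the rotation number.\<close>

primrec words :: "(nat \<Rightarrow> 'a::finite perm_pair \<times> rv_type) \<Rightarrow> nat \<Rightarrow> 'a \<Rightarrow> 'a list" where
  "words \<gamma> 0 = (\<lambda>\<alpha>. [\<alpha>])"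
| "words \<gamma> (Suc n) = (words \<gamma> n)
     (loser (\<gamma> n) := words \<gamma> n (last_bot (fst (\<gamma> n))) @ words \<gamma> n (last_top (fst (\<gamma> n))))"

text \<open>By periodicity the steps after \<open>N\<close> obey the same recursion as the steps
  after 0, started from the words of order \<open>N\<close> instead of single letters: a
  substitution.\<close>

lemma words_add:
  assumes "\<And>n. \<gamma> (n + N) = \<gamma> n"
  shows "words \<gamma> (N + m) \<alpha> = concat (map (words \<gamma> N) (words \<gamma> m \<alpha>))"
proof (induction m arbitrary: \<alpha>)
  case (Suc m)
  have "\<gamma> (N + m) = \<gamma> m" using assms[of m] by (simp add: add.commute)
  then show ?case using Suc by simp
qed simp

abbreviation rv_words :: "'a::finite aiet \<Rightarrow> nat \<Rightarrow> 'a \<Rightarrow> 'a list" where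
  "rv_words f \<equiv> words (rotation_number f)"

abbreviation rv_tower :: "'a::finite aiet \<Rightarrow> nat \<Rightarrow> bool" where
  "rv_tower f n \<equiv> tower (aiet_map f) (aiet_interval f) (aiet_domain f) (rv_interval f n) (rv_words f n)"

abbreviation rv_move :: "'a::finite aiet \<Rightarrow> nat \<Rightarrow> bool" where
  "rv_move f n \<equiv> rauzy_move (rv_map f n) (rv_interval f n) (rv_interval f (Suc n))
     (last_top (rv_perm f n)) (last_bot (rv_perm f n)) (loser (rotation_number f n))"

lemma rv_map_eq: "rv_map f n = first_return (aiet_map f) (\<Union>\<alpha>. rv_interval f n \<alpha>)"
  by (simp add: rv_map_def rv_domain_def)

lemma rv_tower_Suc:
  assumes f: "is_aiet f" "infinitely_renormalizable f"
    and differ: "last_top (rv_perm f n) \<noteq> last_bot (rv_perm f n)"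
    and T: "rv_tower f n"
  shows "rv_move f n \<and> rv_tower f (Suc n)"
proof -
  let ?J = "rv_interval f n" and ?a = "last_top (rv_perm f n)" and ?b = "last_bot (rv_perm f n)"
  obtain x where J: "interval_partition ?J x" "interval_partition (\<lambda>\<alpha>. rv_map f n ` ?J \<alpha>) x"
    using T unfolding tower_def rv_map_eq by blast
  have aff: "\<exists>s. affine_on s (rv_map f n) (?J \<alpha>)" for \<alpha>
    using tower_return_affine[OF T aiet_map_affine_on[OF f(1)]] unfolding rv_map_eq by blast
  have ne: "measure lborel (?J ?a) \<noteq> measure lborel (rv_map f n ` ?J ?b)"
    using f(2) by (simp add: infinitely_renormalizable_def rv_top_length_def rv_bot_length_def)
  have c: "loser (rotation_number f n) =
      (if measure lborel (?J ?a) > measure lborel (rv_map f n ` ?J ?b) then ?b else ?a)"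
    by (simp add: loser_def rotation_number_def rv_step_type_def rv_top_length_def rv_bot_length_def)
  have step: "rv_interval f (Suc n) = rv_step (rv_map f n) ?J" by (simp add: rv_map_eq)
  obtain x' where move: "rv_move f n" and x': "interval_partition (rv_interval f (Suc n)) x'"
    using rauzy_move_rv_step[OF J aff, of ?a ?b "loser (rotation_number f n)"] differ ne c
    unfolding step rv_perm_def by auto
  have "tower (aiet_map f) (aiet_interval f) (aiet_domain f) (rv_interval f (Suc n))
     ((rv_words f n)(loser (rotation_number f n) := rv_words f n ?b @ rv_words f n ?a))"
    by (rule tower_rauzy_move[OF T bij_is_inj[OF bij_aiet_map[OF f(1)]] aiet_map_affine_on[OF f(1)]
        move[unfolded rv_map_eq] x'])
  then show ?thesis using move by (simp add: rotation_number_def)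
qed

text \<open>The return map of an IET is a translation on each interval, so a common last letter
  would make the two lengths compared in the step equal.\<close>

lemma iet_last_letters_differ:
  assumes T: "is_iet T" "infinitely_renormalizable T" and tower: "rv_tower T n"
  shows "last_top (rv_perm T n) \<noteq> last_bot (rv_perm T n)"
proof
  let ?J = "rv_interval T n" and ?a = "last_top (rv_perm T n)" and ?g = "rv_map T n"
  assume eq: "last_top (rv_perm T n) = last_bot (rv_perm T n)"
  obtain x where "interval_partition ?J x" using tower unfolding tower_def by blast
  then obtain l r where lr: "l < r" "?J ?a = {l..<r}" unfolding interval_partition_def by blast
  have "affine_on 1 ?g (?J ?a)"
    using tower_return_affine[OF tower aiet_map_affine_on, of ?a] T(1) unfolding rv_map_eq
    by (simp add: is_iet_def)
  then obtain c where "\<forall>y\<in>{l..<r}. ?g y = c + 1 * y" unfolding affine_on_def lr by blast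
  then have "?g ` ?J ?a = {c + 1 * l..<c + 1 * r}" unfolding lr by (rule affine_image_atLeastLessThan) simp
  then have "measure lborel (?g ` ?J ?a) = measure lborel (?J ?a)" using lr by simp
  then have "rv_top_length T n = rv_bot_length T n"
    unfolding rv_top_length_def rv_bot_length_def eq[symmetric] by simp
  then show False using T(2) by (simp add: infinitely_renormalizable_def)
qed

locale renormalizable_aiet =
  fixes f :: "'a::finite aiet"
  assumes is_aiet: "is_aiet f" and renormalizable: "infinitely_renormalizable f"
    and differ: "last_top (rv_perm f n) \<noteq> last_bot (rv_perm f n)"
begin

lemma tower: "rv_tower f n"
proof (induction n)
  case 0
  then show ?case using tower_0[OF is_aiet] by simp
next
  case (Suc n)
  then show ?case using rv_tower_Suc[OF is_aiet renormalizable differ] by blast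
qed

lemma move: "rv_move f n"
  using rv_tower_Suc[OF is_aiet renormalizable differ tower] by blast

end

lemma iet_renormalizable:
  assumes T: "is_iet T" "infinitely_renormalizable T"
  shows "renormalizable_aiet T"
proof -
  have aiet: "is_aiet T" using T by (simp add: is_iet_def)
  have tower: "rv_tower T n" for n
  proof (induction n)
    case 0
    then show ?case using tower_0[OF aiet] by simp
  next
    case (Suc n)
    then show ?case using rv_tower_Suc[OF aiet T(2) iet_last_letters_differ[OF T]] by blast
  qed
  show ?thesis
    by unfold_locales (use aiet T iet_last_letters_differ[OF T tower] in auto)
qed

text \<open>The return maps of \<open>f\<close> need not be translations, so distinctness of the
  last letters is not read off from lengths; it is inherited from \<open>T\<close> through the
  permutations recorded in the rotation number.\<close>

lemma Aff_renormalizable: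
  assumes "renormalizable_aiet T" "f \<in> Aff T \<omega>"
  shows "renormalizable_aiet f"
proof -
  have "rv_perm f n = rv_perm T n" for n
    using assms(2) by (auto simp: Aff_def rotation_number_def dest!: fun_cong[of _ _ n])
  then show ?thesis
    using assms by (auto simp: renormalizable_aiet_def Aff_def)
qed

section \<open>Measures with piecewise constant Jacobian\<close>

declare rv_interval.simps(2) [simp del]

text \<open>The sum over the floors of a tower of the values of \<open>h\<close>, weighted by the
  exponential of the Birkhoff sum so far. For the word of \<open>\<alpha>\<close> it is the row
  \<open>\<alpha>\<close> of the twisted matrix applied to \<open>h\<close>.\<close>

fun twisted_sum :: "real ^ 'a \<Rightarrow> 'a list \<Rightarrow> ('a \<Rightarrow> real) \<Rightarrow> real" where
  "twisted_sum v [] h = 0"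
| "twisted_sum v (\<beta> # w) h = h \<beta> + exp (v $ \<beta>) * twisted_sum v w h"

lemma twisted_sum_append:
  "twisted_sum v (w @ w') h = twisted_sum v w h + exp (wsum v w) * twisted_sum v w' h"
  by (induction w) (auto simp: exp_add algebra_simps)

text \<open>If replacing a letter by its word preserves Birkhoff sums, the weights in front of later
  words are unchanged, and substitution of words becomes composition of linear maps. This is how the
  hypothesis that \<open>M\<close> fixes \<omega> enters.\<close>

lemma twisted_sum_concat:
  assumes "\<And>\<beta>. wsum v (V \<beta>) = v $ \<beta>"
  shows "twisted_sum v (concat (map V w)) h = twisted_sum v w (\<lambda>\<beta>. twisted_sum v (V \<beta>) h)"
  by (induction w) (auto simp: twisted_sum_append assms)

lemma twisted_sum_conv_sum:
  "twisted_sum v w h = (\<Sum>k<length w. exp (wsum v (take k w)) * h (w ! k))"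
proof (induction w)
  case (Cons \<beta> w)
  then show ?case
    by (simp add: sum.lessThan_Suc_shift exp_add sum_distrib_left mult.assoc del: sum.lessThan_Suc)
qed simp

lemma wsum_conv_card:
  fixes v :: "real ^ 'a"
  shows "wsum v w = (\<Sum>\<beta>\<in>UNIV. real (card {k. k < length w \<and> w ! k = \<beta>}) * v $ \<beta>)"
proof -
  have "wsum v w = (\<Sum>\<beta>\<in>UNIV. real (length (filter (\<lambda>x. x = \<beta>) w)) * v $ \<beta>)"
  proof (induction w)
    case (Cons \<alpha> w)
    have "real (length (filter (\<lambda>x. x = \<beta>) (\<alpha> # w))) * v $ \<beta> =
        (if \<beta> = \<alpha> then v $ \<beta> else 0) + real (length (filter (\<lambda>x. x = \<beta>) w)) * v $ \<beta>" for \<beta>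
      by (simp add: distrib_right)
    then show ?case using Cons by (simp add: sum.distrib del: filter.simps)
  qed simp
  then show ?thesis by (simp add: length_filter_conv_card)
qed

lemma wsum_concat:
  assumes "\<And>\<beta>. wsum v (V \<beta>) = v $ \<beta>"
  shows "wsum v (concat (map V w)) = wsum v w"
  by (induction w) (auto simp: assms)

lemma affine_on_borel_image:
  assumes "affine_on s g J" "B \<subseteq> J" "B \<in> sets borel"
  shows "g ` B \<in> sets borel"
proof -
  obtain c where s: "0 < s" and c: "\<forall>y\<in>B. g y = c + s * y"
    using assms unfolding affine_on_def by blast
  have "g ` B = (\<lambda>z. (z - c) / s) -` B \<inter> space borel"
  proof (intro equalityI subsetI)
    fix z assume "z \<in> (\<lambda>z. (z - c) / s) -` B \<inter> space borel"
    then have "(z - c) / s \<in> B" "z = c + s * ((z - c) / s)" using s by auto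
    then show "z \<in> g ` B" using c by (metis imageI)
  qed (use s c in auto)
  also have "\<dots> \<in> sets borel"
    by (rule measurable_sets[OF _ assms(3)]) simp
  finally show ?thesis .
qed

text \<open>A common form for the three kinds of measures: \<open>v = 0\<close> for an invariant
  measure, \<open>v = logslope f\<close> for Lebesgue measure, and the conformal measure of
  \<open>T\<close>. Stated on images of sets, it can be iterated up a tower.\<close>

definition conformal_on :: "'a::finite aiet \<Rightarrow> real ^ 'a \<Rightarrow> real measure \<Rightarrow> bool" where
  "conformal_on f v m \<longleftrightarrow> prob_space m \<and> sets m = sets borel \<and> measure m (aiet_domain f) = 1 \<and>
     (\<forall>\<beta> A. A \<in> sets borel \<longrightarrow> A \<subseteq> aiet_interval f \<beta> \<longrightarrow>
        measure m (aiet_map f ` A) = exp (v $ \<beta>) * measure m A)"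

section \<open>Geometric data and masses of order n in terms of words\<close>

context renormalizable_aiet
begin

lemma rv_interval_Ico: "\<exists>l r. l < r \<and> rv_interval f n \<alpha> = {l..<r}"
proof -
  obtain x where "interval_partition (rv_interval f n) x" using tower[of n] unfolding tower_def by blast
  then show ?thesis unfolding interval_partition_def by blast
qed

lemma rv_interval_nonempty: "rv_interval f n \<alpha> \<noteq> {}"
  using rv_interval_Ico[of n \<alpha>] by auto

lemma rv_interval_unique:
  assumes "z \<in> rv_interval f n \<alpha>" "z \<in> rv_interval f n \<beta>"
  shows "\<alpha> = \<beta>"
proof -
  obtain x where "interval_partition (rv_interval f n) x" using tower[of n] unfolding tower_def by blast
  then show ?thesis using assms by (rule interval_partition_unique)
qed

lemma itinerary:
  assumes "y \<in> rv_interval f n \<alpha>" "k < length (rv_words f n \<alpha>)"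
  shows "(aiet_map f ^^ k) y \<in> aiet_interval f (rv_words f n \<alpha> ! k)"
  using tower[of n] assms unfolding tower_def by blast

lemma itinerary_avoid:
  assumes "y \<in> rv_interval f n \<alpha>" "0 < k" "k < length (rv_words f n \<alpha>)"
  shows "(aiet_map f ^^ k) y \<notin> rv_interval f n \<beta>"
  using tower[of n] assms unfolding tower_def by blast

lemma rv_time_eq: "rv_time f n \<alpha> = length (rv_words f n \<alpha>)"
proof -
  have *: "first_return_time (aiet_map f) (rv_domain f n) x = length (rv_words f n \<alpha>)"
    if "x \<in> rv_interval f n \<alpha>" for x
    using tower_first_return(1)[OF tower that] by (simp add: rv_domain_def)
  show ?thesis unfolding rv_time_def
    by (rule the_equality) (use * rv_interval_nonempty[of n \<alpha>] in auto)
qed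

lemma image_subset_interval_iff:
  assumes "k < length (rv_words f n \<alpha>)"
  shows "(aiet_map f ^^ k) ` rv_interval f n \<alpha> \<subseteq> aiet_interval f \<beta> \<longleftrightarrow> rv_words f n \<alpha> ! k = \<beta>"
proof
  obtain y where y: "y \<in> rv_interval f n \<alpha>" using rv_interval_nonempty[of n \<alpha>] by blast
  assume "(aiet_map f ^^ k) ` rv_interval f n \<alpha> \<subseteq> aiet_interval f \<beta>"
  then have "(aiet_map f ^^ k) y \<in> aiet_interval f \<beta>" using y by blast
  then show "rv_words f n \<alpha> ! k = \<beta>"
    using itinerary[OF y assms] interval_partition_unique[OF aiet_interval_partition[OF is_aiet]] by blast
qed (use itinerary assms in blast)

lemma visited_eq: "k < length (rv_words f n \<alpha>) \<Longrightarrow> visited f n \<alpha> k = rv_words f n \<alpha> ! k"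
  unfolding visited_def by (simp add: image_subset_interval_iff)

lemma phi_on_interval: "x \<in> aiet_interval f \<beta> \<Longrightarrow> phi f v x = v $ \<beta>"
proof -
  assume x: "x \<in> aiet_interval f \<beta>"
  have "v $ \<alpha> * indicator (aiet_interval f \<alpha>) x = (if \<alpha> = \<beta> then v $ \<beta> else 0)" for \<alpha>
  proof (cases "\<alpha> = \<beta>")
    case False
    then have "x \<notin> aiet_interval f \<alpha>"
      using interval_partition_unique[OF aiet_interval_partition[OF is_aiet] x, of \<alpha>] by blast
    then show ?thesis using False by simp
  qed (use x in simp)
  then show ?thesis by (simp add: phi_def)
qed

lemma S_val_eq:
  assumes "i \<le> length (rv_words f n \<alpha>)"
  shows "S_val f n v \<alpha> i = wsum v (take i (rv_words f n \<alpha>))"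
proof -
  have *: "birkhoff_sum (aiet_map f) i (phi f v) x = wsum v (take i (rv_words f n \<alpha>))"
    if x: "x \<in> rv_interval f n \<alpha>" for x
    using assms
  proof (induction i)
    case (Suc i)
    then show ?case
      using phi_on_interval[OF itinerary[OF x, of i]] by (simp add: birkhoff_sum_def wsum_take_Suc)
  qed (simp add: birkhoff_sum_def)
  show ?thesis unfolding S_val_def
    by (rule the_equality) (use * rv_interval_nonempty[of n \<alpha>] in auto)
qed

lemma ss_matrix_eq:
  "ss_matrix f n $ \<alpha> $ \<beta> = real (card {k. k < length (rv_words f n \<alpha>) \<and> rv_words f n \<alpha> ! k = \<beta>})"
proof -
  have "{k. k < rv_time f n \<alpha> \<and> (aiet_map f ^^ k) ` rv_interval f n \<alpha> \<subseteq> aiet_interval f \<beta>}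
    = {k. k < length (rv_words f n \<alpha>) \<and> rv_words f n \<alpha> ! k = \<beta>}"
    by (intro Collect_cong) (use image_subset_interval_iff rv_time_eq in metis)
  then show ?thesis by (simp add: ss_matrix_def)
qed

lemma twisted_matrix_eq:
  "twisted_matrix f n v $ \<alpha> $ \<beta> =
    (\<Sum>k<length (rv_words f n \<alpha>). exp (wsum v (take k (rv_words f n \<alpha>))) * of_bool (rv_words f n \<alpha> ! k = \<beta>))"
proof -
  let ?w = "rv_words f n \<alpha>"
  have "twisted_matrix f n v $ \<alpha> $ \<beta> =
      (\<Sum>k | k < length ?w \<and> visited f n \<alpha> k = \<beta>. exp (S_val f n v \<alpha> k))"
    by (simp add: twisted_matrix_def rv_time_eq)
  also have "\<dots> = (\<Sum>k | k < length ?w \<and> ?w ! k = \<beta>. exp (wsum v (take k ?w)))"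
    by (rule sum.cong) (auto simp: visited_eq S_val_eq)
  also have "\<dots> = (\<Sum>k<length ?w. exp (wsum v (take k ?w)) * of_bool (?w ! k = \<beta>))"
    by (rule sum.mono_neutral_cong_left) auto
  finally show ?thesis .
qed

lemma ss_matrix_mult: "(ss_matrix f n *v v) $ \<alpha> = wsum v (rv_words f n \<alpha>)"
  by (simp add: matrix_vector_mult_def ss_matrix_eq wsum_conv_card)

lemma rv_interval_borel: "rv_interval f n \<alpha> \<in> sets borel"
  using rv_interval_Ico[of n \<alpha>] by auto

lemma conformal_on_iterate:
  assumes m: "conformal_on f v m" and A: "A \<in> sets borel" "A \<subseteq> rv_interval f n \<alpha>"
    and k: "k \<le> length (rv_words f n \<alpha>)"
  shows "(aiet_map f ^^ k) ` A \<in> sets borel \<and>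
    measure m ((aiet_map f ^^ k) ` A) = exp (wsum v (take k (rv_words f n \<alpha>))) * measure m A"
  using k
proof (induction k)
  case (Suc k)
  let ?B = "(aiet_map f ^^ k) ` A" and ?\<beta> = "rv_words f n \<alpha> ! k"
  have sub: "?B \<subseteq> aiet_interval f ?\<beta>" using A itinerary Suc.prems by (auto simp: Suc_le_eq)
  have img: "(aiet_map f ^^ Suc k) ` A = aiet_map f ` ?B" by (simp add: image_comp)
  have B: "?B \<in> sets borel" using Suc by simp
  have "measure m (aiet_map f ` ?B) = exp (v $ ?\<beta>) * measure m ?B"
    using m B sub unfolding conformal_on_def by blast
  then show ?case
    using Suc affine_on_borel_image[OF aiet_map_affine_on[OF is_aiet] sub B] unfolding img
    by (simp add: wsum_take_Suc exp_add)
qed (use A in simp)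

text \<open>An interval consists of what its own letter keeps, of the loser's new base if that was
  taken from it (\<open>\<alpha> = b\<close>), and of the removed piece
  (\<open>\<alpha> = a\<close>). The latter is the image of the loser's base under the return map,
  hence the exponential factor.\<close>

lemma measure_rv_interval_step:
  fixes n :: nat
  assumes m: "conformal_on f v m"
  defines "a \<equiv> last_top (rv_perm f n)" and "b \<equiv> last_bot (rv_perm f n)"
    and "c \<equiv> loser (rotation_number f n)"
  shows "measure m (rv_interval f n \<alpha>) =
    of_bool (\<alpha> \<noteq> c) * measure m (rv_interval f (Suc n) \<alpha>) +
    of_bool (\<alpha> = b) * measure m (rv_interval f (Suc n) c) +
    of_bool (\<alpha> = a) * exp (wsum v (rv_words f n b)) * measure m (rv_interval f (Suc n) c)"
proof -
  let ?J = "rv_interval f n" and ?J' = "rv_interval f (Suc n)" and ?g = "rv_map f n"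
  interpret prob_space m using m by (simp add: conformal_on_def)
  have sets: "sets m = sets borel" using m by (simp add: conformal_on_def)
  have sub: "\<And>\<alpha>. \<alpha> \<noteq> c \<Longrightarrow> ?J' \<alpha> \<subseteq> ?J \<alpha>" and subb: "?J' c \<subseteq> ?J b" and suba: "?g ` ?J' c \<subseteq> ?J a"
    and un: "(\<Union>\<alpha>. ?J' \<alpha>) = (\<Union>\<alpha>. ?J \<alpha>) - ?g ` ?J' c"
    using move[of n] unfolding rauzy_move_def a_def b_def c_def by blast+
  have g: "?g y = (aiet_map f ^^ length (rv_words f n b)) y" if "y \<in> ?J' c" for y
    using tower_first_return(2)[OF tower, of y n b] subb that unfolding rv_map_eq by blast
  then have gJ: "?g ` ?J' c = (aiet_map f ^^ length (rv_words f n b)) ` ?J' c" by (rule image_cong[OF refl])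
  have meas: "?g ` ?J' c \<in> sets borel \<and> measure m (?g ` ?J' c) = exp (wsum v (rv_words f n b)) * measure m (?J' c)"
    unfolding gJ using conformal_on_iterate[OF m rv_interval_borel subb] by simp
  define P Q R where "P = (if \<alpha> \<noteq> c then ?J' \<alpha> else {})" and "Q = (if \<alpha> = b then ?J' c else {})"
    and "R = (if \<alpha> = a then ?g ` ?J' c else {})"
  have PQR: "P \<in> sets m" "Q \<in> sets m" "R \<in> sets m"
    using rv_interval_borel meas by (auto simp: P_def Q_def R_def sets)
  have "?J \<alpha> = P \<union> Q \<union> R"
  proof (intro equalityI subsetI)
    fix y assume y: "y \<in> ?J \<alpha>"
    show "y \<in> P \<union> Q \<union> R"
    proof (cases "y \<in> ?g ` ?J' c")
      case True
      then have "\<alpha> = a" using suba y rv_interval_unique by blast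
      then show ?thesis using True by (simp add: R_def)
    next
      case False
      then obtain \<beta> where \<beta>: "y \<in> ?J' \<beta>" using un y by blast
      show ?thesis
      proof (cases "\<beta> = c")
        case True
        then have "\<alpha> = b" using subb y \<beta> rv_interval_unique by blast
        then show ?thesis using \<beta> True by (simp add: Q_def)
      next
        case False
        then have "\<alpha> = \<beta>" using sub y \<beta> rv_interval_unique by blast
        then show ?thesis using \<beta> False by (simp add: P_def)
      qed
    qed
  next
    fix y assume "y \<in> P \<union> Q \<union> R"
    then show "y \<in> ?J \<alpha>" using sub subb suba by (auto simp: P_def Q_def R_def split: if_splits)
  qed
  moreover have "P \<inter> Q = {}"
    using rv_interval_unique by (auto simp: P_def Q_def)
  moreover have "(P \<union> Q) \<inter> R = {}"
    using un by (auto simp: P_def Q_def R_def)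
  ultimately have "measure m (?J \<alpha>) = measure m P + measure m Q + measure m R"
    using finite_measure_Union PQR by (metis sets.Un)
  then show ?thesis using meas by (simp add: P_def Q_def R_def)
qed

text \<open>The recursions for words and for masses are dual: joining the words of \<open>b\<close>
  and \<open>a\<close> at the loser collects exactly the coefficients with which the loser's mass
  enters their intervals. The weighted sum therefore does not depend on \<open>k\<close>.\<close>

lemma measure_rv_interval_add:
  assumes m: "conformal_on f v m" and per: "\<And>n. rotation_number f (n + n0) = rotation_number f n"
    and fixv: "\<And>\<beta>. wsum v (rv_words f n0 \<beta>) = v $ \<beta>"
  shows "(\<Sum>\<alpha>\<in>UNIV. twisted_sum v (rv_words f k \<alpha>) h * measure m (rv_interval f (n0 + k) \<alpha>))
    = (\<Sum>\<beta>\<in>UNIV. h \<beta> * measure m (rv_interval f n0 \<beta>))"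
proof (induction k)
  case (Suc k)
  define a b c where "a = last_top (rv_perm f k)" and "b = last_bot (rv_perm f k)"
    and "c = loser (rotation_number f k)"
  have per': "rotation_number f (n0 + k) = rotation_number f k" using per[of k] by (simp add: add.commute)
  then have perm: "rv_perm f (n0 + k) = rv_perm f k" by (simp add: rotation_number_def)
  let ?t = "\<lambda>\<alpha>. twisted_sum v (rv_words f k \<alpha>) h"
  let ?x = "\<lambda>\<alpha>. measure m (rv_interval f (n0 + k) \<alpha>)"
  let ?x' = "\<lambda>\<alpha>. measure m (rv_interval f (Suc (n0 + k)) \<alpha>)"
  \<comment> \<open>The mass step uses the Jacobian along the word of order \<open>n0 + k\<close>;
    by \<open>fixv\<close> it equals the one of order \<open>k\<close>, so every period repeats the
    same recursion.\<close>
  have word: "wsum v (rv_words f (n0 + k) b) = wsum v (rv_words f k b)"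
    unfolding words_add[of "rotation_number f", OF per] by (rule wsum_concat) (rule fixv)
  have x: "?x \<alpha> = of_bool (\<alpha> \<noteq> c) * ?x' \<alpha> + of_bool (\<alpha> = b) * ?x' c +
      of_bool (\<alpha> = a) * exp (wsum v (rv_words f k b)) * ?x' c" for \<alpha>
    using measure_rv_interval_step[OF m, of "n0 + k" \<alpha>] unfolding per' perm a_def b_def c_def
    using word by (simp add: b_def)
  have one: "(\<Sum>\<alpha>\<in>UNIV. of_bool (\<alpha> = \<beta>) * y \<alpha>) = (y \<beta> :: real)" for y and \<beta> :: 'a
    by (simp add: of_bool_def if_distrib if_distribR cong: if_cong)
  have "(\<Sum>\<alpha>\<in>UNIV. ?t \<alpha> * ?x \<alpha>) = (\<Sum>\<alpha>\<in>UNIV. of_bool (\<alpha> \<noteq> c) * (?t \<alpha> * ?x' \<alpha>)) +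
      (\<Sum>\<alpha>\<in>UNIV. of_bool (\<alpha> = b) * (?t \<alpha> * ?x' c)) +
      (\<Sum>\<alpha>\<in>UNIV. of_bool (\<alpha> = a) * (?t \<alpha> * (exp (wsum v (rv_words f k b)) * ?x' c)))"
    unfolding x by (simp add: sum.distrib algebra_simps)
  also have "\<dots> = (\<Sum>\<alpha>\<in>UNIV. of_bool (\<alpha> \<noteq> c) * (?t \<alpha> * ?x' \<alpha>)) +
      (\<Sum>\<alpha>\<in>UNIV. of_bool (\<alpha> = c) * ((?t b + exp (wsum v (rv_words f k b)) * ?t a) * ?x' c))"
    unfolding one by (simp add: algebra_simps)
  also have "\<dots> = (\<Sum>\<alpha>\<in>UNIV. twisted_sum v (rv_words f (Suc k) \<alpha>) h * ?x' \<alpha>)"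
    unfolding sum.distrib[symmetric]
    by (rule sum.cong)
      (auto simp: twisted_sum_append a_def b_def c_def rotation_number_def)
  finally show ?case using Suc by simp
qed simp

end

section \<open>Hausdorff dimension of Gibbs measures\<close>

lemma hausdorff_outer_eq_0_iff:
  "hausdorff_outer s E = 0 \<longleftrightarrow> (\<forall>\<delta>>0. hausdorff_content s \<delta> E = 0)"
  unfolding hausdorff_outer_def bot_ennreal[symmetric] SUP_bot_conv by auto

lemma hausdorff_content_le:
  assumes "E \<subseteq> (\<Union>i. U i)" "\<And>i. bounded (U i) \<and> diameter (U i) \<le> \<delta>"
  shows "hausdorff_content s \<delta> E \<le> (\<Sum>i. ennreal (diameter (U i) powr s))"
  unfolding hausdorff_content_def by (rule INF_lower) (use assms in auto)

lemma hausdorff_content_mono: "E \<subseteq> E' \<Longrightarrow> hausdorff_content s \<delta> E \<le> hausdorff_content s \<delta> E'"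
  unfolding hausdorff_content_def by (rule INF_superset_mono) auto

lemma hausdorff_content_le_finite:
  assumes "finite A" "E \<subseteq> (\<Union>i\<in>A. U i)" "\<And>i. i \<in> A \<Longrightarrow> bounded (U i) \<and> diameter (U i) \<le> \<delta>" "0 \<le> \<delta>"
  shows "hausdorff_content s \<delta> E \<le> ennreal (\<Sum>i\<in>A. diameter (U i) powr s)"
proof -
  obtain h where h: "bij_betw h {..<card A} A"
    using ex_bij_betw_nat_finite[OF assms(1)] by (auto simp: lessThan_atLeast0)
  \<comment> \<open>The finite cover is padded with empty sets, which contribute
    \<open>0 powr s = 0\<close>.\<close>
  define V where "V j = (if j < card A then U (h j) else {})" for j
  have hA: "h j \<in> A" if "j < card A" for j using h that by (auto simp: bij_betw_def)
  have "E \<subseteq> (\<Union>j. V j)"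
  proof
    fix x assume "x \<in> E"
    then obtain i where i: "i \<in> A" "x \<in> U i" using assms(2) by blast
    then obtain j where "j < card A" "h j = i" using h by (metis bij_betw_imp_surj_on imageE lessThan_iff)
    then show "x \<in> (\<Union>j. V j)" using i by (auto simp: V_def)
  qed
  moreover have "bounded (V j) \<and> diameter (V j) \<le> \<delta>" for j
    using assms(3)[OF hA[of j]] assms(4) by (auto simp: V_def)
  ultimately have "hausdorff_content s \<delta> E \<le> (\<Sum>j. ennreal (diameter (V j) powr s))"
    by (rule hausdorff_content_le)
  also have "\<dots> = (\<Sum>j<card A. ennreal (diameter (V j) powr s))"
    by (rule suminf_finite) (auto simp: V_def)
  also have "\<dots> = ennreal (\<Sum>j<card A. diameter (U (h j)) powr s)"
    by (simp add: V_def)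
  also have "(\<Sum>j<card A. diameter (U (h j)) powr s) = (\<Sum>i\<in>A. diameter (U i) powr s)"
    by (rule sum.reindex_bij_betw[OF h])
  finally show ?thesis .
qed

lemma hausdorff_outer_UN_eq_0:
  fixes E :: "nat \<Rightarrow> real set"
  assumes "\<And>n. hausdorff_outer s (E n) = 0"
  shows "hausdorff_outer s (\<Union>n. E n) = 0"
  unfolding hausdorff_outer_eq_0_iff
proof (intro allI impI)
  fix \<delta> :: real assume "0 < \<delta>"
  show "hausdorff_content s \<delta> (\<Union>n. E n) = 0"
  proof (rule ccontr)
    assume "hausdorff_content s \<delta> (\<Union>n. E n) \<noteq> 0"
    then have "0 < hausdorff_content s \<delta> (\<Union>n. E n)" by (simp add: zero_less_iff_neq_zero)
    then obtain e where e: "0 < e" "ennreal e < hausdorff_content s \<delta> (\<Union>n. E n)"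
    proof (cases "hausdorff_content s \<delta> (\<Union>n. E n)")
      case (real r)
      then show ?thesis
        using that[of "r / 2"] \<open>0 < hausdorff_content s \<delta> (\<Union>n. E n)\<close> by (simp add: ennreal_less_iff)
    next
      case top
      then show ?thesis using that[of 1] by simp
    qed
    have "\<exists>U. E n \<subseteq> (\<Union>i. U i) \<and> (\<forall>i. bounded (U i) \<and> diameter (U i) \<le> \<delta>) \<and>
        (\<Sum>i. ennreal (diameter (U i) powr s)) < ennreal (e * (1 / 2) ^ Suc n)" for n
    proof -
      have "hausdorff_content s \<delta> (E n) < ennreal (e * (1 / 2) ^ Suc n)"
        using assms[of n] \<open>0 < \<delta>\<close> e(1) by (simp add: hausdorff_outer_eq_0_iff)
      then show ?thesis unfolding hausdorff_content_def INF_less_iff by auto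
    qed
    then obtain U where U: "\<And>n. E n \<subseteq> (\<Union>i. U n i)"
      "\<And>n i. bounded (U n i) \<and> diameter (U n i) \<le> \<delta>"
      "\<And>n. (\<Sum>i. ennreal (diameter (U n i) powr s)) < ennreal (e * (1 / 2) ^ Suc n)" by metis
    define V where "V j = (case prod_decode j of (n, i) \<Rightarrow> U n i)" for j
    have "(\<Union>n. E n) \<subseteq> (\<Union>j. V j)"
    proof
      fix x assume "x \<in> (\<Union>n. E n)"
      then obtain n i where "x \<in> U n i" using U(1) by blast
      then have "x \<in> V (prod_encode (n, i))" by (simp add: V_def)
      then show "x \<in> (\<Union>j. V j)" by blast
    qed
    moreover have "bounded (V j) \<and> diameter (V j) \<le> \<delta>" for j
      using U(2) by (simp add: V_def split: prod.split)
    ultimately have "hausdorff_content s \<delta> (\<Union>n. E n) \<le> (\<Sum>j. ennreal (diameter (V j) powr s))"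
      by (rule hausdorff_content_le)
    also have "\<dots> = (\<integral>\<^sup>+j. (case prod_decode j of (n, i) \<Rightarrow> ennreal (diameter (U n i) powr s)) \<partial>count_space UNIV)"
      by (simp add: nn_integral_count_space_nat V_def split_beta)
    also have "\<dots> = (\<integral>\<^sup>+p. (case p of (n, i) \<Rightarrow> ennreal (diameter (U n i) powr s)) \<partial>count_space UNIV)"
      by (rule nn_integral_bij_count_space[OF bij_prod_decode])
    also have "\<dots> = (\<integral>\<^sup>+n. \<integral>\<^sup>+i. ennreal (diameter (U n i) powr s) \<partial>count_space UNIV \<partial>count_space UNIV)"
      by (subst nn_integral_fst_count_space[symmetric]) simp
    also have "\<dots> = (\<Sum>n. \<Sum>i. ennreal (diameter (U n i) powr s))"
      by (simp add: nn_integral_count_space_nat)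
    also have "\<dots> \<le> (\<Sum>n. ennreal (e * (1 / 2) ^ Suc n))"
      by (rule suminf_le) (use U(3) in \<open>auto intro: less_imp_le\<close>)
    also have "\<dots> = ennreal e"
      using sums_mult[OF power_half_series, of e] e(1)
      by (subst suminf_ennreal_eq) auto
    finally show False using e(2) by simp
  qed
qed

text \<open>Places 2 in the set whose infimum is \<open>hausdorff_dim E\<close>, so that this set is
  never empty. A unit interval splits into \<open>k\<close> pieces of length \<open>1 / k\<close>,
  with total weight \<open>1 / k\<close>.\<close>

lemma hausdorff_outer_2_eq_0: "hausdorff_outer 2 E = 0"
proof -
  have null: "hausdorff_outer 2 {real_of_int z..<real_of_int z + 1} = 0" for z
    unfolding hausdorff_outer_eq_0_iff
  proof (intro allI impI)
    fix \<delta> :: real assume \<delta>: "0 < \<delta>"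
    let ?E = "{real_of_int z..<real_of_int z + 1}"
    have "hausdorff_content 2 \<delta> ?E \<le> ennreal e" if e: "0 < e" for e
    proof -
      obtain k where k: "1 / min \<delta> e < real k" using reals_Archimedean2 by blast
      have mpos: "0 < min \<delta> e" using \<delta> e by simp
      then have k0: "0 < real k" using k by (meson divide_pos_pos less_trans zero_less_one)
      have "1 < real k * min \<delta> e" using k mpos by (simp only: pos_divide_less_eq)
      then have "1 / real k < min \<delta> e" using k0 by (simp only: pos_divide_less_eq mult.commute)
      then have kk: "1 / real k \<le> \<delta>" "1 / real k \<le> e" by auto
      define U where "U i = {real_of_int z + real i / real k..real_of_int z + (real i + 1) / real k}" for i
      have diam: "diameter (U i) = 1 / real k" for i
      proof -
        have "real i / real k \<le> (real i + 1) / real k" by (rule divide_right_mono) (use k0 in auto)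
        then show ?thesis using k0 by (simp add: U_def diff_divide_distrib[symmetric])
      qed
      have "?E \<subseteq> (\<Union>i\<in>{..<k}. U i)"
      proof
        fix x assume x: "x \<in> ?E"
        define i where "i = nat \<lfloor>(x - z) * real k\<rfloor>"
        have nn: "0 \<le> (x - z) * real k" using x by simp
        have "real i \<le> (x - z) * real k" "(x - z) * real k < real i + 1"
          using nn unfolding i_def by (simp_all add: of_nat_nat)
        then have "x \<in> U i" using k0 by (auto simp: U_def field_simps)
        moreover have "(x - z) * real k < real k" using x k0 by simp
        then have "real i < real k" using \<open>real i \<le> (x - z) * real k\<close> by linarith
        ultimately show "x \<in> (\<Union>i\<in>{..<k}. U i)" by auto
      qed
      then have "hausdorff_content 2 \<delta> ?E \<le> ennreal (\<Sum>i\<in>{..<k}. diameter (U i) powr 2)"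
        by (rule hausdorff_content_le_finite[rotated]) (use diam kk \<delta> in \<open>auto simp: U_def\<close>)
      also have "(\<Sum>i\<in>{..<k}. diameter (U i) powr 2) = 1 / real k"
        using k0 by (simp add: diam powr_numeral power2_eq_square)
      also have "ennreal (1 / real k) \<le> ennreal e" using kk by (intro ennreal_leI)
      finally show ?thesis .
    qed
    then show "hausdorff_content 2 \<delta> ?E = 0"
      by (metis ennreal_0 ennreal_le_epsilon add.left_neutral le_zero_eq zero_le)
  qed
  define G where "G n = {real_of_int (int_decode n)..<real_of_int (int_decode n) + 1}" for n
  have "(\<Union>n. G n) = UNIV"
  proof (intro equalityI subsetI)
    fix x :: real
    have "x \<in> G (int_encode \<lfloor>x\<rfloor>)" by (simp add: G_def)
    then show "x \<in> (\<Union>n. G n)" by blast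
  qed simp
  moreover have "hausdorff_outer 2 (\<Union>n. G n) = 0"
    by (rule hausdorff_outer_UN_eq_0) (simp add: G_def null)
  ultimately show ?thesis
    using hausdorff_content_mono[of E UNIV 2]
    by (metis hausdorff_outer_eq_0_iff le_zero_eq subset_UNIV)
qed

lemma hausdorff_dim_ge:
  assumes "\<And>s. 0 < s \<Longrightarrow> hausdorff_outer s E = 0 \<Longrightarrow> D \<le> s"
  shows "D \<le> hausdorff_dim E"
  unfolding hausdorff_dim_def
  by (rule cInf_greatest) (use assms hausdorff_outer_2_eq_0 in \<open>auto intro!: exI[of _ 2]\<close>)

lemma hausdorff_dim_nonneg: "0 \<le> hausdorff_dim E"
  by (rule hausdorff_dim_ge) simp

lemma hausdorff_dim_le: "0 < s \<Longrightarrow> hausdorff_outer s E = 0 \<Longrightarrow> hausdorff_dim E \<le> s"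
  unfolding hausdorff_dim_def by (rule cInf_lower) (auto intro!: bdd_belowI[of _ 0])

lemma dim_H_le: "E \<in> sets borel \<Longrightarrow> emeasure \<mu> E = 1 \<Longrightarrow> dim_H \<mu> \<le> hausdorff_dim E"
  unfolding dim_H_def
  by (rule cInf_lower) (auto intro!: bdd_belowI[of _ 0] hausdorff_dim_nonneg)

lemma dim_H_ge:
  assumes "E\<^sub>0 \<in> sets borel" "emeasure \<mu> E\<^sub>0 = 1"
    and "\<And>E. E \<in> sets borel \<Longrightarrow> emeasure \<mu> E = 1 \<Longrightarrow> D \<le> hausdorff_dim E"
  shows "D \<le> dim_H \<mu>"
  unfolding dim_H_def by (rule cInf_greatest) (use assms in auto)

text \<open>Turns a bound valid at all large orders into an inequality between exponential
  rates.\<close>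

lemma exp_rate_nonneg:
  assumes "0 < c" "\<And>n. n \<ge> n0 \<Longrightarrow> c \<le> C * exp (real n * a)"
  shows "0 \<le> (a :: real)"
proof (rule ccontr)
  assume "\<not> 0 \<le> a"
  then have "exp a < 1" by simp
  then have "(\<lambda>n. C * exp a ^ n) \<longlonglongrightarrow> C * 0"
    by (intro tendsto_intros LIMSEQ_power_zero) simp
  then have "c \<le> C * 0"
    by (rule tendsto_lowerbound)
      (use assms(2) in \<open>auto simp: exp_of_nat_mult eventually_sequentially intro!: exI[of _ n0]\<close>)
  then show False using assms(1) by simp
qed

text \<open>Removes the deviation \<epsilon> from an inequality between rates.\<close>

lemma nonneg_if_slack:
  assumes "\<And>\<epsilon>. 0 < \<epsilon> \<Longrightarrow> 0 \<le> a + b * (\<epsilon> :: real)" "0 \<le> b"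
  shows "0 \<le> a"
proof (rule ccontr)
  assume a: "\<not> 0 \<le> a"
  show False
  proof (cases "b = 0")
    case True
    then show ?thesis using assms(1)[of 1] a by simp
  next
    case False
    then have "0 < - a / (2 * b)" using a assms(2) by (intro divide_pos_pos) auto
    then have "0 \<le> a + b * (- a / (2 * b))" by (rule assms(1))
    also have "b * (- a / (2 * b)) = - a / 2" using False by simp
    finally show ?thesis using a by simp
  qed
qed

text \<open>The cylinders of order \<open>n\<close> are intervals partitioning \<open>[0, 1)\<close>, with a Birkhoff sum \<open>S\<close> on each
  of them. Up to constants, lengths are Gibbs weights for the parameter \<open>t\<close> and the masses of \<open>m\<close>
  are Gibbs weights for the parameter \<open>s\<close>; \<open>\<rho>\<close> is the pressure and \<open>d\<close> its derivative at \<open>s\<close>.\<close>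

locale gibbs_cylinders = prob_space m
  for m :: "real measure" +
  fixes I :: "nat \<Rightarrow> 'i set" and Q :: "nat \<Rightarrow> 'i \<Rightarrow> real set" and S :: "nat \<Rightarrow> 'i \<Rightarrow> real"
    and s t d k K :: real and \<rho> :: "real \<Rightarrow> real"
  assumes sets_m: "sets m = sets borel"
    and finite_I: "finite (I n)"
    and Q_Ico: "i \<in> I n \<Longrightarrow> \<exists>l r. l < r \<and> Q n i = {l..<r}"
    and Q_disjoint: "i \<in> I n \<Longrightarrow> j \<in> I n \<Longrightarrow> x \<in> Q n i \<Longrightarrow> x \<in> Q n j \<Longrightarrow> i = j"
    and Q_cover: "(\<Union>i\<in>I n. Q n i) = {0..<1}"
    and mass_one: "measure m {0..<1} = 1"
    and k_pos: "0 < k"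
    and length_ge: "i \<in> I n \<Longrightarrow> k * exp (t * S n i - n * \<rho> t) \<le> measure lborel (Q n i)"
    and length_le: "i \<in> I n \<Longrightarrow> measure lborel (Q n i) \<le> K * exp (t * S n i - n * \<rho> t)"
    and mass_ge: "i \<in> I n \<Longrightarrow> k * exp (s * S n i - n * \<rho> s) \<le> measure m (Q n i)"
    and mass_le: "i \<in> I n \<Longrightarrow> measure m (Q n i) \<le> K * exp (s * S n i - n * \<rho> s)"
    and pressure: "\<exists>C. \<forall>n. (\<Sum>i\<in>I n. exp (u * S n i)) \<le> C * exp (n * \<rho> u)"
    and deriv_pressure: "(\<rho> has_real_derivative d) (at s)"
begin

text \<open>Entropy and Lyapunov exponent of the renormalization: the exponential rates at which the
  mass and the length of a typical cylinder decay.\<close>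

definition ent where "ent = \<rho> s - s * d"
definition lyap where "lyap = \<rho> t - t * d"

lemma Q_borel: "i \<in> I n \<Longrightarrow> Q n i \<in> sets borel"
  using Q_Ico[of i n] by auto

lemma Q_sub: "i \<in> I n \<Longrightarrow> Q n i \<subseteq> {0..<1}"
  using Q_cover[of n] by blast

lemma K_pos: "0 < K"
proof -
  have "(\<Union>i\<in>I 0. Q 0 i) \<noteq> {}" unfolding Q_cover by simp
  then obtain i where i: "i \<in> I 0" by blast
  let ?e = "exp (s * S 0 i - real 0 * \<rho> s)"
  have "0 < k * ?e" using k_pos by simp
  also have "\<dots> \<le> K * ?e" by (rule order_trans[OF mass_ge[OF i] mass_le[OF i]])
  finally show ?thesis by (simp only: zero_less_mult_iff) simp
qed

lemma measure_UN_Q: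
  assumes "A \<subseteq> I n"
  shows "measure m (\<Union>i\<in>A. Q n i) = (\<Sum>i\<in>A. measure m (Q n i))"
    and "measure lborel (\<Union>i\<in>A. Q n i) = (\<Sum>i\<in>A. measure lborel (Q n i))"
proof -
  have A: "finite A" using assms finite_I finite_subset by blast
  have disj: "disjoint_family_on (Q n) A"
    unfolding disjoint_family_on_def using Q_disjoint assms by blast
  show "measure m (\<Union>i\<in>A. Q n i) = (\<Sum>i\<in>A. measure m (Q n i))"
    by (rule finite_measure_finite_Union) (use A disj assms Q_borel sets_m in auto)
  show "measure lborel (\<Union>i\<in>A. Q n i) = (\<Sum>i\<in>A. measure lborel (Q n i))"
  proof (rule measure_finite_Union)
    fix i assume "i \<in> A"
    then obtain l r where "l < r" "Q n i = {l..<r}" using Q_Ico[of i n] assms by blast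
    then show "emeasure lborel (Q n i) \<noteq> \<infinity>" by simp
  qed (use A disj assms Q_borel in auto)
qed

text \<open>Chernoff's bound, where the tilted sums are controlled by the pressure near \<open>s\<close>.\<close>

lemma large_deviation:
  assumes "0 < \<epsilon>" and \<sigma>: "\<sigma> = 1 \<or> \<sigma> = - 1"
  shows "\<exists>C q. 0 \<le> C \<and> 0 \<le> q \<and> q < 1 \<and>
    (\<forall>n. (\<Sum>i | i \<in> I n \<and> \<sigma> * (S n i - n * d) > n * \<epsilon>. measure m (Q n i)) \<le> C * q ^ n)"
proof -
  have "((\<lambda>x. (\<rho> (s + x) - \<rho> s) / x) \<longlongrightarrow> d) (at 0)"
    using deriv_pressure by (simp add: DERIV_def)
  from LIM_D[OF this, of "\<epsilon> / 2"] assms(1) obtain r where r: "0 < r"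
    "\<And>x. x \<noteq> 0 \<Longrightarrow> \<bar>x\<bar> < r \<Longrightarrow> \<bar>(\<rho> (s + x) - \<rho> s) / x - d\<bar> < \<epsilon> / 2"
    by auto
  \<comment> \<open>The size of the tilt: at distance \<open>u\<close> from \<open>s\<close> the
    increment of the pressure differs from its linear part by at most half of the gain
    \<open>u * \<epsilon>\<close> in Chernoff's bound; the other half is the rate in
    \<open>q\<close>.\<close>
  define u where "u = r / 2"
  define x where "x = \<sigma> * u"
  have u: "0 < u" "\<bar>x\<bar> = u" "x \<noteq> 0" using r(1) \<sigma> by (auto simp: u_def x_def)
  have "\<bar>(\<rho> (s + x) - \<rho> s) / x - d\<bar> < \<epsilon> / 2" using r u by (simp add: u_def)
  then have "\<bar>x\<bar> * \<bar>(\<rho> (s + x) - \<rho> s) / x - d\<bar> \<le> u * (\<epsilon> / 2)"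
    unfolding u(2) using u(1) by (intro mult_left_mono) auto
  moreover have "\<bar>x\<bar> * \<bar>(\<rho> (s + x) - \<rho> s) / x - d\<bar> = \<bar>\<rho> (s + x) - \<rho> s - x * d\<bar>"
  proof -
    have "x * ((\<rho> (s + x) - \<rho> s) / x - d) = \<rho> (s + x) - \<rho> s - x * d"
      unfolding right_diff_distrib using u(3) by simp
    then show ?thesis by (simp only: abs_mult[symmetric])
  qed
  ultimately have incr: "\<rho> (s + x) - \<rho> s - x * d \<le> u * (\<epsilon> / 2)" by (metis abs_le_D1)
  obtain C where C: "\<And>n. (\<Sum>i\<in>I n. exp ((s + x) * S n i)) \<le> C * exp (n * \<rho> (s + x))"
    using pressure by blast
  have C0: "0 \<le> C"
  proof -
    have "0 \<le> (\<Sum>i\<in>I 0. exp ((s + x) * S 0 i))" by (rule sum_nonneg) simp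
    then show ?thesis using C[of 0] by simp
  qed
  define q where "q = exp (- u * \<epsilon> / 2)"
  have "(\<Sum>i | i \<in> I n \<and> \<sigma> * (S n i - n * d) > n * \<epsilon>. measure m (Q n i)) \<le> (K * C) * q ^ n" for n
  proof -
    let ?B = "{i. i \<in> I n \<and> \<sigma> * (S n i - n * d) > n * \<epsilon>}"
    let ?c = "- n * \<rho> s - x * n * d - u * n * \<epsilon>"
    have "(\<Sum>i\<in>?B. measure m (Q n i)) \<le> (\<Sum>i\<in>?B. K * exp ?c * exp ((s + x) * S n i))"
    proof (rule sum_mono)
      fix i assume i: "i \<in> ?B"
      then have "0 \<le> u * (\<sigma> * (S n i - n * d) - n * \<epsilon>)" using u by simp
      then have "s * S n i - n * \<rho> s \<le> ?c + (s + x) * S n i"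
        by (simp add: x_def algebra_simps)
      then have "K * exp (s * S n i - n * \<rho> s) \<le> K * exp (?c + (s + x) * S n i)"
        using K_pos by simp
      then show "measure m (Q n i) \<le> K * exp ?c * exp ((s + x) * S n i)"
        using mass_le[of i n] i by (simp add: exp_add mult.assoc)
    qed
    also have "\<dots> \<le> (\<Sum>i\<in>I n. K * exp ?c * exp ((s + x) * S n i))"
      by (rule sum_mono2) (use finite_I K_pos in \<open>auto simp: less_imp_le\<close>)
    also have "\<dots> \<le> K * exp ?c * (C * exp (n * \<rho> (s + x)))"
      unfolding sum_distrib_left[symmetric] by (rule mult_left_mono[OF C]) (use K_pos in simp)
    also have "\<dots> = K * C * exp (n * (\<rho> (s + x) - \<rho> s - x * d - u * \<epsilon>))"
      by (simp add: exp_add[symmetric] mult_ac) (simp add: algebra_simps)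
    also have "\<dots> \<le> K * C * exp (n * (- u * \<epsilon> / 2))"
    proof -
      have "real n * (\<rho> (s + x) - \<rho> s - x * d - u * \<epsilon>) \<le> real n * (- u * \<epsilon> / 2)"
        using incr by (intro mult_left_mono) simp_all
      then show ?thesis using K_pos C0 by (intro mult_left_mono) simp_all
    qed
    also have "\<dots> = K * C * q ^ n" by (simp only: q_def exp_of_nat_mult)
    finally show ?thesis .
  qed
  moreover have "q < 1" "0 \<le> q" using u assms(1) by (auto simp: q_def)
  ultimately show ?thesis using C0 K_pos by (intro exI[of _ "K * C"] exI[of _ q]) auto
qed


definition good where "good \<epsilon> n = {i \<in> I n. \<bar>S n i - n * d\<bar> \<le> n * \<epsilon>}"
definition G where "G \<epsilon> n = (\<Union>i\<in>good \<epsilon> n. Q n i)"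
text \<open>Control at all orders from \<open>n0\<close> on simultaneously, so that one set of large
  mass serves every small scale.\<close>

definition F where "F \<epsilon> n0 = (\<Inter>n\<in>{n0..}. G \<epsilon> n)"

lemma good_sub: "good \<epsilon> n \<subseteq> I n" by (auto simp: good_def)

lemma finite_good: "finite (good \<epsilon> n)" using good_sub finite_I finite_subset by blast

lemma G_borel: "G \<epsilon> n \<in> sets borel"
  unfolding G_def by (rule sets.finite_UN) (use finite_good good_sub Q_borel in blast)+

lemma F_borel: "F \<epsilon> n0 \<in> sets borel"
  unfolding F_def by (rule sets.countable_INT') (use G_borel in auto)

lemma F_sub: "n0 \<le> n \<Longrightarrow> F \<epsilon> n0 \<subseteq> G \<epsilon> n" unfolding F_def by auto

lemma F_sub_unit: "F \<epsilon> n0 \<subseteq> {0..<1}"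
  using F_sub[of n0 n0 \<epsilon>] good_sub[of \<epsilon> n0] Q_sub unfolding G_def by blast

lemma UN_Q_sets: "A \<subseteq> I n \<Longrightarrow> (\<Union>i\<in>A. Q n i) \<in> sets m"
  using finite_subset[OF _ finite_I] Q_borel sets_m by (intro sets.finite_UN) blast+

lemma bad_mass:
  assumes "0 < \<epsilon>"
  shows "\<exists>C q. 0 \<le> C \<and> 0 \<le> q \<and> q < 1 \<and> (\<forall>n. measure m ({0..<1} - G \<epsilon> n) \<le> C * q ^ n)"
proof -
  obtain C1 q1 C2 q2 where 1: "0 \<le> C1" "0 \<le> q1" "q1 < 1"
      "\<And>n. (\<Sum>i | i \<in> I n \<and> 1 * (S n i - n * d) > n * \<epsilon>. measure m (Q n i)) \<le> C1 * q1 ^ n"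
    and 2: "0 \<le> C2" "0 \<le> q2" "q2 < 1"
      "\<And>n. (\<Sum>i | i \<in> I n \<and> - 1 * (S n i - n * d) > n * \<epsilon>. measure m (Q n i)) \<le> C2 * q2 ^ n"
    using large_deviation[OF assms, of 1] large_deviation[OF assms, of "- 1"] by blast
  define q where "q = max q1 q2"
  have "measure m ({0..<1} - G \<epsilon> n) \<le> (C1 + C2) * q ^ n" for n
  proof -
    let ?B1 = "{i. i \<in> I n \<and> 1 * (S n i - n * d) > n * \<epsilon>}"
    let ?B2 = "{i. i \<in> I n \<and> - 1 * (S n i - n * d) > n * \<epsilon>}"
    have "{0..<1} - G \<epsilon> n \<subseteq> (\<Union>i\<in>?B1 \<union> ?B2. Q n i)"
    proof
      fix x assume x: "x \<in> {0..<1} - G \<epsilon> n"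
      then obtain i where i: "i \<in> I n" "x \<in> Q n i" using Q_cover[of n] by blast
      then have "i \<notin> good \<epsilon> n" using x by (auto simp: G_def)
      then have "i \<in> ?B1 \<union> ?B2" using i(1) by (auto simp: good_def abs_le_iff not_le)
      then show "x \<in> (\<Union>i\<in>?B1 \<union> ?B2. Q n i)" using i(2) by blast
    qed
    then have "measure m ({0..<1} - G \<epsilon> n) \<le> measure m (\<Union>i\<in>?B1 \<union> ?B2. Q n i)"
      by (rule finite_measure_mono) (rule UN_Q_sets, auto)
    also have "\<dots> = (\<Sum>i\<in>?B1 \<union> ?B2. measure m (Q n i))"
      by (rule measure_UN_Q(1)) auto
    also have "\<dots> \<le> (\<Sum>i\<in>?B1. measure m (Q n i)) + (\<Sum>i\<in>?B2. measure m (Q n i))"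
      using finite_I by (subst sum_Un) (auto intro!: sum_nonneg)
    also have "\<dots> \<le> C1 * q1 ^ n + C2 * q2 ^ n" using 1(4) 2(4) by (intro add_mono)
    also have "\<dots> \<le> C1 * q ^ n + C2 * q ^ n"
      using 1 2 by (intro add_mono mult_left_mono power_mono) (auto simp: q_def)
    finally show ?thesis by (simp add: distrib_right)
  qed
  moreover have "0 \<le> C1 + C2" "0 \<le> q" "q < 1" using 1 2 by (auto simp: q_def)
  ultimately show ?thesis by blast
qed

text \<open>Borel--Cantelli: the complement is covered by the bad sets of orders at least
  \<open>n0\<close>, whose masses sum to a geometric tail.\<close>

lemma F_mass_lim:
  assumes "0 < \<epsilon>"
  shows "(\<lambda>n0. measure m (F \<epsilon> n0)) \<longlonglongrightarrow> 1"
proof -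
  obtain C q where C: "0 \<le> C" "0 \<le> q" "q < 1" "\<And>n. measure m ({0..<1} - G \<epsilon> n) \<le> C * q ^ n"
    using bad_mass[OF assms] by blast
  have lower: "1 - C * q ^ n0 / (1 - q) \<le> measure m (F \<epsilon> n0)" for n0
  proof -
    let ?B = "\<lambda>j. {0..<1} - G \<epsilon> (n0 + j)"
    have sums: "(\<lambda>j. C * q ^ n0 * q ^ j) sums (C * q ^ n0 * (1 / (1 - q)))"
      using C by (intro sums_mult geometric_sums) auto
    have le: "measure m (?B j) \<le> C * q ^ n0 * q ^ j" for j
      using C(4)[of "n0 + j"] by (simp add: power_add mult.assoc)
    have summ: "summable (\<lambda>j. measure m (?B j))"
      by (rule summable_comparison_test'[OF sums_summable[OF sums]]) (use le in auto)
    have "{0..<1} - F \<epsilon> n0 \<subseteq> (\<Union>j. ?B j)"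
    proof
      fix x assume "x \<in> {0..<1} - F \<epsilon> n0"
      then obtain n where "n0 \<le> n" "x \<notin> G \<epsilon> n" "x \<in> {0..<1}" unfolding F_def by auto
      then have "x \<in> ?B (n - n0)" by simp
      then show "x \<in> (\<Union>j. ?B j)" by blast
    qed
    then have "measure m ({0..<1} - F \<epsilon> n0) \<le> measure m (\<Union>j. ?B j)"
      using G_borel by (intro finite_measure_mono) (auto simp: sets_m)
    also have "\<dots> \<le> (\<Sum>j. measure m (?B j))"
      using G_borel summ by (intro finite_measure_subadditive_countably) (auto simp: sets_m)
    also have "\<dots> \<le> C * q ^ n0 * (1 / (1 - q))"
      using suminf_le[OF le summ sums_summable[OF sums]] sums_unique[OF sums] by simp
    finally have "measure m ({0..<1} - F \<epsilon> n0) \<le> C * q ^ n0 / (1 - q)" by simp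
    moreover have "measure m ({0..<1} - F \<epsilon> n0) = 1 - measure m (F \<epsilon> n0)"
      using finite_measure_Diff[of "{0..<1}" "F \<epsilon> n0"] F_borel F_sub_unit mass_one by (simp add: sets_m)
    ultimately show ?thesis by simp
  qed
  have lim: "(\<lambda>n0. 1 - C * q ^ n0 / (1 - q)) \<longlonglongrightarrow> 1 - C * 0 / (1 - q)"
    using C by (intro tendsto_intros LIMSEQ_power_zero) auto
  show ?thesis
  proof (rule tendsto_sandwich[where h = "\<lambda>_. 1"])
    show "\<forall>\<^sub>F n0 in sequentially. 1 - C * q ^ n0 / (1 - q) \<le> measure m (F \<epsilon> n0)"
      using lower by (intro always_eventually allI)
    show "\<forall>\<^sub>F n0 in sequentially. measure m (F \<epsilon> n0) \<le> 1"
      by (intro always_eventually allI) simp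
    show "(\<lambda>n0. 1 - C * q ^ n0 / (1 - q)) \<longlonglongrightarrow> 1" using lim by simp
  qed simp
qed

lemma ex_F_mass: "0 < \<epsilon> \<Longrightarrow> \<exists>n0. 1 / 2 \<le> measure m (F \<epsilon> n0)"
  using order_tendstoD(1)[OF F_mass_lim, of \<epsilon> "1 / 2"]
  by (auto simp: eventually_sequentially intro: less_imp_le)


lemma le_mult_exp:
  assumes "a * exp (- real n * z) \<le> (b :: real)"
  shows "a \<le> b * exp (real n * z)"
proof -
  have "a * exp (- real n * z) * exp (real n * z) \<le> b * exp (real n * z)"
    using assms by (rule mult_right_mono) simp
  then show ?thesis by (simp add: mult.assoc exp_add[symmetric])
qed

text \<open>In the Gibbs exponent \<open>r * S - n * \<rho> r\<close>, replacing \<open>S\<close> by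
  \<open>n * d\<close> costs at most \<open>n * \<bar>r\<bar> * \<epsilon>\<close>;
  \<open>r = s\<close> gives the masses and \<open>r = t\<close> the lengths.\<close>

lemma good_bounds:
  assumes "i \<in> good \<epsilon> n"
  shows "k * exp (- real n * (ent + \<bar>s\<bar> * \<epsilon>)) \<le> measure m (Q n i)"
    and "measure m (Q n i) \<le> K * exp (- real n * (ent - \<bar>s\<bar> * \<epsilon>))"
    and "k * exp (- real n * (lyap + \<bar>t\<bar> * \<epsilon>)) \<le> measure lborel (Q n i)"
    and "measure lborel (Q n i) \<le> K * exp (- real n * (lyap - \<bar>t\<bar> * \<epsilon>))"
proof -
  have i: "i \<in> I n" and dev: "\<bar>S n i - n * d\<bar> \<le> n * \<epsilon>" using assms by (auto simp: good_def)
  have *: "\<bar>r * S n i - r * (n * d)\<bar> \<le> n * (\<bar>r\<bar> * \<epsilon>)" for r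
  proof -
    have "\<bar>r\<bar> * \<bar>S n i - n * d\<bar> \<le> \<bar>r\<bar> * (n * \<epsilon>)" using dev by (rule mult_left_mono) simp
    then show ?thesis by (simp add: abs_mult[symmetric] right_diff_distrib mult_ac)
  qed
  have up: "r * S n i - n * \<rho> r \<le> - real n * (\<rho> r - r * d - \<bar>r\<bar> * \<epsilon>)"
    and lo: "- real n * (\<rho> r - r * d + \<bar>r\<bar> * \<epsilon>) \<le> r * S n i - n * \<rho> r" for r
    using *[of r] by (auto simp: algebra_simps abs_le_iff)
  show "k * exp (- real n * (ent + \<bar>s\<bar> * \<epsilon>)) \<le> measure m (Q n i)"
    by (rule order_trans[OF _ mass_ge[OF i]]) (use lo[of s] k_pos in \<open>simp add: ent_def\<close>)
  show "measure m (Q n i) \<le> K * exp (- real n * (ent - \<bar>s\<bar> * \<epsilon>))"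
    by (rule order_trans[OF mass_le[OF i]]) (use up[of s] K_pos in \<open>simp add: ent_def\<close>)
  show "k * exp (- real n * (lyap + \<bar>t\<bar> * \<epsilon>)) \<le> measure lborel (Q n i)"
    by (rule order_trans[OF _ length_ge[OF i]]) (use lo[of t] k_pos in \<open>simp add: lyap_def\<close>)
  show "measure lborel (Q n i) \<le> K * exp (- real n * (lyap - \<bar>t\<bar> * \<epsilon>))"
    by (rule order_trans[OF length_le[OF i]]) (use up[of t] K_pos in \<open>simp add: lyap_def\<close>)
qed

text \<open>No cylinder has mass above 1, whereas a typical one has mass about
  \<open>exp (- n * ent)\<close>.\<close>

lemma ent_nonneg: "0 \<le> ent"
proof (rule nonneg_if_slack[of ent "\<bar>s\<bar>"])
  fix \<epsilon> :: real assume \<epsilon>: "0 < \<epsilon>"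
  obtain n0 where n0: "1 / 2 \<le> measure m (F \<epsilon> n0)" using ex_F_mass[OF \<epsilon>] by blast
  show "0 \<le> ent + \<bar>s\<bar> * \<epsilon>"
  proof (rule exp_rate_nonneg[OF k_pos, of n0 1])
    fix n assume "n0 \<le> n"
    then have "G \<epsilon> n \<noteq> {}" using F_sub[of n0 n \<epsilon>] n0 by auto
    then obtain i where "i \<in> good \<epsilon> n" unfolding G_def by blast
    then have "k * exp (- real n * (ent + \<bar>s\<bar> * \<epsilon>)) \<le> 1"
      using good_bounds(1) prob_le_1 order_trans by blast
    then show "k \<le> 1 * exp (real n * (ent + \<bar>s\<bar> * \<epsilon>))"
      by (rule le_mult_exp)
  qed
qed simp

text \<open>Count the typical cylinders of order \<open>n\<close>: carrying at least half of the
  mass requires about \<open>exp (n * ent)\<close> of them, while total length 1 leaves room for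
  about \<open>exp (n * lyap)\<close>.\<close>

lemma ent_le_lyap: "ent \<le> lyap"
proof -
  have "0 \<le> lyap - ent"
  proof (rule nonneg_if_slack[of "lyap - ent" "\<bar>t\<bar> + \<bar>s\<bar>"])
    fix \<epsilon> :: real assume \<epsilon>: "0 < \<epsilon>"
    obtain n0 where n0: "1 / 2 \<le> measure m (F \<epsilon> n0)" using ex_F_mass[OF \<epsilon>] by blast
    show "0 \<le> lyap - ent + (\<bar>t\<bar> + \<bar>s\<bar>) * \<epsilon>"
    proof (rule exp_rate_nonneg[of "1 / 2" n0 "K / k"])
      fix n assume n: "n0 \<le> n"
      let ?N = "real (card (good \<epsilon> n))"
      let ?x = "lyap + \<bar>t\<bar> * \<epsilon>" and ?y = "ent - \<bar>s\<bar> * \<epsilon>"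
      have "1 / 2 \<le> measure m (G \<epsilon> n)"
        using n0 finite_measure_mono[OF F_sub[OF n, of \<epsilon>]] G_borel sets_m by force
      also have "\<dots> = (\<Sum>i\<in>good \<epsilon> n. measure m (Q n i))"
        unfolding G_def by (rule measure_UN_Q(1)[OF good_sub])
      also have "\<dots> \<le> ?N * (K * exp (- real n * ?y))"
        by (rule sum_bounded_above) (rule good_bounds)
      finally have mass: "1 / 2 \<le> ?N * (K * exp (- real n * ?y))" .
      have "?N * (k * exp (- real n * ?x)) \<le> (\<Sum>i\<in>good \<epsilon> n. measure lborel (Q n i))"
        by (rule sum_bounded_below) (rule good_bounds)
      also have "\<dots> = measure lborel (G \<epsilon> n)"
        unfolding G_def by (rule measure_UN_Q(2)[OF good_sub, symmetric])
      also have "\<dots> \<le> measure lborel {0..<1 :: real}"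
        by (rule measure_mono_fmeasurable)
          (use good_sub[of \<epsilon> n] Q_sub G_borel in \<open>auto simp: G_def fmeasurable_def\<close>)
      finally have "?N * k * exp (- real n * ?x) \<le> 1" by simp
      then have "?N * k \<le> 1 * exp (real n * ?x)" by (rule le_mult_exp)
      then have N: "?N \<le> exp (real n * ?x) / k"
        using k_pos by (simp only: pos_le_divide_eq mult_1)
      have "1 / 2 \<le> exp (real n * ?x) / k * (K * exp (- real n * ?y))"
        by (rule order_trans[OF mass mult_right_mono[OF N]]) (use K_pos in simp)
      also have "\<dots> = K / k * (exp (real n * ?x) * exp (- real n * ?y))" by simp
      also have "exp (real n * ?x) * exp (- real n * ?y) = exp (real n * (lyap - ent + (\<bar>t\<bar> + \<bar>s\<bar>) * \<epsilon>))"
        unfolding exp_add[symmetric] by (simp add: algebra_simps)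
      finally show "1 / 2 \<le> K / k * exp (real n * (lyap - ent + (\<bar>t\<bar> + \<bar>s\<bar>) * \<epsilon>))" .
    qed simp
  qed simp
  then show ?thesis by simp
qed

section \<open>Upper bound for the dimension by covers with typical cylinders\<close>

lemma diameter_Q: "i \<in> I n \<Longrightarrow> diameter (Q n i) = measure lborel (Q n i)"
proof -
  assume "i \<in> I n"
  then obtain l r where lr: "l < r" "Q n i = {l..<r}" using Q_Ico[of i n] by blast
  have "diameter {l..<r} = r - l"
    using diameter_closure[of "{l..<r}"] lr by (simp add: closure_atLeastLessThan)
  then show ?thesis using lr by simp
qed

lemma bounded_Q: "i \<in> I n \<Longrightarrow> bounded (Q n i)"
  by (rule bounded_subset[of "{0..1}"]) (use Q_sub[of i n] in force)+

text \<open>The good cylinders of order \<open>n\<close> cover \<open>F\<close>. There are at most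
  about \<open>exp (n * ent)\<close> of them, with diameters about \<open>exp (- n * lyap)\<close>,
  so beyond the quotient of the rates their weights tend to 0.\<close>

lemma hausdorff_content_F_eq_0:
  assumes \<epsilon>: "0 < \<epsilon>" and \<sigma>: "0 < \<sigma>" and rate: "ent + \<bar>s\<bar> * \<epsilon> < \<sigma> * (lyap - \<bar>t\<bar> * \<epsilon>)"
    and \<delta>: "0 < \<delta>"
  shows "hausdorff_content \<sigma> \<delta> (F \<epsilon> n0) = 0"
proof -
  let ?x = "lyap - \<bar>t\<bar> * \<epsilon>" and ?y = "ent + \<bar>s\<bar> * \<epsilon>"
  have "0 \<le> ?y" using ent_nonneg \<epsilon> by simp
  then have x: "0 < ?x" using rate \<sigma> by (meson le_less_trans zero_less_mult_pos)
  have "(\<lambda>n. K * exp (- ?x) ^ n) \<longlonglongrightarrow> K * 0"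
    using x by (intro tendsto_intros LIMSEQ_power_zero) simp
  then have "\<forall>\<^sub>F n in sequentially. K * exp (- ?x) ^ n < \<delta>"
    by (rule order_tendstoD(2)) (use \<delta> in simp)
  then obtain n1 where n1: "\<And>n. n1 \<le> n \<Longrightarrow> K * exp (- ?x) ^ n < \<delta>"
    unfolding eventually_sequentially by blast
  have bound: "hausdorff_content \<sigma> \<delta> (F \<epsilon> n0) \<le> ennreal (K powr \<sigma> / k * exp (?y - \<sigma> * ?x) ^ n)"
    if n: "max n0 n1 \<le> n" for n
  proof -
    have len: "diameter (Q n i) \<le> K * exp (- real n * ?x)" if "i \<in> good \<epsilon> n" for i
      using good_bounds(4)[OF that] diameter_Q[OF subsetD[OF good_sub that]] by simp
    have pow: "exp (- real n * ?x) = exp (- ?x) ^ n" by (simp only: exp_of_nat_mult[symmetric]) (simp add: algebra_simps)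
    have "real (card (good \<epsilon> n)) * (k * exp (- real n * ?y)) \<le> (\<Sum>i\<in>good \<epsilon> n. measure m (Q n i))"
      by (rule sum_bounded_below) (rule good_bounds)
    also have "\<dots> = measure m (G \<epsilon> n)"
      unfolding G_def by (rule measure_UN_Q(1)[OF good_sub, symmetric])
    also have "\<dots> \<le> 1" by simp
    finally have "real (card (good \<epsilon> n)) * k * exp (- real n * ?y) \<le> 1" by simp
    then have "real (card (good \<epsilon> n)) * k \<le> 1 * exp (real n * ?y)" by (rule le_mult_exp)
    then have card: "real (card (good \<epsilon> n)) \<le> exp (real n * ?y) / k"
      using k_pos by (simp only: pos_le_divide_eq mult_1)
    have "hausdorff_content \<sigma> \<delta> (F \<epsilon> n0) \<le> ennreal (\<Sum>i\<in>good \<epsilon> n. diameter (Q n i) powr \<sigma>)"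
    proof (rule hausdorff_content_le_finite[OF finite_good])
      show "F \<epsilon> n0 \<subseteq> (\<Union>i\<in>good \<epsilon> n. Q n i)" using F_sub[of n0 n \<epsilon>] n by (simp add: G_def)
      fix i assume i: "i \<in> good \<epsilon> n"
      then have "bounded (Q n i)" using bounded_Q good_sub by blast
      moreover have "diameter (Q n i) \<le> \<delta>" using len[OF i] n1[of n] n unfolding pow by simp
      ultimately show "bounded (Q n i) \<and> diameter (Q n i) \<le> \<delta>" by blast
    qed (use \<delta> in simp)
    also have "\<dots> \<le> ennreal (K powr \<sigma> / k * exp (?y - \<sigma> * ?x) ^ n)"
    proof (rule ennreal_leI)
      have "(\<Sum>i\<in>good \<epsilon> n. diameter (Q n i) powr \<sigma>) \<le> real (card (good \<epsilon> n)) * (K * exp (- real n * ?x)) powr \<sigma>"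
        by (rule sum_bounded_above, rule powr_mono2)
          (use \<sigma> len diameter_ge_0[OF bounded_Q[OF subsetD[OF good_sub]]] in \<open>auto simp: less_imp_le\<close>)
      also have "\<dots> \<le> exp (real n * ?y) / k * (K * exp (- real n * ?x)) powr \<sigma>"
        by (rule mult_right_mono[OF card]) simp
      also have "\<dots> = K powr \<sigma> / k * (exp (real n * ?y) * exp (\<sigma> * (- real n * ?x)))"
        using K_pos by (simp add: powr_mult exp_powr_real mult.commute)
      also have "exp (real n * ?y) * exp (\<sigma> * (- real n * ?x)) = exp (?y - \<sigma> * ?x) ^ n"
        unfolding exp_add[symmetric] exp_of_nat_mult[symmetric] by (simp add: algebra_simps)
      finally show "(\<Sum>i\<in>good \<epsilon> n. diameter (Q n i) powr \<sigma>) \<le> K powr \<sigma> / k * exp (?y - \<sigma> * ?x) ^ n" .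
    qed
    finally show ?thesis .
  qed
  have "(\<lambda>n. K powr \<sigma> / k * exp (?y - \<sigma> * ?x) ^ n) \<longlonglongrightarrow> K powr \<sigma> / k * 0"
    using rate by (intro tendsto_intros LIMSEQ_power_zero) simp
  then have lim: "(\<lambda>n. ennreal (K powr \<sigma> / k * exp (?y - \<sigma> * ?x) ^ n)) \<longlonglongrightarrow> ennreal 0"
    by (intro tendsto_ennrealI) simp
  have "hausdorff_content \<sigma> \<delta> (F \<epsilon> n0) \<le> ennreal 0"
    by (rule tendsto_lowerbound[OF lim])
      (use bound in \<open>auto simp: eventually_sequentially intro!: exI[of _ "max n0 n1"]\<close>)
  then show ?thesis by simp
qed

lemma emeasure_UN_F:
  assumes "0 < \<epsilon>"
  shows "emeasure m (\<Union>n0. F \<epsilon> n0) = 1"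
proof -
  have sets: "(\<Union>n0. F \<epsilon> n0) \<in> sets m" unfolding sets_m using F_borel by blast
  have "measure m (F \<epsilon> n0) \<le> measure m (\<Union>n0. F \<epsilon> n0)" for n0
    by (rule finite_measure_mono) (use sets in auto)
  then have "1 \<le> measure m (\<Union>n0. F \<epsilon> n0)"
    by (intro tendsto_upperbound[OF F_mass_lim[OF assms]] always_eventually) auto
  then have "measure m (\<Union>n0. F \<epsilon> n0) = 1" using prob_le_1 by (intro antisym) auto
  then show ?thesis by (simp add: emeasure_eq_measure)
qed

lemma dim_H_upper:
  assumes "0 < lyap"
  shows "dim_H m \<le> ent / lyap"
proof (rule field_le_epsilon)
  fix e :: real assume e: "0 < e"
  define \<sigma> where "\<sigma> = ent / lyap + e"
  have \<sigma>: "0 < \<sigma>" using e assms ent_nonneg by (simp add: \<sigma>_def add_nonneg_pos)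
  \<comment> \<open>With \<open>\<epsilon> = e * lyap / (2 * D)\<close> the deviations in mass and
    length together use up at most half of the margin \<open>e * lyap\<close>; the summand 1 keeps
    \<open>D\<close> positive.\<close>
  define D where "D = \<bar>s\<bar> + \<sigma> * \<bar>t\<bar> + 1"
  define \<epsilon> where "\<epsilon> = e * lyap / (2 * D)"
  have den: "0 < D" using \<sigma> by (simp add: D_def add_nonneg_pos)
  have \<epsilon>: "0 < \<epsilon>" using e assms den by (simp add: \<epsilon>_def)
  have "\<epsilon> * (\<bar>s\<bar> + \<sigma> * \<bar>t\<bar>) \<le> \<epsilon> * D" using \<epsilon> by (simp add: D_def)
  also have "\<dots> = e * lyap / 2" using den by (simp add: \<epsilon>_def)
  also have "\<dots> < e * lyap" using e assms by simp
  also have "e * lyap = \<sigma> * lyap - ent" using assms by (simp add: \<sigma>_def distrib_right)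
  finally have rate: "ent + \<bar>s\<bar> * \<epsilon> < \<sigma> * (lyap - \<bar>t\<bar> * \<epsilon>)" by (simp add: algebra_simps)
  have "hausdorff_outer \<sigma> (F \<epsilon> n0) = 0" for n0
    unfolding hausdorff_outer_eq_0_iff using hausdorff_content_F_eq_0[OF \<epsilon> \<sigma> rate] by blast
  then have "hausdorff_outer \<sigma> (\<Union>n0. F \<epsilon> n0) = 0" by (rule hausdorff_outer_UN_eq_0)
  then have "hausdorff_dim (\<Union>n0. F \<epsilon> n0) \<le> \<sigma>" by (rule hausdorff_dim_le[OF \<sigma>])
  moreover have "dim_H m \<le> hausdorff_dim (\<Union>n0. F \<epsilon> n0)"
    by (rule dim_H_le[OF _ emeasure_UN_F[OF \<epsilon>]]) (use F_borel in blast)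
  ultimately show "dim_H m \<le> ent / lyap + e" by (simp add: \<sigma>_def)
qed

section \<open>Lower bound for the dimension by the mass distribution principle\<close>

lemma interval_mass_scale:
  assumes n: "n0 \<le> n" and pq: "p \<le> q" "q - p \<le> exp (- real n * (lyap + \<bar>t\<bar> * \<epsilon>))"
  shows "measure m ({p..q} \<inter> F \<epsilon> n0) \<le> (2 + 1 / k) * K * exp (- real n * (ent - \<bar>s\<bar> * \<epsilon>))"
proof -
  let ?x = "lyap + \<bar>t\<bar> * \<epsilon>" and ?y = "ent - \<bar>s\<bar> * \<epsilon>"
  define A where "A = {i \<in> good \<epsilon> n. Q n i \<inter> {p..q} \<noteq> {}}"
  \<comment> \<open>Cylinders meeting \<open>{p..q}\<close> without containing an endpoint lie
    inside it. Each has at least \<open>k\<close> times the length allowed for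
    \<open>{p..q}\<close>, so there are at most \<open>1 / k\<close> of them; at most two further
    ones contain an endpoint. This gives the constant \<open>2 + 1 / k\<close>.\<close>
  define A0 where "A0 = {i \<in> A. p \<notin> Q n i \<and> q \<notin> Q n i}"
  have A: "A \<subseteq> I n" "finite A" "A \<subseteq> good \<epsilon> n"
    using good_sub finite_good by (auto simp: A_def)
  have A0: "A0 \<subseteq> I n" "finite A0" "A0 \<subseteq> good \<epsilon> n" using A by (auto simp: A0_def)
  have "Q n i \<subseteq> {p..q}" if i: "i \<in> A0" for i
  proof -
    obtain l r where lr: "Q n i = {l..<r}" using Q_Ico[of i n] A0 i by blast
    have "Q n i \<inter> {p..q} \<noteq> {}" using i by (simp add: A0_def A_def)
    then obtain x where "x \<in> {l..<r}" "x \<in> {p..q}" unfolding lr by blast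
    moreover have "p \<notin> {l..<r}" "q \<notin> {l..<r}" using i lr by (auto simp: A0_def)
    ultimately show ?thesis unfolding lr by auto
  qed
  then have "(\<Union>i\<in>A0. Q n i) \<subseteq> {p..q}" by blast
  moreover have "(\<Union>i\<in>A0. Q n i) \<in> sets lborel" using UN_Q_sets[OF A0(1)] sets_m by simp
  ultimately have "measure lborel (\<Union>i\<in>A0. Q n i) \<le> measure lborel {p..q}"
    using pq(1) by (intro measure_mono_fmeasurable) (auto simp: fmeasurable_def)
  also have "\<dots> \<le> exp (- real n * ?x)" using pq by simp
  finally have "(\<Sum>i\<in>A0. measure lborel (Q n i)) \<le> exp (- real n * ?x)"
    using measure_UN_Q(2)[OF A0(1)] by simp
  moreover have "real (card A0) * (k * exp (- real n * ?x)) \<le> (\<Sum>i\<in>A0. measure lborel (Q n i))"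
    by (rule sum_bounded_below) (use good_bounds A0 in blast)
  ultimately have "real (card A0) * (k * exp (- real n * ?x)) \<le> exp (- real n * ?x)"
    by (rule order_trans[rotated])
  then have "real (card A0) * k * exp (- real n * ?x) \<le> 1 * exp (- real n * ?x)"
    by (simp only: mult.assoc mult_1)
  then have "real (card A0) * k \<le> 1" by (rule mult_right_le_imp_le) simp
  then have cardA0: "real (card A0) \<le> 1 / k" using k_pos by (simp add: pos_le_divide_eq)
  have one: "card {i \<in> I n. z \<in> Q n i} \<le> 1" for z
  proof -
    have "\<exists>j. {i \<in> I n. z \<in> Q n i} \<subseteq> {j}"
      using Q_disjoint by blast
    then show ?thesis using card_mono[of "{_}"] by (metis card.empty card_insert_disjoint empty_iff finite.intros One_nat_def)
  qed
  have "A \<subseteq> A0 \<union> ({i \<in> I n. p \<in> Q n i} \<union> {i \<in> I n. q \<in> Q n i})" using A(1) by (auto simp: A0_def)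
  then have "card A \<le> card (A0 \<union> ({i \<in> I n. p \<in> Q n i} \<union> {i \<in> I n. q \<in> Q n i}))"
    by (rule card_mono[rotated]) (use A0 finite_I in auto)
  also have "\<dots> \<le> card A0 + (card {i \<in> I n. p \<in> Q n i} + card {i \<in> I n. q \<in> Q n i})"
    by (meson card_Un_le add_left_mono order_trans)
  finally have "card A \<le> card A0 + 2" using one[of p] one[of q] by linarith
  then have "real (card A) \<le> real (card A0) + 2" by linarith
  then have cardA: "real (card A) \<le> 2 + 1 / k" using cardA0 by linarith
  have "{p..q} \<inter> F \<epsilon> n0 \<subseteq> (\<Union>i\<in>A. Q n i)"
    using F_sub[OF n, of \<epsilon>] unfolding G_def A_def by blast
  then have "measure m ({p..q} \<inter> F \<epsilon> n0) \<le> measure m (\<Union>i\<in>A. Q n i)"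
    by (rule finite_measure_mono) (rule UN_Q_sets[OF A(1)])
  also have "\<dots> = (\<Sum>i\<in>A. measure m (Q n i))" by (rule measure_UN_Q(1)[OF A(1)])
  also have "\<dots> \<le> real (card A) * (K * exp (- real n * ?y))"
    by (rule sum_bounded_above) (use good_bounds A in blast)
  also have "\<dots> \<le> (2 + 1 / k) * (K * exp (- real n * ?y))"
    by (rule mult_right_mono[OF cardA]) (use K_pos in simp)
  finally show ?thesis by (simp add: mult.assoc)
qed

text \<open>A Frostman estimate, obtained from \<open>interval_mass_scale\<close> at the order whose
  length scale matches \<open>q - p\<close>. The factor
  \<open>exp (ent - \<bar>s\<bar> * \<epsilon>)\<close> pays for rounding that order to an
  integer.\<close>

lemma interval_mass:
  assumes \<sigma>: "0 < \<sigma>" and x: "0 < lyap + \<bar>t\<bar> * \<epsilon>"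
    and rate: "\<sigma> * (lyap + \<bar>t\<bar> * \<epsilon>) \<le> ent - \<bar>s\<bar> * \<epsilon>"
    and pq: "p \<le> q" "q - p \<le> exp (- real n0 * (lyap + \<bar>t\<bar> * \<epsilon>))"
  shows "measure m ({p..q} \<inter> F \<epsilon> n0) \<le> (2 + 1 / k) * K * exp (ent - \<bar>s\<bar> * \<epsilon>) * (q - p) powr \<sigma>"
proof -
  define x where "x = lyap + \<bar>t\<bar> * \<epsilon>"
  define y where "y = ent - \<bar>s\<bar> * \<epsilon>"
  have x0: "0 < x" and sxy: "\<sigma> * x \<le> y" and y0: "0 < y"
    using x rate mult_pos_pos[OF \<sigma> x] by (auto simp: x_def y_def)
  have C0: "0 < (2 + 1 / k) * K" using k_pos K_pos by (simp add: add_pos_pos)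
  note scale = interval_mass_scale[of n0 _ p q \<epsilon>, folded x_def y_def]
  show ?thesis
  proof (cases "p = q")
    case True
    \<comment> \<open>The bound holds for a point at every order, so the point has mass 0, in
      accordance with \<open>0 powr \<sigma> = 0\<close>.\<close>
    have lim: "(\<lambda>n. (2 + 1 / k) * K * exp (- y) ^ n) \<longlonglongrightarrow> (2 + 1 / k) * K * 0"
      using y0 by (intro tendsto_intros LIMSEQ_power_zero) simp
    have le: "measure m ({p..q} \<inter> F \<epsilon> n0) \<le> (2 + 1 / k) * K * exp (- y) ^ n" if "n0 \<le> n" for n
    proof -
      have "exp (- real n * y) = exp (- y) ^ n" by (simp only: exp_of_nat_mult[symmetric]) (simp add: algebra_simps)
      then show ?thesis using scale[OF that] True by simp
    qed
    have "measure m ({p..q} \<inter> F \<epsilon> n0) \<le> (2 + 1 / k) * K * 0"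
      by (rule LIMSEQ_le_const[OF lim]) (use le in blast)
    then show ?thesis using True by simp
  next
    case False
    \<comment> \<open>The real-valued order at which the length scale \<open>exp (- w * x)\<close>
      is exactly \<open>q - p\<close>; \<open>n\<close> is its integer part.\<close>
    define w where "w = - ln (q - p) / x"
    have pq0: "0 < q - p" using pq False by simp
    have d: "q - p = exp (- w * x)" using pq0 x0 by (simp add: w_def)
    have "exp (- w * x) \<le> exp (- real n0 * x)" using pq(2) d by (simp add: x_def)
    then have w: "real n0 \<le> w" using x0 by simp
    define n where "n = nat \<lfloor>w\<rfloor>"
    have n: "real n \<le> w" "w \<le> real n + 1" using w unfolding n_def by linarith+
    have "n0 \<le> n" using w unfolding n_def by linarith
    then have "measure m ({p..q} \<inter> F \<epsilon> n0) \<le> (2 + 1 / k) * K * exp (- real n * y)"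
      by (rule scale) (use pq n x0 in \<open>auto simp: d\<close>)
    also have "\<dots> \<le> (2 + 1 / k) * K * (exp y * (q - p) powr \<sigma>)"
    proof (rule mult_left_mono)
      have "\<sigma> * w * x \<le> w * y" using mult_left_mono[OF sxy, of w] w by (simp add: mult_ac)
      also have "\<dots> \<le> (real n + 1) * y" using n y0 by simp
      finally have "- real n * y \<le> y + \<sigma> * (- w * x)" by (simp add: algebra_simps)
      then have "exp (- real n * y) \<le> exp (y + \<sigma> * (- w * x))" by simp
      also have "\<dots> = exp y * exp (\<sigma> * (- w * x))" by (rule exp_add)
      also have "exp (\<sigma> * (- w * x)) = (q - p) powr \<sigma>" by (simp add: d exp_powr_real mult.commute)
      finally show "exp (- real n * y) \<le> exp y * (q - p) powr \<sigma>" .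
    qed (use C0 in simp)
    finally show ?thesis by (simp add: y_def mult.assoc)
  qed
qed

text \<open>Each set of a fine cover of \<open>E\<close> carries, within \<open>F\<close>, mass at
  most \<open>C\<close> times its diameter to the power \<open>\<sigma>\<close>; a cover of small
  total weight could not carry the mass of \<open>F\<close>, almost all of which lies in
  \<open>E\<close>.\<close>

lemma hausdorff_outer_pos:
  assumes \<epsilon>: "0 < \<epsilon>" and \<sigma>: "0 < \<sigma>" and x: "0 < lyap + \<bar>t\<bar> * \<epsilon>"
    and rate: "\<sigma> * (lyap + \<bar>t\<bar> * \<epsilon>) \<le> ent - \<bar>s\<bar> * \<epsilon>"
    and E: "E \<in> sets borel" "emeasure m E = 1"
  shows "hausdorff_outer \<sigma> E \<noteq> 0"
proof
  assume "hausdorff_outer \<sigma> E = 0"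
  obtain n0 where n0: "1 / 2 \<le> measure m (F \<epsilon> n0)" using ex_F_mass[OF \<epsilon>] by blast
  define \<delta> where "\<delta> = exp (- real n0 * (lyap + \<bar>t\<bar> * \<epsilon>))"
  define C where "C = (2 + 1 / k) * K * exp (ent - \<bar>s\<bar> * \<epsilon>)"
  have C0: "0 < C" using k_pos K_pos by (simp add: C_def add_pos_pos)
  \<comment> \<open>With this margin the cover carries at most \<open>1 / 4\<close> of mass within
    \<open>F\<close>, against at least \<open>1 / 2\<close>.\<close>
  have "hausdorff_content \<sigma> \<delta> E < ennreal (1 / (4 * C))"
    using \<open>hausdorff_outer \<sigma> E = 0\<close> C0 by (simp add: hausdorff_outer_eq_0_iff \<delta>_def)
  then obtain U where U: "E \<subseteq> (\<Union>i. U i)" "\<And>i. bounded (U i) \<and> diameter (U i) \<le> \<delta>"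
    "(\<Sum>i. ennreal (diameter (U i) powr \<sigma>)) < ennreal (1 / (4 * C))"
    unfolding hausdorff_content_def INF_less_iff by auto
  \<comment> \<open>The Frostman estimate is about closed intervals, so the arbitrary sets of the
    cover are replaced by the closed intervals they span, of no larger diameter.\<close>
  define V where "V i = (if U i = {} then {} else {Inf (U i)..Sup (U i)})" for i
  have UV: "U i \<subseteq> V i" for i
    using U(2)[of i] by (auto simp: V_def bounded_imp_bdd_above bounded_imp_bdd_below cInf_lower cSup_upper)
  have V: "V i \<in> sets m" for i by (simp add: V_def sets_m)
  have mass: "emeasure m (V i \<inter> F \<epsilon> n0) \<le> ennreal C * ennreal (diameter (U i) powr \<sigma>)" for i
  proof (cases "U i = {}")
    case False
    have bdd: "bdd_above (U i)" "bdd_below (U i)" "bounded (U i)"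
      using U(2)[of i] by (auto simp: bounded_imp_bdd_above bounded_imp_bdd_below)
    have le: "Inf (U i) \<le> Sup (U i)" using False bdd by (intro cInf_le_cSup)
    have "Sup (U i) \<le> Inf (U i) + diameter (U i)"
    proof (rule cSup_least[OF False])
      fix a assume a: "a \<in> U i"
      have "a - diameter (U i) \<le> Inf (U i)"
      proof (rule cInf_greatest[OF False])
        fix b assume "b \<in> U i"
        then have "dist a b \<le> diameter (U i)" using a bdd(3) by (intro diameter_bounded_bound)
        then show "a - diameter (U i) \<le> b" by (simp add: dist_real_def)
      qed
      then show "a \<le> Inf (U i) + diameter (U i)" by simp
    qed
    then have diam: "Sup (U i) - Inf (U i) \<le> diameter (U i)" by simp
    have "measure m ({Inf (U i)..Sup (U i)} \<inter> F \<epsilon> n0) \<le> C * (Sup (U i) - Inf (U i)) powr \<sigma>"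
      unfolding C_def
      by (rule interval_mass[OF \<sigma> x rate le]) (use diam U(2)[of i] in \<open>simp add: \<delta>_def\<close>)
    also have "\<dots> \<le> C * diameter (U i) powr \<sigma>"
      using C0 diam le \<sigma> by (intro mult_left_mono powr_mono2) auto
    finally show ?thesis
      using False C0 by (simp add: V_def emeasure_eq_measure ennreal_mult[symmetric])
  qed (simp add: V_def)
  have sets: "F \<epsilon> n0 \<in> sets m" "E \<in> sets m" using F_borel E by (simp_all add: sets_m)
  have "emeasure m (F \<epsilon> n0) = emeasure m (F \<epsilon> n0 \<inter> E)"
  proof (rule emeasure_eq_AE)
    have "AE z in m. z \<in> E" using E sets by (simp add: AE_in_set_eq_1 emeasure_eq_measure)
    then show "AE z in m. z \<in> F \<epsilon> n0 \<longleftrightarrow> z \<in> F \<epsilon> n0 \<inter> E" by eventually_elim simp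
  qed (use sets in auto)
  also have "\<dots> \<le> emeasure m (\<Union>i. V i \<inter> F \<epsilon> n0)"
  proof (rule emeasure_mono)
    show "F \<epsilon> n0 \<inter> E \<subseteq> (\<Union>i. V i \<inter> F \<epsilon> n0)" using U(1) UV by blast
    show "(\<Union>i. V i \<inter> F \<epsilon> n0) \<in> sets m" using V sets by auto
  qed
  also have "\<dots> \<le> (\<Sum>i. emeasure m (V i \<inter> F \<epsilon> n0))"
    by (rule emeasure_subadditive_countably) (use V sets in auto)
  also have "\<dots> \<le> (\<Sum>i. ennreal C * ennreal (diameter (U i) powr \<sigma>))"
    by (rule suminf_le) (use mass in auto)
  also have "\<dots> = ennreal C * (\<Sum>i. ennreal (diameter (U i) powr \<sigma>))" by simp
  also have "\<dots> \<le> ennreal C * ennreal (1 / (4 * C))" using U(3) by (intro mult_left_mono) auto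
  also have "\<dots> = ennreal (1 / 4)" using C0 by (simp add: ennreal_mult[symmetric])
  finally have "measure m (F \<epsilon> n0) \<le> 1 / 4" by (simp add: emeasure_eq_measure)
  then show False using n0 by simp
qed

lemma dim_H_lower:
  assumes "0 < lyap"
  shows "ent / lyap \<le> dim_H m"
proof (rule dim_H_ge[of "{0..<1}"])
  fix E assume E: "E \<in> sets borel" "emeasure m E = 1"
  show "ent / lyap \<le> hausdorff_dim E"
  proof (rule hausdorff_dim_ge, rule ccontr)
    fix \<sigma> :: real assume \<sigma>: "0 < \<sigma>" "hausdorff_outer \<sigma> E = 0" "\<not> ent / lyap \<le> \<sigma>"
    define e where "e = ent - \<sigma> * lyap"
    have e: "0 < e" using \<sigma>(3) assms by (simp add: e_def field_simps)
    define \<epsilon> where "\<epsilon> = e / (\<bar>s\<bar> + \<sigma> * \<bar>t\<bar> + 1)"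
    have den: "0 < \<bar>s\<bar> + \<sigma> * \<bar>t\<bar> + 1" using \<sigma> by (simp add: add_nonneg_pos)
    have \<epsilon>: "0 < \<epsilon>" using e den by (simp add: \<epsilon>_def)
    have "\<epsilon> * (\<bar>s\<bar> + \<sigma> * \<bar>t\<bar>) \<le> \<epsilon> * (\<bar>s\<bar> + \<sigma> * \<bar>t\<bar> + 1)" using \<epsilon> by simp
    also have "\<dots> = e" using den by (simp add: \<epsilon>_def)
    finally have "\<sigma> * (lyap + \<bar>t\<bar> * \<epsilon>) \<le> ent - \<bar>s\<bar> * \<epsilon>" by (simp add: e_def algebra_simps)
    then show False
      using hausdorff_outer_pos[OF \<epsilon> \<sigma>(1) _ _ E] \<sigma>(2) assms \<epsilon> by (simp add: add_pos_nonneg)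
  qed
qed (simp_all add: emeasure_eq_measure mass_one)

lemma dim_H_eq: "0 < lyap \<Longrightarrow> dim_H m = ent / lyap"
  using dim_H_upper dim_H_lower by (intro antisym)

end

section \<open>Self-similar interval exchanges\<close>

lemma measure_lborel_affine_image:
  assumes "affine_on s g J" "A \<subseteq> J" "A \<in> sets borel"
  shows "measure lborel (g ` A) = s * measure lborel A"
proof -
  obtain c where s: "0 < s" and c: "\<forall>y\<in>A. g y = c + s * y"
    using assms unfolding affine_on_def by blast
  have img: "g ` A = (\<lambda>y. s *\<^sub>R y + c) ` A" by (rule image_cong) (use c in auto)
  have "measure lborel (g ` A) = measure lebesgue (g ` A)"
    using affine_on_borel_image[OF assms] by simp
  also have "\<dots> = s * measure lebesgue A"
    unfolding img using measure_lebesgue_affine[of s c A] s by simp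
  also have "\<dots> = s * measure lborel A" using assms(3) by simp
  finally show ?thesis .
qed

text \<open>Turns lengths into masses of a probability measure, so that they obey the same
  renormalization as invariant and conformal measures.\<close>

definition unit_lebesgue :: "real measure" where
  "unit_lebesgue = density lborel (indicator {0..<1})"

lemma measure_unit_lebesgue:
  assumes "A \<in> sets borel" "A \<subseteq> {0..<1}"
  shows "measure unit_lebesgue A = measure lborel A"
proof -
  have "emeasure unit_lebesgue A = (\<integral>\<^sup>+x. indicator {0..<1} x * indicator A x \<partial>lborel)"
    unfolding unit_lebesgue_def by (rule emeasure_density) (use assms in auto)
  also have "\<dots> = (\<integral>\<^sup>+x. indicator A x \<partial>lborel)"
    by (rule nn_integral_cong) (use assms in \<open>auto simp: indicator_def\<close>)
  also have "\<dots> = emeasure lborel A" using assms by simp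
  finally show ?thesis by (simp add: measure_def)
qed

lemma prob_space_unit_lebesgue: "prob_space unit_lebesgue"
  by (rule prob_spaceI) (simp add: unit_lebesgue_def emeasure_density)

lemma conformal_on_unit_lebesgue:
  assumes f: "is_aiet f" "aiet_domain f = {0..<1}"
  shows "conformal_on f (logslope f) unit_lebesgue"
  unfolding conformal_on_def
proof (intro conjI allI impI prob_space_unit_lebesgue)
  show "sets unit_lebesgue = sets borel" by (simp add: unit_lebesgue_def)
  show "measure unit_lebesgue (aiet_domain f) = 1" by (simp add: f measure_unit_lebesgue)
  fix \<beta> A assume A: "A \<in> sets borel" "A \<subseteq> aiet_interval f \<beta>"
  have dom: "A \<subseteq> {0..<1}" using A UN_aiet_interval[OF f(1)] f(2) by blast
  then have dom': "aiet_map f ` A \<subseteq> {0..<1}" using aiet_map_domain[OF f(1)] f(2) by blast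
  have aff: "affine_on (exp (logslope f $ \<beta>)) (aiet_map f) (aiet_interval f \<beta>)"
    using aiet_map_affine_on[OF f(1)] .
  show "measure unit_lebesgue (aiet_map f ` A) = exp (logslope f $ \<beta>) * measure unit_lebesgue A"
    using measure_lborel_affine_image[OF aff A(2,1)] affine_on_borel_image[OF aff A(2,1)] dom dom' A
    by (simp add: measure_unit_lebesgue)
qed

lemma borel_aiet_image:
  assumes f: "is_aiet f" and A: "A \<in> sets borel"
  shows "aiet_map f ` A \<in> sets borel"
proof -
  have "aiet_map f ` A = (\<Union>\<beta>. aiet_map f ` (A \<inter> aiet_interval f \<beta>)) \<union> (A - aiet_domain f)"
  proof -
    have "A = (\<Union>\<beta>. A \<inter> aiet_interval f \<beta>) \<union> (A - aiet_domain f)"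
      using UN_aiet_interval[OF f] by blast
    moreover have "aiet_map f ` (A - aiet_domain f) = A - aiet_domain f"
      by (auto simp: aiet_map_def image_iff)
    ultimately show ?thesis by (metis image_UN image_Un)
  qed
  moreover have "aiet_map f ` (A \<inter> aiet_interval f \<beta>) \<in> sets borel" for \<beta>
    by (rule affine_on_borel_image[OF aiet_map_affine_on[OF f]])
      (use A in \<open>auto simp: aiet_interval_def\<close>)
  moreover have "A - aiet_domain f \<in> sets borel" using A by (simp add: aiet_domain_def)
  ultimately show ?thesis by auto
qed

text \<open>Evaluating \<open>distr\<close> presupposes measurability of the map, which is checked
  branch by branch; bijectivity then lets invariance be read on images instead of preimages.\<close>

lemma invariant_prob_conformal_on:
  assumes f: "is_aiet f" and \<mu>: "invariant_prob f \<mu>"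
  shows "conformal_on f 0 \<mu>"
proof -
  have sets: "sets \<mu> = sets borel" and prob: "prob_space \<mu>" and one: "emeasure \<mu> (aiet_domain f) = 1"
    and inv: "distr \<mu> borel (aiet_map f) = \<mu>"
    using \<mu> by (auto simp: invariant_prob_def borel_prob_on_def)
  have bij: "bij (aiet_map f)" using bij_aiet_map[OF f] .
  have space: "space \<mu> = UNIV" using sets_eq_imp_space_eq[OF sets] by simp
  have meas: "aiet_map f \<in> measurable \<mu> borel"
  proof (rule measurableI)
    fix A :: "real set" assume A: "A \<in> sets borel"
    let ?h = "\<lambda>\<beta> x. bot_end f \<beta> + exp (logslope f $ \<beta>) * (x - top_end f \<beta>)"
    let ?P = "\<lambda>\<beta>. {x \<in> aiet_interval f \<beta>. ?h \<beta> x \<in> A}"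
    have "aiet_map f -` A = (\<Union>\<beta>. ?P \<beta>) \<union> (A - aiet_domain f)"
    proof (intro equalityI subsetI)
      fix x assume x: "x \<in> aiet_map f -` A"
      show "x \<in> (\<Union>\<beta>. ?P \<beta>) \<union> (A - aiet_domain f)"
      proof (cases "x \<in> aiet_domain f")
        case True
        then obtain \<beta> where "x \<in> aiet_interval f \<beta>" using UN_aiet_interval[OF f] by blast
        then show ?thesis using x aiet_map_on_interval[OF f] by auto
      next
        case False
        then show ?thesis using x by (simp add: aiet_map_def)
      qed
    next
      fix x assume "x \<in> (\<Union>\<beta>. ?P \<beta>) \<union> (A - aiet_domain f)"
      then show "x \<in> aiet_map f -` A"
      proof
        assume "x \<in> A - aiet_domain f"
        then show ?thesis by (simp add: aiet_map_def)
      qed (use aiet_map_on_interval[OF f] in auto)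
    qed
    moreover have "?P \<beta> \<in> sets borel" for \<beta>
    proof -
      have "(\<lambda>x. ?h \<beta> x) -` A \<inter> space borel \<in> sets borel"
        by (rule measurable_sets[OF _ A]) simp
      then have "aiet_interval f \<beta> \<inter> ((\<lambda>x. ?h \<beta> x) -` A) \<in> sets borel"
        by (auto simp: aiet_interval_def)
      then show ?thesis by (simp add: Int_def)
    qed
    ultimately show "aiet_map f -` A \<inter> space \<mu> \<in> sets \<mu>"
      using A unfolding sets space by (auto simp: aiet_domain_def)
  qed simp
  have "measure \<mu> (aiet_map f ` A) = measure \<mu> A" if A: "A \<in> sets borel" for A
  proof -
    have "emeasure \<mu> (aiet_map f ` A) = emeasure (distr \<mu> borel (aiet_map f)) (aiet_map f ` A)"
      using inv by simp
    also have "\<dots> = emeasure \<mu> (aiet_map f -` (aiet_map f ` A) \<inter> space \<mu>)"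
      by (rule emeasure_distr[OF meas borel_aiet_image[OF f A]])
    also have "aiet_map f -` (aiet_map f ` A) \<inter> space \<mu> = A"
      using bij space by (simp add: inj_vimage_image_eq bij_is_inj)
    finally show ?thesis by (simp add: measure_def)
  qed
  then show ?thesis
    using sets prob one by (simp add: conformal_on_def measure_def)
qed

text \<open>Preimages under the inverse map are images under the map, so the density of the
  pushforward is a Jacobian; on one exchanged interval \<open>phi\<close> is constant.\<close>

lemma conformal_prob_conformal_on:
  assumes T: "renormalizable_aiet T" and \<nu>: "conformal_prob T (phi T v) \<nu>"
  shows "conformal_on T v \<nu>"
proof -
  interpret T: renormalizable_aiet T by (rule T)
  have f: "is_aiet T" by (rule T.is_aiet)
  have sets: "sets \<nu> = sets borel" and prob: "prob_space \<nu>" and one: "emeasure \<nu> (aiet_domain T) = 1"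
    and conf: "distr \<nu> borel (inv (aiet_map T)) = density \<nu> (\<lambda>x. ennreal (exp (phi T v x)))"
    using \<nu> by (auto simp: conformal_prob_def borel_prob_on_def)
  interpret prob_space \<nu> by (rule prob)
  have bij: "bij (aiet_map T)" using bij_aiet_map[OF f] .
  have space: "space \<nu> = UNIV" using sets_eq_imp_space_eq[OF sets] by simp
  have vim: "inv (aiet_map T) -` A = aiet_map T ` A" for A
    using bij by (metis bij_vimage_eq_inv_image bij_imp_bij_inv inv_inv_eq)
  have meas: "inv (aiet_map T) \<in> measurable \<nu> borel"
    by (rule measurableI) (use borel_aiet_image[OF f] in \<open>auto simp: vim sets space\<close>)
  have phi: "phi T v \<in> borel_measurable \<nu>"
    unfolding phi_def[abs_def] measurable_cong_sets[OF sets refl]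
    by (intro borel_measurable_sum borel_measurable_times borel_measurable_indicator)
      (auto simp: aiet_interval_def)
  have "measure \<nu> (aiet_map T ` A) = exp (v $ \<beta>) * measure \<nu> A"
    if A: "A \<in> sets borel" "A \<subseteq> aiet_interval T \<beta>" for A \<beta>
  proof -
    have "emeasure \<nu> (aiet_map T ` A) = emeasure (distr \<nu> borel (inv (aiet_map T))) A"
      by (subst emeasure_distr[OF meas A(1)]) (simp add: vim space)
    also have "\<dots> = (\<integral>\<^sup>+x. ennreal (exp (phi T v x)) * indicator A x \<partial>\<nu>)"
      unfolding conf using A phi by (intro emeasure_density) (auto simp: sets)
    also have "\<dots> = (\<integral>\<^sup>+x. ennreal (exp (v $ \<beta>)) * indicator A x \<partial>\<nu>)"
      using A(2) T.phi_on_interval[of _ \<beta> v] by (intro nn_integral_cong) (auto simp: indicator_def)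
    also have "\<dots> = ennreal (exp (v $ \<beta>)) * emeasure \<nu> A"
      using A by (simp add: nn_integral_cmult_indicator sets)
    finally have "emeasure \<nu> (aiet_map T ` A) = ennreal (exp (v $ \<beta>)) * emeasure \<nu> A" .
    then have "ennreal (measure \<nu> (aiet_map T ` A)) = ennreal (exp (v $ \<beta>) * measure \<nu> A)"
      by (simp add: emeasure_eq_measure ennreal_mult)
    then show ?thesis by (subst (asm) ennreal_inj) auto
  qed
  then show ?thesis
    using sets prob one by (simp add: conformal_on_def measure_def)
qed

section \<open>Renormalization matrices, pressure and its derivative\<close>

lemma twisted_matrix_mult:
  assumes "renormalizable_aiet f"
  shows "(\<Sum>\<beta>\<in>UNIV. twisted_matrix f n v $ \<alpha> $ \<beta> * h \<beta>) = twisted_sum v (rv_words f n \<alpha>) h"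
proof -
  interpret renormalizable_aiet f by (rule assms)
  let ?w = "rv_words f n \<alpha>"
  have "(\<Sum>\<beta>\<in>UNIV. twisted_matrix f n v $ \<alpha> $ \<beta> * h \<beta>) =
      (\<Sum>\<beta>\<in>UNIV. \<Sum>k<length ?w. exp (wsum v (take k ?w)) * (of_bool (?w ! k = \<beta>) * h \<beta>))"
    unfolding twisted_matrix_eq sum_distrib_right by (simp add: mult.assoc)
  also have "\<dots> = (\<Sum>k<length ?w. \<Sum>\<beta>\<in>UNIV. exp (wsum v (take k ?w)) * (of_bool (?w ! k = \<beta>) * h \<beta>))"
    by (rule sum.swap)
  also have "\<dots> = (\<Sum>k<length ?w. exp (wsum v (take k ?w)) * h (?w ! k))"
    unfolding sum_distrib_left[symmetric]
    by (rule sum.cong) (auto simp: of_bool_def if_distrib if_distribR cong: if_cong)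
  finally show ?thesis by (simp add: twisted_sum_conv_sum)
qed

locale self_similar_twist =
  fixes T :: "'a::finite aiet" and N :: nat and \<omega> :: "real ^ 'a"
  assumes two_letters: "2 \<le> CARD('a)"
    and iet: "is_iet T" and domain: "aiet_domain T = {0..<1}"
    and infinite: "infinitely_renormalizable T" and period: "is_period T N"
    and positive: "0 < ss_matrix T N $ \<alpha> $ \<beta>"
    and fixed: "ss_matrix T N *v \<omega> = \<omega>"
begin

sublocale T: renormalizable_aiet T
  using iet_renormalizable[OF iet infinite] .

abbreviation W :: "nat \<Rightarrow> 'a \<Rightarrow> 'a list" where
  "W \<equiv> rv_words T"

definition M :: "real \<Rightarrow> real ^ 'a ^ 'a" where
  "M t = twisted_matrix T N (t *\<^sub>R \<omega>)"

definition \<rho> :: "real \<Rightarrow> real" where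
  "\<rho> t = ln (pf_eigenvalue (M t))"

lemma rotation_number_period: "rotation_number T (n + j * N) = rotation_number T n"
proof (induction j)
  case (Suc j)
  have "n + Suc j * N = (n + j * N) + N" by simp
  then show ?case using Suc period unfolding is_period_def by metis
qed simp

text \<open>That \<open>M\<close> fixes \<omega> means that the word of one period has the Birkhoff
  sum of its letter; substitution carries this over to any number of periods.\<close>

lemma wsum_period: "wsum (t *\<^sub>R \<omega>) (W (j * N) \<alpha>) = (t *\<^sub>R \<omega>) $ \<alpha>"
proof (induction j arbitrary: \<alpha>)
  case (Suc j)
  have one: "wsum (t *\<^sub>R \<omega>) (W N \<beta>) = (t *\<^sub>R \<omega>) $ \<beta>" for \<beta>
    using T.ss_matrix_mult[of N \<omega> \<beta>] fixed by (simp add: wsum_scaleR)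
  have "W (Suc j * N) \<alpha> = concat (map (W N) (W (j * N) \<alpha>))"
    using words_add[of "rotation_number T" N "j * N"] period by (simp add: is_period_def)
  then show ?case using Suc wsum_concat[of "t *\<^sub>R \<omega>" "W N", OF one] by simp
qed simp

lemma M_eq: "M t $ \<alpha> $ \<beta> = (\<Sum>k<length (W N \<alpha>). exp (t * wsum \<omega> (take k (W N \<alpha>))) * of_bool (W N \<alpha> ! k = \<beta>))"
  by (simp add: M_def T.twisted_matrix_eq wsum_scaleR)

lemma M_mult: "(\<Sum>\<beta>\<in>UNIV. M t $ \<alpha> $ \<beta> * h \<beta>) = twisted_sum (t *\<^sub>R \<omega>) (W N \<alpha>) h"
  unfolding M_def by (rule twisted_matrix_mult[OF T.renormalizable_aiet_axioms])

lemma M_0: "M 0 = ss_matrix T N"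
  by (simp add: vec_eq_iff M_eq T.ss_matrix_eq of_bool_def sum.If_cases Int_def)

sublocale M: positive_matrix "M t" for t
proof
  fix \<alpha> \<beta>
  have "0 < card {k. k < length (W N \<alpha>) \<and> W N \<alpha> ! k = \<beta>}"
    using positive[of \<alpha> \<beta>] by (simp add: T.ss_matrix_eq)
  then have "{k. k < length (W N \<alpha>) \<and> W N \<alpha> ! k = \<beta>} \<noteq> {}" unfolding card_gt_0_iff by (rule conjunct1)
  then obtain k where "k < length (W N \<alpha>)" "W N \<alpha> ! k = \<beta>" by blast
  then show "0 < M t $ \<alpha> $ \<beta>"
    unfolding M_eq by (intro sum_pos2[of _ k]) auto
qed

lemma exp_\<rho>: "exp (\<rho> t) = pf_eigenvalue (M t)"
  by (simp add: \<rho>_def M.pf_eigenvalue_pos)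

text \<open>\<open>M 0\<close> counts visits, so its positive entries are at least 1, and with two
  letters the Perron eigenvalue exceeds 1.\<close>

lemma \<rho>_0_pos: "0 < \<rho> 0"
proof -
  have "1 \<le> M 0 $ \<alpha> $ \<beta>" for \<alpha> \<beta>
    using positive[of \<alpha> \<beta>] by (simp add: M_0 T.ss_matrix_eq)
  then show ?thesis unfolding \<rho>_def by (intro ln_gt_zero M.pf_eigenvalue_gt_1 two_letters)
qed

abbreviation \<l> :: "real \<Rightarrow> real ^ 'a" where "\<l> t \<equiv> pf_left (M t)"
abbreviation \<r> :: "real \<Rightarrow> real ^ 'a" where "\<r> t \<equiv> pf_right (M t)"

text \<open>The derivative of the logarithm of the eigenvalue given by
  \<open>has_derivative_pf_eigenvalue\<close>, spelled out over the floors of the towers so that it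
  matches the sums in \<open>G_quantity\<close> and \<open>H_quantity\<close> term by term.\<close>

definition \<rho>' :: "real \<Rightarrow> real" where
  "\<rho>' t = (\<Sum>\<alpha>\<in>UNIV. \<Sum>k<length (W N \<alpha>). \<l> t $ \<alpha> * exp (t * wsum \<omega> (take k (W N \<alpha>))) *
     wsum \<omega> (take k (W N \<alpha>)) * \<r> t $ (W N \<alpha> ! k)) * exp (- \<rho> t)"

lemma has_derivative_\<rho>: "(\<rho> has_real_derivative \<rho>' t) (at t)"
proof -
  define D where "D t \<alpha> \<beta> = (\<Sum>k<length (W N \<alpha>). exp (t * wsum \<omega> (take k (W N \<alpha>))) *
      wsum \<omega> (take k (W N \<alpha>)) * of_bool (W N \<alpha> ! k = \<beta>))" for t \<alpha> \<beta>
  have "((\<lambda>s. M s $ \<alpha> $ \<beta>) has_real_derivative D s \<alpha> \<beta>) (at s)" for s \<alpha> \<beta>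
    unfolding M_eq D_def by (auto intro!: derivative_eq_intros sum.cong)
  then have "((\<lambda>s. pf_eigenvalue (M s)) has_real_derivative
    (\<Sum>\<alpha>\<in>UNIV. \<Sum>\<beta>\<in>UNIV. \<l> t $ \<alpha> * D t \<alpha> \<beta> * \<r> t $ \<beta>)) (at t)"
    by (intro has_derivative_pf_eigenvalue M.positive_matrix_axioms)
  from DERIV_chain2[where g = "\<lambda>s. pf_eigenvalue (M s)", OF DERIV_ln_divide[OF M.pf_eigenvalue_pos] this]
  have deriv: "(\<rho> has_real_derivative 1 / pf_eigenvalue (M t) *
      (\<Sum>\<alpha>\<in>UNIV. \<Sum>\<beta>\<in>UNIV. \<l> t $ \<alpha> * D t \<alpha> \<beta> * \<r> t $ \<beta>)) (at t)"
    by (simp add: \<rho>_def[abs_def])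
  have "(\<Sum>\<beta>\<in>UNIV. \<l> t $ \<alpha> * D t \<alpha> \<beta> * \<r> t $ \<beta>) = (\<Sum>k<length (W N \<alpha>). \<l> t $ \<alpha> *
      exp (t * wsum \<omega> (take k (W N \<alpha>))) * wsum \<omega> (take k (W N \<alpha>)) * \<r> t $ (W N \<alpha> ! k))" for \<alpha>
  proof -
    have "(\<Sum>\<beta>\<in>UNIV. \<l> t $ \<alpha> * D t \<alpha> \<beta> * \<r> t $ \<beta>) = (\<Sum>\<beta>\<in>UNIV. \<Sum>k<length (W N \<alpha>). \<l> t $ \<alpha> *
      exp (t * wsum \<omega> (take k (W N \<alpha>))) * wsum \<omega> (take k (W N \<alpha>)) * (of_bool (W N \<alpha> ! k = \<beta>) * \<r> t $ \<beta>))"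
      unfolding D_def sum_distrib_left sum_distrib_right by (simp add: mult.assoc)
    also have "\<dots> = (\<Sum>k<length (W N \<alpha>). \<Sum>\<beta>\<in>UNIV. \<l> t $ \<alpha> *
      exp (t * wsum \<omega> (take k (W N \<alpha>))) * wsum \<omega> (take k (W N \<alpha>)) * (of_bool (W N \<alpha> ! k = \<beta>) * \<r> t $ \<beta>))"
      by (rule sum.swap)
    also have "\<dots> = (\<Sum>k<length (W N \<alpha>). \<l> t $ \<alpha> *
      exp (t * wsum \<omega> (take k (W N \<alpha>))) * wsum \<omega> (take k (W N \<alpha>)) * \<r> t $ (W N \<alpha> ! k))"
      unfolding sum_distrib_left[symmetric]
      by (rule sum.cong) (auto simp: of_bool_def if_distrib if_distribR cong: if_cong)
    finally show ?thesis .
  qed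
  then have "\<rho>' t = 1 / pf_eigenvalue (M t) *
      (\<Sum>\<alpha>\<in>UNIV. \<Sum>\<beta>\<in>UNIV. \<l> t $ \<alpha> * D t \<alpha> \<beta> * \<r> t $ \<beta>)"
    by (simp add: \<rho>'_def exp_minus exp_\<rho> field_simps)
  then show ?thesis using deriv by simp
qed

lemma Aff_period:
  assumes "f \<in> Aff T (t *\<^sub>R \<omega>)"
  shows "rotation_number f = rotation_number T" "renormalizable_aiet f" "is_aiet f"
    "aiet_domain f = {0..<1}" "logslope f = t *\<^sub>R \<omega>"
  using assms Aff_renormalizable[OF T.renormalizable_aiet_axioms assms] by (auto simp: Aff_def)

text \<open>Lets statements about \<open>Aff\<close> apply to measures living on \<open>T\<close>,
  with length parameter 0.\<close>

lemma T_in_Aff: "T \<in> Aff T (0 *\<^sub>R \<omega>)"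
  using iet domain infinite by (simp add: Aff_def is_iet_def)

text \<open>The mass vectors of orders \<open>j * N\<close> form an infinite backward orbit of
  \<open>M s\<close>, and total mass 1 at order 0 fixes its scale, so
  \<open>backward_orbit_eq\<close> leaves no freedom.\<close>

lemma conformal_measure_rv_interval:
  assumes f: "f \<in> Aff T (t *\<^sub>R \<omega>)" and m: "conformal_on f (s *\<^sub>R \<omega>) m"
  shows "measure m (rv_interval f (j * N) \<alpha>) = exp (- real j * \<rho> s) * \<l> s $ \<alpha>"
proof -
  interpret renormalizable_aiet f using Aff_period[OF f] by blast
  interpret prob_space m using m by (simp add: conformal_on_def)
  have rot: "rotation_number f = rotation_number T" using Aff_period[OF f] by blast
  define x where "x j = (\<chi> \<alpha>. measure m (rv_interval f (j * N) \<alpha>))" for j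
  have "x j = (1 / pf_eigenvalue (M s) ^ j) *s \<l> s"
  proof (rule M.backward_orbit_eq)
    show "0 \<le> x n $ i" for n i by (simp add: x_def)
    show "x n = x (Suc n) v* M s" for n
    proof -
      have "x n $ \<beta> = (x (Suc n) v* M s) $ \<beta>" for \<beta>
      proof -
        \<comment> \<open>Taking \<open>h\<close> to be the indicator of \<open>\<beta>\<close>
          singles out one matrix entry, so that the duality of words and masses becomes the vector
          equation of the orbit.\<close>
        have entry: "twisted_sum (s *\<^sub>R \<omega>) (W N \<alpha>) (\<lambda>\<alpha>. of_bool (\<alpha> = \<beta>)) = M s $ \<alpha> $ \<beta>" for \<alpha>
          unfolding M_mult[symmetric] by (simp add: of_bool_def if_distrib if_distribR cong: if_cong)
        have "(\<Sum>\<alpha>\<in>UNIV. twisted_sum (s *\<^sub>R \<omega>) (rv_words f N \<alpha>) (\<lambda>\<alpha>. of_bool (\<alpha> = \<beta>)) *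
            measure m (rv_interval f (n * N + N) \<alpha>))
          = (\<Sum>\<alpha>\<in>UNIV. of_bool (\<alpha> = \<beta>) * measure m (rv_interval f (n * N) \<alpha>))"
          by (rule measure_rv_interval_add[OF m]) (simp_all only: rot rotation_number_period wsum_period)
        also have "\<dots> = x n $ \<beta>"
          by (simp add: x_def of_bool_def if_distrib if_distribR cong: if_cong)
        finally show ?thesis
          by (simp add: rot entry vector_matrix_mult_def x_def add.commute mult.commute)
      qed
      then show ?thesis by (simp add: vec_eq_iff)
    qed
    have sets: "sets m = sets borel" using m by (simp add: conformal_on_def)
    have "(\<Sum>\<alpha>\<in>UNIV. x 0 $ \<alpha>) = measure m (\<Union>\<alpha>. rv_interval f 0 \<alpha>)"
    proof -
      have "disjoint_family (rv_interval f 0)"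
        using rv_interval_unique unfolding disjoint_family_on_def by blast
      then show ?thesis unfolding x_def
        using rv_interval_borel[of 0] sets by (subst finite_measure_finite_Union) auto
    qed
    also have "(\<Union>\<alpha>. rv_interval f 0 \<alpha>) = aiet_domain f" using UN_aiet_interval[OF is_aiet] by simp
    also have "measure m (aiet_domain f) = 1" using m by (simp add: conformal_on_def)
    finally show "(\<Sum>\<alpha>\<in>UNIV. x 0 $ \<alpha>) = 1" .
  qed
  then have "x j $ \<alpha> = \<l> s $ \<alpha> / exp (\<rho> s) ^ j" by (simp add: exp_\<rho>)
  then show ?thesis by (simp add: x_def exp_minus exp_of_nat_mult[symmetric] field_simps)
qed

text \<open>Order 0 of the preceding formula for Lebesgue measure, which \<open>T\<close>
  preserves.\<close>

lemma len_T: "len T = \<l> 0"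
proof -
  have conf: "conformal_on T (0 *\<^sub>R \<omega>) unit_lebesgue"
    using conformal_on_unit_lebesgue[OF T.is_aiet domain] iet by (simp add: is_iet_def)
  have "len T $ \<alpha> = \<l> 0 $ \<alpha>" for \<alpha>
  proof -
    have "0 < len T $ \<alpha>" using T.is_aiet by (simp add: is_aiet_def)
    then have "measure lborel (aiet_interval T \<alpha>) = len T $ \<alpha>" by (simp add: aiet_interval_def)
    moreover have "aiet_interval T \<alpha> \<subseteq> {0..<1}" using UN_aiet_interval[OF T.is_aiet] domain by blast
    ultimately have "measure unit_lebesgue (aiet_interval T \<alpha>) = len T $ \<alpha>"
      using measure_unit_lebesgue[of "aiet_interval T \<alpha>"] by (simp add: aiet_interval_def)
    then show ?thesis using conformal_measure_rv_interval[OF T_in_Aff conf, of 0 \<alpha>] by simp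
  qed
  then show ?thesis by (simp add: vec_eq_iff)
qed

text \<open>\<open>len T\<close> and \<open>theta T N 0\<close> are the eigenvectors at 0, where the
  weights \<open>exp (0 * S)\<close> are 1; as \<open>S_val\<close> is linear in the vector, the sum
  is \<open>t\<close> times the formula for \<open>\<rho>' 0\<close>.\<close>

lemma G_quantity_eq: "G_quantity T N (t *\<^sub>R \<omega>) = \<rho> t - t * \<rho>' 0"
proof -
  have t0: "theta T N 0 = \<r> 0" by (simp add: theta_def M_def)
  have r0: "rho_T T N = \<rho> 0" by (simp add: rho_T_def \<rho>_def M_0)
  have rt: "rho T N (t *\<^sub>R \<omega>) = \<rho> t" by (simp add: rho_def \<rho>_def M_def)
  have "(\<Sum>\<alpha>\<in>UNIV. \<Sum>i<rv_time T N \<alpha>.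
        theta T N 0 $ visited T N \<alpha> i * exp (- rho_T T N) * len T $ \<alpha> * S_val T N (t *\<^sub>R \<omega>) \<alpha> i) = t * \<rho>' 0"
    unfolding \<rho>'_def t0 r0 len_T T.rv_time_eq sum_distrib_left sum_distrib_right
    by (intro sum.cong refl) (simp add: T.visited_eq T.S_val_eq wsum_scaleR)
  then show ?thesis by (simp add: G_quantity_def rt)
qed

lemma H_quantity_eq: "H_quantity T N (t *\<^sub>R \<omega>) = \<rho> t - t * \<rho>' t"
proof -
  have tt: "theta T N (t *\<^sub>R \<omega>) = \<r> t" by (simp add: theta_def M_def)
  have lt: "ell T N (t *\<^sub>R \<omega>) = \<l> t" by (simp add: ell_def M_def)
  have rt: "rho T N (t *\<^sub>R \<omega>) = \<rho> t" by (simp add: rho_def \<rho>_def M_def)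
  have "(\<Sum>\<alpha>\<in>UNIV. \<Sum>i<rv_time T N \<alpha>.
        theta T N (t *\<^sub>R \<omega>) $ visited T N \<alpha> i * exp (- rho T N (t *\<^sub>R \<omega>)) * ell T N (t *\<^sub>R \<omega>) $ \<alpha> *
        exp (S_val T N (t *\<^sub>R \<omega>) \<alpha> i) * S_val T N (t *\<^sub>R \<omega>) \<alpha> i) = t * \<rho>' t"
    unfolding \<rho>'_def tt rt lt T.rv_time_eq sum_distrib_left sum_distrib_right
    by (intro sum.cong refl) (simp add: T.visited_eq T.S_val_eq wsum_scaleR)
  then show ?thesis by (simp add: H_quantity_def rt)
qed

text \<open>The constant function 1 is at most \<open>\<r> u / c\<close>, and each further period
  applies \<open>M u\<close>, which multiplies this eigenvector by
  \<open>exp (\<rho> u)\<close>.\<close>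

lemma pressure_bound:
  "\<exists>C. \<forall>n. (\<Sum>\<alpha>\<in>UNIV. twisted_sum (u *\<^sub>R \<omega>) (W (n * N) \<alpha>) (\<lambda>_. 1)) \<le> C * exp (real n * \<rho> u)"
proof -
  define c where "c = Min (range (($) (\<r> u)))"
  have "c \<in> range (($) (\<r> u))" unfolding c_def by (rule Min_in) auto
  then have c: "0 < c" using M.pf_right_props(1) by auto
  have c_le: "c \<le> \<r> u $ \<alpha>" for \<alpha> unfolding c_def by (rule Min_le) auto
  have bound: "twisted_sum (u *\<^sub>R \<omega>) (W (n * N) \<alpha>) (\<lambda>_. 1) \<le> exp (\<rho> u) ^ n / c * \<r> u $ \<alpha>" for n \<alpha>
  proof (induction n arbitrary: \<alpha>)
    case 0
    then show ?case using c c_le[of \<alpha>] by simp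
  next
    case (Suc n)
    have "W (Suc n * N) \<alpha> = concat (map (W (n * N)) (W N \<alpha>))"
      using words_add[of "rotation_number T" "n * N" N, OF rotation_number_period] by (simp add: add.commute)
    then have "twisted_sum (u *\<^sub>R \<omega>) (W (Suc n * N) \<alpha>) (\<lambda>_. 1)
      = (\<Sum>\<beta>\<in>UNIV. M u $ \<alpha> $ \<beta> * twisted_sum (u *\<^sub>R \<omega>) (W (n * N) \<beta>) (\<lambda>_. 1))"
      by (simp only: twisted_sum_concat[OF wsum_period] M_mult)
    also have "\<dots> \<le> (\<Sum>\<beta>\<in>UNIV. M u $ \<alpha> $ \<beta> * (exp (\<rho> u) ^ n / c * \<r> u $ \<beta>))"
      by (intro sum_mono mult_left_mono Suc) (simp add: less_imp_le M.pos)
    also have "\<dots> = exp (\<rho> u) ^ n / c * (M u *v \<r> u) $ \<alpha>"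
      by (simp add: matrix_vector_mult_def sum_distrib_left mult_ac)
    also have "\<dots> = exp (\<rho> u) ^ Suc n / c * \<r> u $ \<alpha>"
      by (simp add: M.pf_right_props(2) exp_\<rho>)
    finally show ?case .
  qed
  have "(\<Sum>\<alpha>\<in>UNIV. twisted_sum (u *\<^sub>R \<omega>) (W (n * N) \<alpha>) (\<lambda>_. 1))
      \<le> ((\<Sum>\<alpha>\<in>UNIV. \<r> u $ \<alpha>) / c) * exp (real n * \<rho> u)" for n
  proof -
    have "(\<Sum>\<alpha>\<in>UNIV. twisted_sum (u *\<^sub>R \<omega>) (W (n * N) \<alpha>) (\<lambda>_. 1)) \<le> (\<Sum>\<alpha>\<in>UNIV. exp (\<rho> u) ^ n / c * \<r> u $ \<alpha>)"
      by (rule sum_mono) (rule bound)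
    also have "\<dots> = exp (\<rho> u) ^ n / c * (\<Sum>\<alpha>\<in>UNIV. \<r> u $ \<alpha>)" by (rule sum_distrib_left[symmetric])
    finally show ?thesis by (simp add: exp_of_nat_mult mult.commute)
  qed
  then show ?thesis by blast
qed

text \<open>The cylinders are the floors of the towers of order \<open>n * N\<close>. Their masses
  and lengths are exact Gibbs weights times coordinates of left eigenvectors; these coordinates sum
  to 1, so \<open>K = 1\<close>, and \<open>k\<close> is the smallest of them.\<close>

lemma gibbs_cylinders_Aff:
  assumes f: "f \<in> Aff T (t *\<^sub>R \<omega>)" and m: "conformal_on f (s *\<^sub>R \<omega>) m"
  shows "gibbs_cylinders m (\<lambda>n. SIGMA \<alpha>:UNIV. {..<length (W (n * N) \<alpha>)})
    (\<lambda>n (\<alpha>, j). (aiet_map f ^^ j) ` rv_interval f (n * N) \<alpha>)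
    (\<lambda>n (\<alpha>, j). wsum \<omega> (take j (W (n * N) \<alpha>)))
    s t (\<rho>' s) (Min (range (\<lambda>\<alpha>. min (\<l> s $ \<alpha>) (\<l> t $ \<alpha>)))) 1 \<rho>"
proof -
  interpret renormalizable_aiet f using Aff_period[OF f] by blast
  interpret prob_space m using m by (simp add: conformal_on_def)
  have sets: "sets m = sets borel" using m by (simp add: conformal_on_def)
  have rot: "rotation_number f = rotation_number T" and dom: "aiet_domain f = {0..<1}"
    using Aff_period[OF f] by blast+
  have leb: "conformal_on f (t *\<^sub>R \<omega>) unit_lebesgue"
    using conformal_on_unit_lebesgue[OF is_aiet dom] Aff_period(5)[OF f] by simp
  define k where "k = Min (range (\<lambda>\<alpha>. min (\<l> s $ \<alpha>) (\<l> t $ \<alpha>)))"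
  have "k \<in> range (\<lambda>\<alpha>. min (\<l> s $ \<alpha>) (\<l> t $ \<alpha>))" unfolding k_def by (rule Min_in) auto
  then have k: "0 < k" using M.pf_left_props(1) by auto
  have k_le: "k \<le> \<l> s $ \<alpha>" "k \<le> \<l> t $ \<alpha>" for \<alpha>
  proof -
    have "k \<le> min (\<l> s $ \<alpha>) (\<l> t $ \<alpha>)" unfolding k_def by (rule Min_le) auto
    then show "k \<le> \<l> s $ \<alpha>" "k \<le> \<l> t $ \<alpha>" by auto
  qed
  have le_1: "\<l> u $ \<alpha> \<le> 1" for u \<alpha>
    using member_le_sum[of \<alpha> UNIV "($) (\<l> u)"] M.pf_left_props(1)[of u] M.pf_left_props(3)[of u]
    by (simp add: less_imp_le)
  let ?Q = "\<lambda>n \<alpha> j. (aiet_map f ^^ j) ` rv_interval f (n * N) \<alpha>"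
  let ?S = "\<lambda>n \<alpha> j. wsum \<omega> (take j (W (n * N) \<alpha>))"
  have mass: "measure m' (?Q n \<alpha> j) = \<l> u $ \<alpha> * exp (u * ?S n \<alpha> j - real n * \<rho> u)"
    if m': "conformal_on f (u *\<^sub>R \<omega>) m'" and j: "j < length (W (n * N) \<alpha>)" for m' u n \<alpha> j
  proof -
    have "measure m' (?Q n \<alpha> j) = exp (u * ?S n \<alpha> j) * measure m' (rv_interval f (n * N) \<alpha>)"
      using conformal_on_iterate[OF m' rv_interval_borel order_refl, of j "n * N" \<alpha>] j
      by (simp add: rot wsum_scaleR)
    also have "\<dots> = exp (u * ?S n \<alpha> j) * (exp (- real n * \<rho> u) * \<l> u $ \<alpha>)"
      by (simp only: conformal_measure_rv_interval[OF f m'])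
    also have "\<dots> = \<l> u $ \<alpha> * exp (u * ?S n \<alpha> j - real n * \<rho> u)"
      by (simp add: exp_diff exp_minus field_simps)
    finally show ?thesis .
  qed
  have sub: "?Q n \<alpha> j \<subseteq> {0..<1}" if "j < length (W (n * N) \<alpha>)" for n \<alpha> j
    using itinerary[of _ "n * N" \<alpha> j] that UN_aiet_interval[OF is_aiet] dom unfolding rot by blast
  have Ico: "\<exists>l r. l < r \<and> ?Q n \<alpha> j = {l..<r}" if j: "j < length (W (n * N) \<alpha>)" for n \<alpha> j
  proof -
    obtain l r where lr: "l < r" "rv_interval f (n * N) \<alpha> = {l..<r}" using rv_interval_Ico by blast
    define z where "z = exp (wsum (logslope f) (take j (W (n * N) \<alpha>)))"
    have "affine_on z (aiet_map f ^^ j) {l..<r}"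
      using tower_affine[OF tower aiet_map_affine_on[OF is_aiet], of j "n * N" \<alpha>] j
      unfolding rot lr(2)[symmetric] z_def by simp
    then obtain c where z: "0 < z" "\<forall>y\<in>{l..<r}. (aiet_map f ^^ j) y = c + z * y"
      unfolding affine_on_def by blast
    have "?Q n \<alpha> j = {c + z * l..<c + z * r}"
      unfolding lr(2) by (rule affine_image_atLeastLessThan[OF z(2,1)])
    moreover have "c + z * l < c + z * r" using z lr by simp
    ultimately show ?thesis by blast
  qed
  have leb_mass: "measure lborel (?Q n \<alpha> j) = \<l> t $ \<alpha> * exp (t * ?S n \<alpha> j - real n * \<rho> t)"
    if j: "j < length (W (n * N) \<alpha>)" for n \<alpha> j
    using mass[OF leb j] measure_unit_lebesgue[OF _ sub[OF j]] Ico[OF j] by auto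
  have disj: "\<alpha> = \<alpha>' \<and> j = j'"
    if j: "j < length (W (n * N) \<alpha>)" "j' < length (W (n * N) \<alpha>')"
      and x: "x \<in> ?Q n \<alpha> j" "x \<in> ?Q n \<alpha>' j'" for n \<alpha> j \<alpha>' j' x
  proof -
    have inj: "inj (aiet_map f)" using bij_is_inj[OF bij_aiet_map[OF is_aiet]] .
    \<comment> \<open>If two floors met at different heights, cancelling the smaller height would
      bring a base point back to the bases before its return time.\<close>
    have *: "\<alpha> = \<alpha>' \<and> j = j'"
      if le: "j \<le> j'" and j': "j' < length (W (n * N) \<alpha>')" and y: "y \<in> rv_interval f (n * N) \<alpha>"
        "y' \<in> rv_interval f (n * N) \<alpha>'" and eq: "(aiet_map f ^^ j) y = (aiet_map f ^^ j') y'"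
      for \<alpha> \<alpha>' j j' y y'
    proof -
      have "(aiet_map f ^^ j') y' = (aiet_map f ^^ j) ((aiet_map f ^^ (j' - j)) y')"
        using le by (metis add_diff_inverse_nat comp_apply funpow_add not_less)
      then have yy: "y = (aiet_map f ^^ (j' - j)) y'" using eq inj_fn[OF inj, of j] by (simp add: inj_eq)
      then have "j' - j = 0"
        using itinerary_avoid[OF y(2), of "j' - j" \<alpha>] y(1) j' unfolding rot by fastforce
      then show ?thesis using yy y le rv_interval_unique by auto
    qed
    obtain y y' where "y \<in> rv_interval f (n * N) \<alpha>" "y' \<in> rv_interval f (n * N) \<alpha>'"
      "(aiet_map f ^^ j) y = (aiet_map f ^^ j') y'" using x by auto
    then show ?thesis
      using *[of j j' \<alpha>' y \<alpha> y'] *[of j' j \<alpha> y' \<alpha>' y] j by (cases "j \<le> j'") auto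
  qed
  have cover: "(\<Union>(\<alpha>, j)\<in>(SIGMA \<alpha>:UNIV. {..<length (W (n * N) \<alpha>)}). ?Q n \<alpha> j) = {0..<1}" for n
  proof (intro equalityI subsetI)
    fix z :: real assume "z \<in> {0..<1}"
    then have "z \<in> aiet_domain f" using dom by simp
    then obtain \<alpha> j y where "j < length (W (n * N) \<alpha>)" "y \<in> rv_interval f (n * N) \<alpha>" "z = (aiet_map f ^^ j) y"
      using tower_cover[OF tower[of "n * N"]] unfolding rot by blast
    then show "z \<in> (\<Union>(\<alpha>, j)\<in>(SIGMA \<alpha>:UNIV. {..<length (W (n * N) \<alpha>)}). ?Q n \<alpha> j)" by auto
  next
    fix z assume "z \<in> (\<Union>(\<alpha>, j)\<in>(SIGMA \<alpha>:UNIV. {..<length (W (n * N) \<alpha>)}). ?Q n \<alpha> j)"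
    then obtain \<alpha> j where "j < length (W (n * N) \<alpha>)" "z \<in> ?Q n \<alpha> j" by auto
    then show "z \<in> {0..<1}" using sub by blast
  qed
  have press: "\<exists>C. \<forall>n. (\<Sum>(\<alpha>, j)\<in>(SIGMA \<alpha>:UNIV. {..<length (W (n * N) \<alpha>)}). exp (u * ?S n \<alpha> j)) \<le> C * exp (real n * \<rho> u)" for u
  proof -
    have "(\<Sum>(\<alpha>, j)\<in>(SIGMA \<alpha>:UNIV. {..<length (W (n * N) \<alpha>)}). exp (u * ?S n \<alpha> j))
      = (\<Sum>\<alpha>\<in>UNIV. twisted_sum (u *\<^sub>R \<omega>) (W (n * N) \<alpha>) (\<lambda>_. 1))" for n
      by (subst sum.Sigma[symmetric]) (auto simp: twisted_sum_conv_sum wsum_scaleR)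
    then show ?thesis using pressure_bound[of u] by simp
  qed
  show ?thesis
    unfolding k_def[symmetric]
  proof (unfold_locales, goal_cases)
    case 1 then show ?case by (rule sets)
  next
    case (2 n) then show ?case by auto
  next
    case (3 i n) then show ?case using Ico by auto
  next
    case (4 i n j x) then show ?case using disj by (cases i; cases j) auto
  next
    case (5 n) then show ?case using cover[of n] by simp
  next
    case 6 then show ?case using m dom by (simp add: conformal_on_def)
  next
    case 7 then show ?case by (rule k)
  next
    case (8 i n) then show ?case using leb_mass k_le by (auto intro: mult_right_mono)
  next
    case (9 i n) then show ?case using leb_mass le_1 by (auto intro: mult_right_mono)
  next
    case (10 i n) then show ?case using mass[OF m] k_le by (auto intro: mult_right_mono)
  next
    case (11 i n) then show ?case using mass[OF m] le_1 by (auto intro: mult_right_mono)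
  next
    case (12 u) then show ?case using press[of u] by (simp add: split_beta)
  next
    case 13 then show ?case by (rule has_derivative_\<rho>)
  qed
qed

text \<open>Mass parameter 0 and length parameter \<open>t\<close>: here \<open>ent\<close> is
  \<open>\<rho> 0\<close>, and \<open>lyap\<close> is positive because it is at least
  \<open>ent\<close>.\<close>

lemma dim_H_invariant:
  assumes f: "f \<in> Aff T (t *\<^sub>R \<omega>)" and \<mu>: "invariant_prob f \<mu>"
  shows "dim_H \<mu> = \<rho> 0 / (\<rho> t - \<rho>' 0 * t)"
proof -
  have "conformal_on f (0 *\<^sub>R \<omega>) \<mu>"
    using invariant_prob_conformal_on[OF Aff_period(3)[OF f] \<mu>] by simp
  then interpret gibbs_cylinders \<mu> "\<lambda>n. SIGMA \<alpha>:UNIV. {..<length (W (n * N) \<alpha>)}"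
    "\<lambda>n (\<alpha>, j). (aiet_map f ^^ j) ` rv_interval f (n * N) \<alpha>"
    "\<lambda>n (\<alpha>, j). wsum \<omega> (take j (W (n * N) \<alpha>))"
    0 t "\<rho>' 0" "Min (range (\<lambda>\<alpha>. min (\<l> 0 $ \<alpha>) (\<l> t $ \<alpha>)))" 1 \<rho>
    by (rule gibbs_cylinders_Aff[OF f])
  have e: "ent = \<rho> 0" "lyap = \<rho> t - \<rho>' 0 * t" by (simp_all add: ent_def lyap_def mult.commute)
  then have "0 < \<rho> t - \<rho>' 0 * t" using ent_le_lyap \<rho>_0_pos by simp
  then show ?thesis using dim_H_eq e by simp
qed

text \<open>Mass parameter \<open>t\<close> on \<open>T\<close> itself, where lengths have parameter
  0 and \<open>lyap\<close> is \<open>\<rho> 0\<close>.\<close>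

lemma dim_H_conformal:
  assumes "conformal_prob T (phi T (t *\<^sub>R \<omega>)) \<nu>"
  shows "dim_H \<nu> = (\<rho> t - \<rho>' t * t) / \<rho> 0"
proof -
  interpret gibbs_cylinders \<nu> "\<lambda>n. SIGMA \<alpha>:UNIV. {..<length (W (n * N) \<alpha>)}"
    "\<lambda>n (\<alpha>, j). (aiet_map T ^^ j) ` rv_interval T (n * N) \<alpha>"
    "\<lambda>n (\<alpha>, j). wsum \<omega> (take j (W (n * N) \<alpha>))"
    t 0 "\<rho>' t" "Min (range (\<lambda>\<alpha>. min (\<l> t $ \<alpha>) (\<l> 0 $ \<alpha>)))" 1 \<rho>
    by (rule gibbs_cylinders_Aff[OF T_in_Aff conformal_prob_conformal_on[OF T.renormalizable_aiet_axioms assms]])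
  have "ent = \<rho> t - \<rho>' t * t" "lyap = \<rho> 0" by (simp_all add: ent_def lyap_def mult.commute)
  then show ?thesis using dim_H_eq \<rho>_0_pos by simp
qed

end

section \<open>The identities for the two quantities, the dimension formulas and the derivative
  relation\<close>

theorem theorem5p2:
  fixes T :: "'a::finite aiet" and N :: nat and \<omega> :: "real ^ 'a" and \<rho> :: "real \<Rightarrow> real"
  assumes "2 \<le> CARD('a)"
    and "hyperbolically_self_similar T N"
    and "\<omega> \<noteq> 0" and "ss_matrix T N *v \<omega> = \<omega>"
    and "\<And>t. \<rho> t = ln (pf_eigenvalue (twisted_matrix T N (t *\<^sub>R \<omega>)))"
  shows "(\<forall>t. \<rho> field_differentiable at t)
    \<and> (\<forall>t. G_quantity T N (t *\<^sub>R \<omega>) = \<rho> t - t * deriv \<rho> 0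
          \<and> H_quantity T N (t *\<^sub>R \<omega>) = \<rho> t - t * deriv \<rho> t)
    \<and> (\<forall>f \<mu> \<nu>.
          (\<forall>t. f t \<in> Aff T (t *\<^sub>R \<omega>) \<and> invariant_prob (f t) (\<mu> t)
               \<and> conformal_prob T (phi T (t *\<^sub>R \<omega>)) (\<nu> t)) \<longrightarrow>
          (\<forall>t. dim_H (\<mu> t) = \<rho> 0 / (\<rho> t - deriv \<rho> 0 * t)
               \<and> dim_H (\<nu> t) = (\<rho> t - deriv \<rho> t * t) / \<rho> 0)
          \<and> (\<forall>t. t \<noteq> 0 \<longrightarrow>
               ((\<lambda>s. 1 / (s * dim_H (\<mu> s))) has_real_derivative - dim_H (\<nu> t) / t\<^sup>2) (at t)))"
proof -
  interpret S: self_similar_twist T N \<omega>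
    by unfold_locales
      (use assms(1,2,4) in \<open>auto simp: hyperbolically_self_similar_def self_similar_def\<close>)
  have \<rho>: "\<rho> = S.\<rho>" by (rule ext) (simp add: assms(5) S.\<rho>_def S.M_def)
  have deriv: "deriv S.\<rho> t = S.\<rho>' t" for t
    by (rule DERIV_imp_deriv[OF S.has_derivative_\<rho>])
  show ?thesis
  proof (intro conjI allI impI)
    show "\<rho> field_differentiable at t" for t
      unfolding \<rho> field_differentiable_def using S.has_derivative_\<rho> by blast
    show "G_quantity T N (t *\<^sub>R \<omega>) = \<rho> t - t * deriv \<rho> 0"
      "H_quantity T N (t *\<^sub>R \<omega>) = \<rho> t - t * deriv \<rho> t" for t
      using S.G_quantity_eq S.H_quantity_eq by (simp_all add: deriv \<rho>)
  next
    fix f \<mu> \<nu>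
    assume *: "\<forall>t. f t \<in> Aff T (t *\<^sub>R \<omega>) \<and> invariant_prob (f t) (\<mu> t)
      \<and> conformal_prob T (phi T (t *\<^sub>R \<omega>)) (\<nu> t)"
    have dim_\<mu>: "dim_H (\<mu> t) = \<rho> 0 / (\<rho> t - deriv \<rho> 0 * t)" for t
      using S.dim_H_invariant[of "f t" t "\<mu> t"] * by (simp add: deriv \<rho>)
    have dim_\<nu>: "dim_H (\<nu> t) = (\<rho> t - deriv \<rho> t * t) / \<rho> 0" for t
      using S.dim_H_conformal[of t "\<nu> t"] * by (simp add: deriv \<rho>)
    show "dim_H (\<mu> t) = \<rho> 0 / (\<rho> t - deriv \<rho> 0 * t)"
      "dim_H (\<nu> t) = (\<rho> t - deriv \<rho> t * t) / \<rho> 0" for t by (rule dim_\<mu> dim_\<nu>)+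
    fix t :: real assume t: "t \<noteq> 0"
    have "0 < \<rho> 0" using S.\<rho>_0_pos by (simp add: \<rho>)
    \<comment> \<open>Valid also at \<open>s = 0\<close> or where a denominator vanishes, since
      division by zero gives 0 on both sides. The quotient rule then leaves
      \<open>(t * deriv \<rho> t - \<rho> t) / (t\<^sup>2 * \<rho> 0)\<close>, in which the terms
      with \<open>deriv \<rho> 0\<close> have cancelled.\<close>
    have quot: "(\<lambda>s. 1 / (s * dim_H (\<mu> s))) = (\<lambda>s. (\<rho> s - deriv \<rho> 0 * s) / (s * \<rho> 0))"
      by (rule ext) (simp add: dim_\<mu>)
    have D: "(\<rho> has_real_derivative deriv \<rho> t) (at t)"
      unfolding \<rho> deriv by (rule S.has_derivative_\<rho>)
    show "((\<lambda>s. 1 / (s * dim_H (\<mu> s))) has_real_derivative - dim_H (\<nu> t) / t\<^sup>2) (at t)"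
      unfolding quot dim_\<nu> using t \<open>0 < \<rho> 0\<close>
      by (auto intro!: derivative_eq_intros D simp: power2_eq_square field_simps)
  qed
qed

end
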